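(* Let $n\ge3$, $\lambda\in(1,\infty)$, $\theta=\frac{\lambda-1}{\lambda+1}$, and $\alpha,p\in\mathbb{R}$ with $1<p<n+\alpha$. For $\varepsilon>0$ let $F_\varepsilon(x,y)=|y|-\frac{\langle x,y\rangle(|x|+2\varepsilon)\theta}{(|x|+\varepsilon)^2}$ on $\mathbb{R}^n\times\mathbb{R}^n$, $\mathsf{m}_\varepsilon$ its Busemann--Hausdorff measure, $\rho_\varepsilon=d_{F_\varepsilon}(0,\cdot)$, and $\mathcal{F}_{0,0,\lambda}=\{(\mathbb{R}^n,F_\varepsilon,\mathsf{m}_\varepsilon)\}_{\varepsilon>0}$. Then for every $\varepsilon>0$ and $u\in C_0^\infty(\mathbb{R}^n)$, \[\lambda^p\int_{\mathbb{R}^n}\rho_\varepsilon^\alpha F^*_\varepsilon(Du)^p\,\mathrm{d}\mathsf{m}_\varepsilon\ \ge\ c_{n,p,\alpha}\int_{\mathbb{R}^n}\rho_\varepsilon^\alpha\frac{|u|^p}{\rho_\varepsilon^p}\,\mathrm{d}\mathsf{m}_\varepsilon,\qquad c_{n,p,\alpha}=\Big(\frac{n+\alpha-p}{p}\Big)^p.\] Moreover $c_{n,p,\alpha}$ is sharp in $\mathcal{F}_{0,0,\lambda}$: it is the greatest constant for which this inequality holds for every $\varepsilon>0$ and every $u\in C_0^\infty(\mathbb{R}^n)$.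
   Context: $|\cdot|,\langle\cdot,\cdot\rangle$ are Euclidean. $d_F(x_0,x_1)$ is the infimum of $\int_0^1F(c,\dot c)\,dt$ over Lipschitz curves from $x_0$ to $x_1$. Busemann--Hausdorff measure: density $\sigma_F(x)=\mathrm{vol}(\mathbb{B}^n)/\mathrm{vol}\{y:F(x,y)<1\}$. $F^*_\varepsilon(x,\xi)=\sup_{y\ne0}\xi(y)/F_\varepsilon(x,y)$ is the dual metric and $Du$ the differential of $u$. *)

theory Defs
  imports "HOL-Analysis.Analysis"
begin

coinductive smooth_fun :: "(real^'n \<Rightarrow> real) \<Rightarrow> bool" where
  "(\<forall>x. f differentiable (at x)) \<Longrightarrow>
   (\<forall>i. smooth_fun (\<lambda>x. frechet_derivative f (at x) (axis i 1))) \<Longrightarrow> smooth_fun f"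

definition C0_infty :: "(real^'n \<Rightarrow> real) set" where
  "C0_infty = {u. smooth_fun u \<and> compact (closure {x. u x \<noteq> 0})}"

definition F_eps :: "real \<Rightarrow> real \<Rightarrow> real^'n \<Rightarrow> real^'n \<Rightarrow> real" where
  "F_eps \<theta> \<epsilon> x y = norm y - (x \<bullet> y) * (norm x + 2 * \<epsilon>) * \<theta> / (norm x + \<epsilon>)\<^sup>2"

definition finsler_dist :: "(real^'n \<Rightarrow> real^'n \<Rightarrow> real) \<Rightarrow> real^'n \<Rightarrow> real^'n \<Rightarrow> real" where
  "finsler_dist F x0 x1 = Inf {integral {0..1} (\<lambda>t. F (c t) (vector_derivative c (at t within {0..1}))) | c.
       (\<exists>L. L-lipschitz_on {0..1} c) \<and> c 0 = x0 \<and> c 1 = x1}"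

definition BH_density :: "(real^'n \<Rightarrow> real^'n \<Rightarrow> real) \<Rightarrow> real^'n \<Rightarrow> real" where
  "BH_density F x = measure lebesgue (ball (0::real^'n) 1) / measure lebesgue {y. F x y < 1}"

definition BH_measure :: "(real^'n \<Rightarrow> real^'n \<Rightarrow> real) \<Rightarrow> (real^'n) measure" where
  "BH_measure F = density lborel (\<lambda>x. ennreal (BH_density F x))"

definition dual_metric :: "(real^'n \<Rightarrow> real^'n \<Rightarrow> real) \<Rightarrow> real^'n \<Rightarrow> (real^'n \<Rightarrow> real) \<Rightarrow> real" where
  "dual_metric F x \<xi> = (SUP y\<in>-{0}. \<xi> y / F x y)"

end

theory Submission
  imports Defs
begin

text \<open>
  \<open>F_eps\<close> is the Randers metric \<open>norm y - Df(x) y\<close> with \<open>f x = \<theta> r\<^sup>2 / (r + \<epsilon>)\<close>, \<open>r = norm x\<close>; since \<open>Df\<close> is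
  exact, rays from the origin are shortest and the distance is \<open>\<rho> = r - f\<close>, with \<open>\<rho>' = 1 - h\<close>. The unit
  balls are ellipsoids, so the Busemann--Hausdorff density is \<open>(1 - h\<^sup>2)\<close> to the power \<open>(n + 1) / 2\<close>.
  Relative to \<open>\<rho>^(n-1) d\<rho>\<close> this density is nondecreasing along rays. Together with
  \<open>\<lambda> F\<^sup>* (Du) \<ge> \<bar>\<partial>u/\<partial>\<rho>\<bar>\<close> this reduces the inequality to the one-dimensional weighted Hardy inequality,
  which is carried out without polar coordinates: \<open>u\<close> is integrated along rays, the dilations are
  undone by Fubini's theorem, and Young's inequality closes the argument.
  For sharpness, at infinity \<open>\<lambda> F\<^sup>* (Du)\<close> and \<open>\<bar>\<partial>u/\<partial>\<rho>\<bar>\<close> agree asymptotically for radially decreasing \<open>u\<close>.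
  Smoothly truncated powers \<open>r powr (- (n + \<alpha> - p) / p)\<close> make both sides grow like the logarithm of the
  truncation radius, up to bounded errors from the origin and from the cutoff.
\<close>

section \<open>Lipschitz curves and the distance from the origin\<close>

text \<open>The factor \<open>lam\<close> is the price of irreversibility. A covector at x is tested
  on x and on -x, whose lengths are in the ratio (1 - h) : (1 + h), and \<open>lam\<close> is the
  supremum of (1 + h) / (1 - h) over h in [0, \<theta>]. It is approached only far from the origin
  and for inward pointing covectors, whatever the value of \<epsilon>. So sharpness lives at
  infinity, uses decreasing functions, and is decided by a single \<epsilon>. The constant comes
  from the integral of \<rho>^(\<beta>-1), which is \<rho>^\<beta> / \<beta> with \<beta> = n +
  \<alpha> - p; Young's inequality is weighted with \<beta> / p so that its first term can be
  absorbed. Two obstacles shape the proof. The integrals may be infinite, so absorption is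
  legitimate only after a small ball around the origin has been cut out; the ball is shrunk
  afterwards. The distance is an infimum over Lipschitz curves, whose derivative exists only almost
  everywhere, so exactness of the drift can be exploited only through an almost everywhere
  fundamental theorem of calculus.\<close>

lemma absolutely_continuous_interval_measure:
  fixes g \<psi> :: "real \<Rightarrow> real"
  assumes g: "continuous_on UNIV g" "mono g" and p: "continuous_on UNIV \<psi>" "mono \<psi>"
    and s: "\<And>t. g t + \<psi> t = t"
  shows "absolutely_continuous lborel (interval_measure g)"
proof -
  let ?m = "\<lambda>A. emeasure (interval_measure g) A + emeasure (interval_measure \<psi>) A"
  define M where "M = measure_of UNIV (sets borel) ?m"
  have sM: "sets M = sets borel"
    unfolding M_def using sets.sigma_sets_eq[of "borel :: real measure"] by (simp add: sets_measure_of)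
  have eM: "emeasure M A = ?m A" if "A \<in> sets borel" for A
    unfolding M_def
  proof (rule emeasure_measure_of_sigma)
    show "sigma_algebra (UNIV :: real set) (sets borel)"
      using sets.sigma_algebra_axioms[of "borel :: real measure"] by simp
    show "positive (sets borel) ?m" by (simp add: positive_def)
    show "countably_additive (sets borel) ?m"
    proof (rule countably_additiveI)
      fix A :: "nat \<Rightarrow> real set"
      assume A: "range A \<subseteq> sets borel" "disjoint_family A" "(\<Union>i. A i) \<in> sets borel"
      have "(\<Sum>i. emeasure (interval_measure g) (A i) + emeasure (interval_measure \<psi>) (A i))
          = (\<Sum>i. emeasure (interval_measure g) (A i)) + (\<Sum>i. emeasure (interval_measure \<psi>) (A i))"
        by (rule suminf_add[symmetric]) auto
      also have "\<dots> = ?m (\<Union>i. A i)"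
        using A by (subst (1 2) suminf_emeasure) auto
      finally show "(\<Sum>i. ?m (A i)) = ?m (\<Union>i. A i)" .
    qed
    show "A \<in> sets borel" by fact
  qed
  \<comment> \<open>\<open>lborel_eqI\<close> tests a measure on open boxes; continuity of
    \<open>f\<close> makes the endpoints null, so the half-open value carries over.\<close>
  have Ioo: "emeasure (interval_measure f) {l<..<u} = f u - f l"
    if f: "continuous_on UNIV f" "mono f" and lu: "l \<le> u" for f :: "real \<Rightarrow> real" and l u
  proof -
    have pt: "emeasure (interval_measure f) {u} = 0"
      using emeasure_interval_measure_Icc[of u u f] f monoD[OF f(2)] by auto
    have Ioc: "emeasure (interval_measure f) {l<..u} = f u - f l"
      by (rule emeasure_interval_measure_Ioc[OF lu])
        (use f monoD[OF f(2)] in \<open>auto simp: continuous_on_eq_continuous_at continuous_at_imp_continuous_at_within\<close>)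
    show ?thesis
    proof (cases "l = u")
      case False
      then have "{l<..<u} = {l<..u} - {u}" by auto
      moreover have "emeasure (interval_measure f) ({l<..u} - {u}) = emeasure (interval_measure f) {l<..u}"
        using pt by (intro emeasure_Diff_null_set) (auto simp: null_sets_def)
      ultimately show ?thesis using Ioc by simp
    qed simp
  qed
  \<comment> \<open>Since \<open>g\<close> and \<open>\<psi>\<close> add up to the identity, their
    interval measures add up to Lebesgue measure. A Lebesgue null set is then null for each
    summand.\<close>
  have "lborel = M"
  proof (rule lborel_eqI)
    fix l u :: real assume "\<And>b. b \<in> Basis \<Longrightarrow> l \<bullet> b \<le> u \<bullet> b"
    then have lu: "l \<le> u" by simp
    have "emeasure M (box l u) = ennreal (g u - g l) + ennreal (\<psi> u - \<psi> l)"
      using lu g p by (simp add: eM Ioo box_real)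
    also have "\<dots> = ennreal (u - l)"
    proof (subst ennreal_plus[symmetric])
      show "0 \<le> g u - g l" "0 \<le> \<psi> u - \<psi> l" using monoD[OF g(2) lu] monoD[OF p(2) lu] by auto
      show "ennreal (g u - g l + (\<psi> u - \<psi> l)) = ennreal (u - l)"
        using s[of u] s[of l] by (intro arg_cong[of _ _ ennreal]) linarith
    qed
    finally show "emeasure M (box l u) = (\<Prod>b\<in>Basis. (u - l) \<bullet> b)" by simp
  qed (rule sM)
  then show ?thesis
    unfolding absolutely_continuous_def null_sets_def using eM by auto
qed

text \<open>Rademacher's theorem on the line, together with the fundamental theorem of calculus.
  After division by a Lipschitz constant, t plus \<phi> and t minus \<phi> are both monotone and
  their halves sum to t. So the first half has an absolutely continuous interval measure;
  Radon-Nikodym gives a density, and Lebesgue differentiation identifies it with the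
  derivative.\<close>

lemma lipschitz_real_ae_derivative:
  fixes \<phi> :: "real \<Rightarrow> real"
  assumes "L-lipschitz_on UNIV \<phi>"
  obtains D N where "negligible N" "\<And>t. t \<notin> N \<Longrightarrow> (\<phi> has_real_derivative D t) (at t)"
    "\<And>a b. a \<le> b \<Longrightarrow> (D has_integral (\<phi> b - \<phi> a)) {a..b}"
    "\<And>a b. a \<le> b \<Longrightarrow> D absolutely_integrable_on {a..b}"
proof -
  \<comment> \<open>A strictly positive Lipschitz constant, so that dividing by it is harmless even
    for L = 0.\<close>
  define K where "K = L + 1"
  have K: "K > 0" unfolding K_def using lipschitz_on_nonneg[OF assms] by simp
  have lip: "\<bar>\<phi> x - \<phi> y\<bar> \<le> K * \<bar>x - y\<bar>" for x y
    using lipschitz_onD[OF assms, of x y] abs_ge_zero[of "x - y"]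
    unfolding K_def by (simp add: dist_real_def algebra_simps)
  have cont: "continuous_on UNIV \<phi>" by (rule lipschitz_on_continuous_on[OF assms])
  define g where "g t = (\<phi> t / K + t) / 2" for t
  define \<psi> where "\<psi> t = (t - \<phi> t / K) / 2" for t
  have ab: "\<bar>\<phi> x / K - \<phi> y / K\<bar> \<le> \<bar>x - y\<bar>" for x y
    using lip[of x y] K by (simp add: diff_divide_distrib[symmetric] divide_simps mult.commute)
  have mg: "mono g" unfolding mono_def g_def using ab by (smt (verit) divide_right_mono)
  have mp: "mono \<psi>" unfolding mono_def \<psi>_def using ab by (smt (verit) divide_right_mono)
  have cg: "continuous_on UNIV g" unfolding g_def using K by (intro continuous_intros cont) auto
  have cp: "continuous_on UNIV \<psi>" unfolding \<psi>_def using K by (intro continuous_intros cont) auto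
  have "absolutely_continuous lborel (interval_measure g)"
    by (rule absolutely_continuous_interval_measure[OF cg mg cp mp]) (simp add: g_def \<psi>_def field_simps)
  then obtain E where E: "E \<in> borel_measurable lborel" "density lborel E = interval_measure g"
    using sigma_finite_measure.Radon_Nikodym[OF sigma_finite_lborel] by fastforce
  have [measurable]: "E \<in> borel_measurable borel" using E(1) by simp
  have EI: "(\<integral>\<^sup>+x. E x * indicator {a..b} x \<partial>lborel) = ennreal (g b - g a)" if "a \<le> b" for a b
  proof -
    have "(\<integral>\<^sup>+x. E x * indicator {a..b} x \<partial>lborel) = emeasure (density lborel E) {a..b}"
      by (subst emeasure_density) auto
    also have "\<dots> = ennreal (g b - g a)"
      unfolding E(2) using emeasure_interval_measure_Icc[of a b g] that monoD[OF mg] cg by auto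
    finally show ?thesis .
  qed
  \<comment> \<open>The density integrates to a finite value over every bounded interval, so it is
    infinite only on a null set and may be replaced by a real function.\<close>
  have fin: "AE x in lborel. E x \<noteq> \<infinity>"
  proof -
    have "AE x in lborel. \<forall>n::nat. E x * indicator {-real n..real n} x \<noteq> \<infinity>"
      unfolding AE_all_countable
      by (intro allI nn_integral_PInf_AE) (auto simp: EI)
    then show ?thesis
    proof (rule eventually_mono)
      fix x assume *: "\<forall>n::nat. E x * indicator {-real n..real n} x \<noteq> \<infinity>"
      obtain n :: nat where "\<bar>x\<bar> \<le> real n" using real_arch_simple by blast
      then show "E x \<noteq> \<infinity>" using *[rule_format, of n] by (auto simp: indicator_def abs_le_iff)
    qed
  qed
  define G where "G x = enn2real (E x)" for x
  have [measurable]: "G \<in> borel_measurable borel" unfolding G_def by measurable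
  have GI: "(G has_integral (g b - g a)) {a..b}" if "a \<le> b" for a b
  proof -
    have "(\<integral>\<^sup>+x. ennreal (G x * indicator {a..b} x) \<partial>lborel) = (\<integral>\<^sup>+x. E x * indicator {a..b} x \<partial>lborel)"
      by (rule nn_integral_cong_AE, use fin in eventually_elim)
        (auto simp: G_def indicator_def ennreal_enn2real_if top.not_eq_extremum)
    then have "((\<lambda>x. G x * indicator {a..b} x) has_integral (g b - g a)) UNIV"
      using monoD[OF mg that] EI[OF that]
      by (intro nn_integral_has_integral) (auto simp: G_def)
    moreover have "(\<lambda>x. G x * indicator {a..b} x) = (\<lambda>x. if x \<in> {a..b} then G x else 0)"
      by (auto simp: indicator_def)
    ultimately show ?thesis by (simp only: has_integral_restrict_UNIV)
  qed
  have Gi: "G integrable_on cbox a b" for a b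
    using GI[of a b] by (cases "a \<le> b") (auto simp: integrable_on_def)
  have Gr: "(\<lambda>x. G (- x)) integrable_on cbox a b" for a b
    using Gi[of "-b" "-a"] integrable_reflect[of G "-a" "-b"]  by simp
  obtain N1 where N1: "negligible N1" "\<And>x e. \<lbrakk>x \<notin> N1; 0 < e\<rbrakk> \<Longrightarrow> \<exists>d>0. \<forall>h. 0 < h \<and> h < d \<longrightarrow>
      norm (integral (cbox x (x + h *\<^sub>R One)) G /\<^sub>R h ^ DIM(real) - G x) < e"
    using integrable_ccontinuous_explicit[OF Gi] by metis
  obtain N2 where N2: "negligible N2" "\<And>x e. \<lbrakk>x \<notin> N2; 0 < e\<rbrakk> \<Longrightarrow> \<exists>d>0. \<forall>h. 0 < h \<and> h < d \<longrightarrow>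
      norm (integral (cbox x (x + h *\<^sub>R One)) (\<lambda>x. G (- x)) /\<^sub>R h ^ DIM(real) - G (- x)) < e"
    using integrable_ccontinuous_explicit[OF Gr] by metis
  have neg2: "negligible (uminus ` N2)"
    by (rule negligible_differentiable_image_negligible[OF _ N2(1)]) (auto simp: differentiable_on_def)
  have der: "(g has_real_derivative G t) (at t)" if t: "t \<notin> N1 \<union> uminus ` N2" for t
    unfolding DERIV_def LIM_def
  proof (intro allI impI)
    fix e :: real assume e: "e > 0"
    obtain d1 where d1: "d1 > 0" "\<And>h. 0 < h \<and> h < d1 \<Longrightarrow>
        norm (integral (cbox t (t + h *\<^sub>R One)) G /\<^sub>R h ^ DIM(real) - G t) < e"
      using N1(2)[of t e] t e by auto
    have "- t \<notin> N2" using t by force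
    then obtain d2 where d2: "d2 > 0" "\<And>h. 0 < h \<and> h < d2 \<Longrightarrow>
        norm (integral (cbox (-t) (-t + h *\<^sub>R One)) (\<lambda>x. G (- x)) /\<^sub>R h ^ DIM(real) - G t) < e"
      using N2(2)[of "-t" e] e by auto
    have "dist ((g (t + h) - g t) / h) (G t) < e" if h: "h \<noteq> 0" "\<bar>h\<bar> < min d1 d2" for h
    proof (cases "h > 0")
      case True
      then have "integral {t..t+h} G = g (t + h) - g t" using GI[of t "t+h"] by (simp add: integral_unique)
      then show ?thesis using d1(2)[of h] True h by (simp add: dist_real_def field_simps)
    next
      case False
      define k where "k = - h"
      have k: "k > 0" "k < d2" using False h unfolding k_def by auto
      have "integral {-t..-t+k} (\<lambda>x. G (- x)) = g t - g (t - k)"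
        using GI[of "t-k" t] k has_integral_reflect_real[of G "g t - g (t - k)" t "t - k"]
        by (intro integral_unique) (simp add: algebra_simps)
      then have "\<bar>(g t - g (t - k)) / k - G t\<bar> < e" using d2(2)[of k] k by (simp add: field_simps)
      moreover have "(g t - g (t - k)) / k = (g (t + h) - g t) / h"
        unfolding k_def using h by (simp add: field_simps)
      ultimately show ?thesis by (simp add: dist_real_def)
    qed
    then show "\<exists>s>0. \<forall>x. x \<noteq> 0 \<and> dist x 0 < s \<longrightarrow> dist ((g (t + x) - g t) / x) (G t) < e"
      using d1(1) d2(1) by (intro exI[of _ "min d1 d2"]) (auto simp: dist_real_def)
  qed
  have \<phi>g: "\<phi> = (\<lambda>t. K * (2 * g t - t))" unfolding g_def using K by (auto simp: field_simps)
  define D where "D t = K * (2 * G t - 1)" for t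
  show thesis
  proof
    show "negligible (N1 \<union> uminus ` N2)" using N1(1) neg2 by (rule negligible_Un)
    show "(\<phi> has_real_derivative D t) (at t)" if "t \<notin> N1 \<union> uminus ` N2" for t
      unfolding \<phi>g D_def using der[OF that] by (auto intro!: derivative_eq_intros)
    fix a b :: real assume "a \<le> b"
    have "((\<lambda>t. K * (2 * G t - 1)) has_integral (K * (2 * (g b - g a) - (b - a)))) {a..b}"
      using has_integral_const_real[of "1::real" a b] \<open>a \<le> b\<close>
      by (intro has_integral_mult_right has_integral_diff GI) auto
    moreover have "K * (2 * (g b - g a) - (b - a)) = \<phi> b - \<phi> a" unfolding g_def using K by (simp add: field_simps)
    ultimately show "(D has_integral (\<phi> b - \<phi> a)) {a..b}" unfolding D_def by simp
    have "G absolutely_integrable_on {a..b}"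
      using GI[OF \<open>a \<le> b\<close>] by (intro nonnegative_absolutely_integrable_1) (auto simp: G_def integrable_on_def)
    then show "D absolutely_integrable_on {a..b}"
      unfolding D_def by (intro set_integrable_mult_right set_integral_diff(1)) 
        (auto intro!: absolutely_integrable_continuous_real continuous_intros)
  qed
qed

lemma lipschitz_ae_vector_derivative:
  fixes c :: "real \<Rightarrow> 'a::euclidean_space"
  assumes "L-lipschitz_on {0..1} c"
  obtains D N where "negligible N"
    "\<And>t. t \<in> {0..1} - N \<Longrightarrow> (c has_vector_derivative D t) (at t within {0..1})"
    "(D has_integral (c 1 - c 0)) {0..1}" "D absolutely_integrable_on {0..1}"
proof -
  \<comment> \<open>Clamping the parameter extends \<open>c\<close> by constants to the whole line
    with the same Lipschitz constant, so the scalar lemma applies to each coordinate.\<close>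
  define cl :: "real \<Rightarrow> real" where "cl t = max 0 (min 1 t)" for t
  have cl: "cl t \<in> {0..1}" "\<bar>cl s - cl t\<bar> \<le> \<bar>s - t\<bar>" for s t by (auto simp: cl_def)
  have L: "L \<ge> 0" by (rule lipschitz_on_nonneg[OF assms])
  have "L-lipschitz_on UNIV (\<lambda>t. c (cl t) \<bullet> b)" if b: "b \<in> Basis" for b
  proof (rule lipschitz_onI)
    fix s t
    have "dist (c (cl s) \<bullet> b) (c (cl t) \<bullet> b) \<le> dist (c (cl s)) (c (cl t))"
      using Basis_le_norm[OF b, of "c (cl s) - c (cl t)"] by (simp add: dist_norm inner_diff_left)
    also have "\<dots> \<le> L * dist (cl s) (cl t)" using lipschitz_onD[OF assms cl(1) cl(1)] .
    also have "\<dots> \<le> L * dist s t" using L cl(2) by (intro mult_left_mono) (auto simp: dist_real_def)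
    finally show "dist (c (cl s) \<bullet> b) (c (cl t) \<bullet> b) \<le> L * dist s t" .
  qed (rule L)
  then have "\<forall>b\<in>Basis. \<exists>D N. negligible N \<and>
      (\<forall>t. t \<notin> N \<longrightarrow> ((\<lambda>t. c (cl t) \<bullet> b) has_real_derivative D t) (at t)) \<and>
      (D has_integral (c 1 \<bullet> b - c 0 \<bullet> b)) {0..1} \<and> D absolutely_integrable_on {0..1}"
  proof (intro ballI)
    fix b :: 'a assume lb: "b \<in> Basis" and *: "\<And>b::'a. b \<in> Basis \<Longrightarrow> L-lipschitz_on UNIV (\<lambda>t. c (cl t) \<bullet> b)"
    obtain D N where DN: "negligible N" "\<And>t. t \<notin> N \<Longrightarrow> ((\<lambda>t. c (cl t) \<bullet> b) has_real_derivative D t) (at t)"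
      "\<And>u v. u \<le> v \<Longrightarrow> (D has_integral (c (cl v) \<bullet> b - c (cl u) \<bullet> b)) {u..v}"
      "\<And>u v. u \<le> v \<Longrightarrow> D absolutely_integrable_on {u..v}"
      by (rule lipschitz_real_ae_derivative[OF *[OF lb]]) blast
    then show "\<exists>D N. negligible N \<and>
      (\<forall>t. t \<notin> N \<longrightarrow> ((\<lambda>t. c (cl t) \<bullet> b) has_real_derivative D t) (at t)) \<and>
      (D has_integral (c 1 \<bullet> b - c 0 \<bullet> b)) {0..1} \<and> D absolutely_integrable_on {0..1}"
      using DN(3)[of 0 1] by (intro exI[of _ D] exI[of _ N]) (auto simp: cl_def)
  qed
  then obtain D N where DN: "\<And>b. b \<in> Basis \<Longrightarrow> negligible (N b)"
      "\<And>b t. b \<in> Basis \<Longrightarrow> t \<notin> N b \<Longrightarrow> ((\<lambda>t. c (cl t) \<bullet> b) has_real_derivative D b t) (at t)"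
      "\<And>b. b \<in> Basis \<Longrightarrow> (D b has_integral (c 1 \<bullet> b - c 0 \<bullet> b)) {0..1}"
      "\<And>b. b \<in> Basis \<Longrightarrow> D b absolutely_integrable_on {0..1}"
    by metis
  define E where "E t = (\<Sum>b\<in>Basis. D b t *\<^sub>R b)" for t
  show thesis
  proof
    show "negligible (\<Union>b\<in>Basis. N b)" using DN(1) by (intro negligible_Union finite_imageI finite_Basis) blast
    show "(c has_vector_derivative E t) (at t within {0..1})" if t: "t \<in> {0..1} - (\<Union>b\<in>Basis. N b)" for t
    proof -
      have "((\<lambda>s. \<Sum>b\<in>Basis. (c (cl s) \<bullet> b) *\<^sub>R b) has_vector_derivative E t) (at t within {0..1})"
        unfolding E_def
      proof (rule has_vector_derivative_sum)
        fix b :: 'a assume b: "b \<in> Basis"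
        have "((\<lambda>s. c (cl s) \<bullet> b) has_vector_derivative D b t) (at t within {0..1})"
          using DN(2)[OF b, of t] t b has_vector_derivative_at_within
          by (fastforce simp: has_real_derivative_iff_has_vector_derivative)
        then show "((\<lambda>s. (c (cl s) \<bullet> b) *\<^sub>R b) has_vector_derivative D b t *\<^sub>R b) (at t within {0..1})"
          by (rule bounded_linear.has_vector_derivative[OF bounded_linear_scaleR_left])
      qed
      then show ?thesis
      proof (rule has_vector_derivative_transform[rotated 2])
        show "c s = (\<Sum>b\<in>Basis. (c (cl s) \<bullet> b) *\<^sub>R b)" if "s \<in> {0..1}" for s
          using that by (simp add: euclidean_representation cl_def)
      qed (use t in auto)
    qed
    have "(E has_integral (\<Sum>b\<in>Basis. (c 1 \<bullet> b - c 0 \<bullet> b) *\<^sub>R b)) {0..1}"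
      unfolding E_def by (rule has_integral_sum[OF finite_Basis has_integral_scaleR_left[OF DN(3)]])
    then show "(E has_integral (c 1 - c 0)) {0..1}"
      by (simp add: inner_diff_left[symmetric] euclidean_representation)
    show "E absolutely_integrable_on {0..1}"
      unfolding E_def using DN(4)
      by (intro absolutely_integrable_sum finite_Basis set_integrable_scaleR_left)
  qed
qed

section \<open>The potential of the drift and the distance from the origin\<close>

definition pot :: "real \<Rightarrow> real \<Rightarrow> real^'n \<Rightarrow> real" where
  "pot \<theta> \<epsilon> x = \<theta> * (norm x)\<^sup>2 / (norm x + \<epsilon>)"

text \<open>The derivative in r of \<theta> r^2 / (r + \<epsilon>), hence the norm of the
  differential of \<open>pot\<close> at radius r. It equals \<theta> (1 - (\<epsilon> / (r +
  \<epsilon>))^2), which increases from 0 towards \<theta>.\<close>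

definition drift :: "real \<Rightarrow> real \<Rightarrow> real \<Rightarrow> real" where
  "drift \<theta> \<epsilon> r = \<theta> * r * (r + 2 * \<epsilon>) / (r + \<epsilon>)\<^sup>2"

definition rad :: "real \<Rightarrow> real \<Rightarrow> real \<Rightarrow> real" where
  "rad \<theta> \<epsilon> r = r - \<theta> * r\<^sup>2 / (r + \<epsilon>)"

lemma drift_bounds:
  assumes "0 \<le> \<theta>" "\<epsilon> > 0" "r \<ge> 0"
  shows "0 \<le> drift \<theta> \<epsilon> r" "drift \<theta> \<epsilon> r \<le> \<theta>"
proof -
  show "0 \<le> drift \<theta> \<epsilon> r" using assms by (simp add: drift_def)
  have "r * (r + 2 * \<epsilon>) \<le> (r + \<epsilon>)\<^sup>2" by (simp add: power2_eq_square algebra_simps)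
  then have "\<theta> * (r * (r + 2 * \<epsilon>)) \<le> \<theta> * (r + \<epsilon>)\<^sup>2" using assms by (intro mult_left_mono)
  then show "drift \<theta> \<epsilon> r \<le> \<theta>" using assms by (simp add: drift_def divide_simps mult.assoc)
qed

lemma rad_has_derivative:
  assumes "r + \<epsilon> > 0"
  shows "(rad \<theta> \<epsilon> has_real_derivative (1 - drift \<theta> \<epsilon> r)) (at r)"
  unfolding rad_def[abs_def] drift_def using assms
  by (auto intro!: derivative_eq_intros simp: field_simps power2_eq_square)

lemma pot_has_derivative:
  fixes x :: "real^'n"
  assumes e: "\<epsilon> > 0"
  shows "(pot \<theta> \<epsilon> has_derivative (\<lambda>y. (x \<bullet> y) * (norm x + 2 * \<epsilon>) * \<theta> / (norm x + \<epsilon>)\<^sup>2)) (at x)"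
proof (cases "x = 0")
  case True
  \<comment> \<open>At the origin the norm is not differentiable, but \<open>pot\<close> vanishes
    there to second order, so its difference quotient is the norm times a bounded factor.\<close>
  have "((\<lambda>y. (norm y) * (\<theta> / (norm y + \<epsilon>))) \<longlongrightarrow> 0 * (\<theta> / (0 + \<epsilon>))) (at (0::real^'n))"
    using e by (intro tendsto_intros tendsto_norm_zero) auto
  then have *: "((\<lambda>y. (norm y) * (\<theta> / (norm y + \<epsilon>))) \<longlongrightarrow> 0) (at (0::real^'n))" by simp
  have "(\<lambda>y. (pot \<theta> \<epsilon> (0 + y :: real^'n) - pot \<theta> \<epsilon> (0::real^'n) - 0) / norm y) \<midarrow>0\<rightarrow> 0"
    by (rule Lim_transform_eventually[OF *])
       (simp add: pot_def power2_eq_square eventually_at_filter)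
  from tendsto_norm_zero[OF this] show ?thesis using True
    by (simp add: has_derivative_at bounded_linear_zero)
next
  case False
  have "((\<lambda>r. r - rad \<theta> \<epsilon> r) has_derivative (\<lambda>h. h * drift \<theta> \<epsilon> (norm x))) (at (norm x))"
    using DERIV_diff[OF DERIV_ident rad_has_derivative[of "norm x" \<epsilon> \<theta>]] e norm_ge_zero[of x]
    by (simp add: has_field_derivative_def mult.commute[of _ "drift _ _ _"] add_nonneg_pos)
  from has_derivative_compose[OF has_derivative_norm[OF False] this]
  have "((\<lambda>x. norm x - rad \<theta> \<epsilon> (norm x)) has_derivative (\<lambda>h. (h \<bullet> sgn x) * drift \<theta> \<epsilon> (norm x))) (at x)"
    by (simp add: inner_commute)
  moreover have "(\<lambda>x. norm x - rad \<theta> \<epsilon> (norm x)) = (pot \<theta> \<epsilon> :: real^'n \<Rightarrow> real)"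
    by (auto simp: pot_def rad_def)
  moreover have "(h \<bullet> sgn x) * drift \<theta> \<epsilon> (norm x) = (x \<bullet> h) * (norm x + 2 * \<epsilon>) * \<theta> / (norm x + \<epsilon>)\<^sup>2" for h
    using False by (simp add: drift_def sgn_div_norm inner_commute)
  ultimately show ?thesis by simp
qed

lemma pot_lipschitz:
  assumes "0 \<le> \<theta>" "\<epsilon> > 0"
  shows "\<theta>-lipschitz_on UNIV (pot \<theta> \<epsilon> :: real^'n \<Rightarrow> real)"
proof (rule bounded_derivative_imp_lipschitz[OF _ convex_UNIV])
  fix x :: "real^'n"
  show "(pot \<theta> \<epsilon> has_derivative (\<lambda>y. (x \<bullet> y) * (norm x + 2 * \<epsilon>) * \<theta> / (norm x + \<epsilon>)\<^sup>2)) (at x within UNIV)"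
    by (rule has_derivative_at_withinI[OF pot_has_derivative[OF assms(2)]])
  show "onorm (\<lambda>y. (x \<bullet> y) * (norm x + 2 * \<epsilon>) * \<theta> / (norm x + \<epsilon>)\<^sup>2) \<le> \<theta>"
  proof (rule onorm_bound[OF assms(1)])
    fix y
    have "norm ((x \<bullet> y) * (norm x + 2 * \<epsilon>) * \<theta> / (norm x + \<epsilon>)\<^sup>2)
        = \<bar>x \<bullet> y\<bar> * ((norm x + 2 * \<epsilon>) * \<theta> / (norm x + \<epsilon>)\<^sup>2)"
      using assms by (simp add: abs_mult)
    also have "\<dots> \<le> (norm x * norm y) * ((norm x + 2 * \<epsilon>) * \<theta> / (norm x + \<epsilon>)\<^sup>2)"
      using assms by (intro mult_right_mono Cauchy_Schwarz_ineq2) auto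
    also have "\<dots> = drift \<theta> \<epsilon> (norm x) * norm y" by (simp add: drift_def)
    also have "\<dots> \<le> \<theta> * norm y" using drift_bounds(2)[OF assms, of "norm x"] by (intro mult_right_mono) auto
    finally show "norm ((x \<bullet> y) * (norm x + 2 * \<epsilon>) * \<theta> / (norm x + \<epsilon>)\<^sup>2) \<le> \<theta> * norm y" .
  qed
qed (rule assms(1))

text \<open>The Euclidean part of the integrand integrates to at least the chord. The drift part is
  almost everywhere the derivative of \<open>pot\<close> along \<open>c\<close>; as
  \<open>pot\<close> composed with \<open>c\<close> is again Lipschitz, that derivative integrates
  to the difference of the endpoint values.\<close>

lemma integral_F_eps_lipschitz_ge:
  fixes c :: "real \<Rightarrow> real^'n"
  assumes th: "0 \<le> \<theta>" and e: "\<epsilon> > 0" and L: "L-lipschitz_on {0..1} c"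
  shows "norm (c 1 - c 0) - (pot \<theta> \<epsilon> (c 1) - pot \<theta> \<epsilon> (c 0))
       \<le> integral {0..1} (\<lambda>t. F_eps \<theta> \<epsilon> (c t) (vector_derivative c (at t within {0..1})))"
proof -
  obtain D N where D: "negligible N"
    "\<And>t. t \<in> {0..1} - N \<Longrightarrow> (c has_vector_derivative D t) (at t within {0..1})"
    "(D has_integral (c 1 - c 0)) {0..1}" "D absolutely_integrable_on {0..1}"
    by (rule lipschitz_ae_vector_derivative[OF L]) blast
  have "(\<theta> * L)-lipschitz_on {0..1} (\<lambda>t. pot \<theta> \<epsilon> (c t))"
    using lipschitz_on_compose[OF L lipschitz_on_subset[OF pot_lipschitz[OF th e] subset_UNIV]] by (simp add: o_def)
  then obtain E M where E: "negligible M"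
    "\<And>t. t \<in> {0..1} - M \<Longrightarrow> ((\<lambda>t. pot \<theta> \<epsilon> (c t)) has_vector_derivative E t) (at t within {0..1})"
    "(E has_integral (pot \<theta> \<epsilon> (c 1) - pot \<theta> \<epsilon> (c 0))) {0..1}" "E absolutely_integrable_on {0..1}"
    by (rule lipschitz_ae_vector_derivative) blast
  have ni: "(\<lambda>t. norm (D t)) integrable_on {0..1}"
    using D(4) by (simp add: absolutely_integrable_on_def)
  have eq: "F_eps \<theta> \<epsilon> (c t) (vector_derivative c (at t within {0..1})) = norm (D t) - E t"
    if t: "t \<in> {0..1} - (N \<union> M)" for t
  proof -
    have "vector_derivative c (at t within {0..1}) = D t"
      using D(2)[of t] t by (intro vector_derivative_within_closed_interval) auto
    moreover have "E t = (c t \<bullet> D t) * (norm (c t) + 2 * \<epsilon>) * \<theta> / (norm (c t) + \<epsilon>)\<^sup>2"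
    proof (rule vector_derivative_unique_within_closed_interval[of 0 1 t "\<lambda>t. pot \<theta> \<epsilon> (c t)"])
      show "((\<lambda>t. pot \<theta> \<epsilon> (c t)) has_vector_derivative E t) (at t within cbox 0 1)" using E(2)[of t] t by simp
      have "(c has_derivative (\<lambda>h. h *\<^sub>R D t)) (at t within {0..1})"
        using D(2)[of t] t by (simp add: has_vector_derivative_def)
      from has_derivative_compose[OF this pot_has_derivative[OF e]]
      show "((\<lambda>t. pot \<theta> \<epsilon> (c t)) has_vector_derivative
          (c t \<bullet> D t) * (norm (c t) + 2 * \<epsilon>) * \<theta> / (norm (c t) + \<epsilon>)\<^sup>2) (at t within cbox 0 1)"
        by (simp add: has_vector_derivative_def mult.assoc)
    qed (use t in auto)
    ultimately show ?thesis by (simp add: F_eps_def)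
  qed
  have "((\<lambda>t. norm (D t) - E t) has_integral
     (integral {0..1} (\<lambda>t. norm (D t)) - (pot \<theta> \<epsilon> (c 1) - pot \<theta> \<epsilon> (c 0)))) {0..1}"
    by (intro has_integral_diff integrable_integral ni E(3))
  then have "((\<lambda>t. F_eps \<theta> \<epsilon> (c t) (vector_derivative c (at t within {0..1}))) has_integral
     (integral {0..1} (\<lambda>t. norm (D t)) - (pot \<theta> \<epsilon> (c 1) - pot \<theta> \<epsilon> (c 0)))) {0..1}"
    by (rule has_integral_spike[where S="N \<union> M", rotated 2]) (rule negligible_Un[OF D(1) E(1)], erule eq)
  moreover have "norm (c 1 - c 0) \<le> integral {0..1} (\<lambda>t. norm (D t))"
    using integral_norm_bound_integral[OF _ ni, of D] D(3) by (auto simp: integral_unique integrable_on_def)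
  ultimately show ?thesis by (simp add: integral_unique)
qed

lemma finsler_dist_F_eps:
  fixes x :: "real^'n"
  assumes th: "0 \<le> \<theta>" and e: "\<epsilon> > 0"
  shows "finsler_dist (F_eps \<theta> \<epsilon>) 0 x = rad \<theta> \<epsilon> (norm x)"
proof -
  let ?S = "{integral {0..1} (\<lambda>t. F_eps \<theta> \<epsilon> (c t) (vector_derivative c (at t within {0..1}))) | c.
       (\<exists>L. L-lipschitz_on {0..1} c) \<and> c 0 = 0 \<and> c 1 = x}"
  have r: "rad \<theta> \<epsilon> (norm x) = norm x - pot \<theta> \<epsilon> x" by (simp add: rad_def pot_def)
  have lb: "rad \<theta> \<epsilon> (norm x) \<le> v" if "v \<in> ?S" for v
    using that integral_F_eps_lipschitz_ge[OF th e] unfolding r by (fastforce simp: pot_def)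
  \<comment> \<open>Along the segment the integrand is the exact derivative of
    \<open>t * norm x - pot \<theta> \<epsilon> (?c t)\<close>, so its length meets the lower bound
    and the infimum is a minimum.\<close>
  let ?c = "\<lambda>t. t *\<^sub>R x"
  have "((\<lambda>t. F_eps \<theta> \<epsilon> (?c t) (vector_derivative ?c (at t within {0..1}))) has_integral
      (1 * norm x - pot \<theta> \<epsilon> (?c 1) - (0 * norm x - pot \<theta> \<epsilon> (?c 0)))) {0..1}"
  proof (rule fundamental_theorem_of_calculus)
    fix t :: real assume t: "t \<in> {0..1}"
    have d: "(?c has_vector_derivative x) (at t within {0..1})" by (auto intro!: derivative_eq_intros)
    then have v: "vector_derivative ?c (at t within {0..1}) = x"
      using t by (intro vector_derivative_within_closed_interval) auto
    have "((\<lambda>t. pot \<theta> \<epsilon> (?c t)) has_derivative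
        (\<lambda>y. (t *\<^sub>R x \<bullet> (y *\<^sub>R x)) * (norm (t *\<^sub>R x) + 2 * \<epsilon>) * \<theta> / (norm (t *\<^sub>R x) + \<epsilon>)\<^sup>2)) (at t within {0..1})"
      using has_derivative_compose[OF d[unfolded has_vector_derivative_def] pot_has_derivative[OF e]] .
    then have "((\<lambda>t. pot \<theta> \<epsilon> (?c t)) has_vector_derivative
         (t *\<^sub>R x \<bullet> x) * (norm (t *\<^sub>R x) + 2 * \<epsilon>) * \<theta> / (norm (t *\<^sub>R x) + \<epsilon>)\<^sup>2) (at t within {0..1})"
      unfolding has_vector_derivative_def by (rule has_derivative_eq_rhs) (auto simp: algebra_simps)
    from has_vector_derivative_diff[OF has_vector_derivative_mult_left[OF has_vector_derivative_id] this, of "norm x"]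
    show "((\<lambda>t. t * norm x - pot \<theta> \<epsilon> (?c t)) has_vector_derivative
        F_eps \<theta> \<epsilon> (?c t) (vector_derivative ?c (at t within {0..1}))) (at t within {0..1})"
      unfolding v F_eps_def by simp
  qed simp
  then have "integral {0..1} (\<lambda>t. F_eps \<theta> \<epsilon> (?c t) (vector_derivative ?c (at t within {0..1}))) = rad \<theta> \<epsilon> (norm x)"
    unfolding r by (simp add: integral_unique pot_def)
  moreover have "(norm x)-lipschitz_on {0..1} ?c"
    by (rule lipschitz_onI) (auto simp: dist_norm scaleR_diff_left[symmetric] mult.commute)
  ultimately have mem: "rad \<theta> \<epsilon> (norm x) \<in> ?S" by force
  show ?thesis
    unfolding finsler_dist_def
    by (rule cInf_eq_minimum[OF mem lb])
qed

section \<open>The Busemann--Hausdorff density\<close>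

lemma power2_norm_cart_split:
  fixes y :: "real^'n"
  shows "(norm y)\<^sup>2 = (y $ k)\<^sup>2 + (\<Sum>i\<in>-{k}. (y $ i)\<^sup>2)"
  unfolding power2_norm_eq_inner inner_vec_def
  by (subst sum.remove[of _ k]) (auto simp: power2_eq_square Compl_eq_Diff_UNIV)

text \<open>Squaring \<open>norm y < 1 + h * y $ k\<close> and completing the square gives an
  ellipsoid with centre h / b on the k-th axis, half-axis 1 / b along it and 1 / sqrt b across it,
  where b = 1 - h^2. The product of the half-axes is b to the power -(n + 1) / 2. The map
  \<open>T\<close> is the affine normalisation of the ellipsoid to the unit ball.\<close>

lemma measure_shifted_ball_axis:
  fixes k :: "'n::finite"
  assumes h: "0 \<le> h" "h < 1"
  defines "S \<equiv> {y :: real^'n. norm y - h * (y $ k) < 1}"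
  shows "S \<in> lmeasurable"
    and "measure lebesgue S = measure lebesgue (ball (0::real^'n) 1) / (1 - h\<^sup>2) powr ((real CARD('n) + 1) / 2)"
proof -
  define b where "b = 1 - h\<^sup>2"
  have b: "b > 0" using h power_less_one_iff[of h 2] by (simp add: b_def)
  define m where "m i = (if i = k then 1 / b else 1 / sqrt b)" for i
  define st where "st z = (\<chi> i. m i * z $ i)" for z :: "real^'n"
  define T where "T y = (\<chi> i. if i = k then b * y $ k - h else sqrt b * y $ i)" for y :: "real^'n"
  define v :: "real^'n" where "v = axis k (h / b)"
  have gT: "v + st (T y) = y" for y
    using b by (simp add: vec_eq_iff st_def T_def m_def v_def axis_def field_simps)
  have Tg: "T (v + st z) = z" for z
    using b by (simp add: vec_eq_iff st_def T_def m_def v_def axis_def field_simps)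
  have iff: "T y \<in> ball 0 1 \<longleftrightarrow> y \<in> S" for y
  proof -
    let ?q = "\<Sum>i\<in>-{k}. (y $ i)\<^sup>2" and ?s = "y $ k"
    have "(\<Sum>i\<in>-{k}. (T y $ i)\<^sup>2) = b * ?q"
      unfolding sum_distrib_left using b by (intro sum.cong) (auto simp: T_def power_mult_distrib)
    then have "(norm (T y))\<^sup>2 = (b * ?s - h)\<^sup>2 + b * ?q"
      by (simp add: power2_norm_cart_split[of _ k] T_def)
    also have "\<dots> = 1 + b * (?s\<^sup>2 + ?q - (1 + h * ?s)\<^sup>2)"
      unfolding b_def by (simp add: power2_eq_square algebra_simps)
    finally have nT: "(norm (T y))\<^sup>2 = 1 + b * ((norm y)\<^sup>2 - (1 + h * ?s)\<^sup>2)"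
      by (simp add: power2_norm_cart_split[of y k])
    have "norm (T y) < 1 \<longleftrightarrow> (norm (T y))\<^sup>2 < 1"
      by (simp add: power_less_one_iff)
    also have "\<dots> \<longleftrightarrow> (norm y)\<^sup>2 < (1 + h * ?s)\<^sup>2"
      unfolding nT using b by (simp add: mult_less_0_iff)
    finally have i1: "norm (T y) < 1 \<longleftrightarrow> (norm y)\<^sup>2 < (1 + h * ?s)\<^sup>2" .
    show ?thesis
    proof
      \<comment> \<open>Squaring forgets the sign of 1 + h y_k. The k-th coordinate of
        \<open>T y\<close> exceeds -1, which factors as (1 - h) ((1 + h) y_k + 1) > 0 and excludes
        the wrong branch.\<close>
      assume "T y \<in> ball 0 1"
      then have n1: "norm (T y) < 1" by simp
      have "\<bar>T y $ k\<bar> < 1" using component_le_norm_cart[of "T y" k] n1 by linarith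
      then have "b * ?s - h > -1" by (simp add: T_def)
      then have "(1 - h) * ((1 + h) * ?s + 1) > 0" by (simp add: b_def power2_eq_square algebra_simps)
      then have "(1 + h) * ?s + 1 > 0" using h by (simp add: zero_less_mult_iff)
      then have "1 + h * ?s > 0"
        using h by (cases "?s \<ge> 0") (auto simp: algebra_simps intro: add_pos_nonneg)
      then have "norm y < 1 + h * ?s" using i1 n1 power_less_imp_less_base[of "norm y" 2 "1 + h * ?s"] by simp
      then show "y \<in> S" by (simp add: S_def)
    next
      assume "y \<in> S"
      then have "norm y < 1 + h * ?s" by (simp add: S_def)
      then have "(norm y)\<^sup>2 < (1 + h * ?s)\<^sup>2" by (intro power_strict_mono) auto
      then show "T y \<in> ball 0 1" using i1 by simp
    qed
  qed
  have S: "S = (+) v ` st ` ball 0 1"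
    unfolding image_image using gT Tg iff by (metis (no_types, lifting) image_iff set_eqI)
  have lm: "st ` ball 0 1 \<in> lmeasurable"
    unfolding st_def[abs_def] by (rule measurable_stretch) simp
  show "S \<in> lmeasurable" unfolding S using lm by (rule measurable_translation)
  have "prod m UNIV = m k * prod m (-{k})"
    by (subst prod.remove[of _ k]) (auto simp: Compl_eq_Diff_UNIV)
  also have "prod m (-{k}) = (1 / sqrt b) ^ (CARD('n) - 1)"
    by (subst prod.cong[of _ "-{k}" _ "\<lambda>_. 1 / sqrt b"]) (auto simp: m_def Compl_eq_Diff_UNIV card_Diff_singleton)
  also have "\<dots> = b powr (- (real CARD('n) - 1) / 2)"
  proof -
    have "1 / sqrt b = b powr (-1/2)" using b by (simp add: powr_half_sqrt[symmetric] powr_minus_divide)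
    then have "(1 / sqrt b) ^ (CARD('n) - 1) = (b powr (-1/2)) powr real (CARD('n) - 1)"
      using b by (subst powr_realpow) auto
    moreover have "(-1/2) * real (CARD('n) - 1) = - (real CARD('n) - 1) / 2" by (simp add: of_nat_diff Suc_leI) (simp add: field_simps)
    ultimately show ?thesis unfolding powr_powr by metis
  qed
  also have "m k = b powr (-1)" using b by (simp add: m_def powr_minus_divide)
  also have "b powr (-1) * b powr (- (real CARD('n) - 1) / 2) = b powr (-((real CARD('n) + 1) / 2))"
    unfolding powr_add[symmetric] by (rule arg_cong[of _ _ "(powr) b"]) (simp add: field_simps)
  finally have pm: "prod m UNIV = b powr (-((real CARD('n) + 1) / 2))" .
  have "measure lebesgue S = measure lebesgue (st ` ball 0 1)" unfolding S by (rule measure_translation)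
  also have "\<dots> = \<bar>prod m UNIV\<bar> * measure lebesgue (ball (0::real^'n) 1)"
    unfolding st_def[abs_def] by (rule measure_stretch) simp
  finally show "measure lebesgue S = measure lebesgue (ball (0::real^'n) 1) / (1 - h\<^sup>2) powr ((real CARD('n) + 1) / 2)"
    unfolding pm b_def[symmetric] by (simp add: powr_minus_divide)
qed

lemma nn_integral_lborel_translate:
  fixes g :: "'a::euclidean_space \<Rightarrow> ennreal"
  assumes [measurable]: "g \<in> borel_measurable borel"
  shows "(\<integral>\<^sup>+x. g (x + c) \<partial>lborel) = (\<integral>\<^sup>+x. g x \<partial>lborel)"
proof -
  have "(\<integral>\<^sup>+x. g x \<partial>lborel) = (\<integral>\<^sup>+x. g x \<partial>distr lborel borel ((+) c))"
    using lborel_distr_plus[of c] by simp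
  also have "\<dots> = (\<integral>\<^sup>+x. g (c + x) \<partial>lborel)" by (subst nn_integral_distr) auto
  finally show ?thesis by (simp add: add.commute)
qed

text \<open>The general linear change of variables of the library is restricted to well-ordered index types;
  the uniqueness argument for Haar measure, tested against the indicator of the unit ball, is not.\<close>

lemma nn_integral_lborel_orthogonal:
  fixes f :: "'a::euclidean_space \<Rightarrow> 'a" and g :: "'a \<Rightarrow> ennreal"
  assumes f: "orthogonal_transformation f" and [measurable]: "g \<in> borel_measurable borel"
  shows "(\<integral>\<^sup>+x. g (f x) \<partial>lborel) = (\<integral>\<^sup>+x. g x \<partial>lborel)"
proof -
  have lin: "linear f" using f by (rule orthogonal_transformation_linear)
  have [measurable]: "f \<in> borel_measurable borel"
    by (intro borel_measurable_continuous_onI linear_continuous_on linear_conv_bounded_linear[THEN iffD1] lin)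
  define B :: "'a \<Rightarrow> ennreal" where "B = indicator (ball 0 1)"
  have [measurable]: "B \<in> borel_measurable borel" unfolding B_def by (intro borel_measurable_indicator) simp
  let ?v = "\<integral>\<^sup>+y. B y \<partial>lborel"
  have v: "?v = ennreal (measure lborel (ball (0::'a) 1))" "measure lborel (ball (0::'a) 1) > 0"
    using emeasure_eq_ennreal_measure[of lborel "ball (0::'a) 1"] emeasure_lborel_ball_finite[of "0::'a" 1]
      content_ball_pos[of 1 "0::'a"] by (auto simp: B_def)
  obtain h where h: "\<And>y. f (h y) = y"
    using orthogonal_transformation_surj[OF f] by (metis surj_def)
  have "(\<integral>\<^sup>+x. g (f x) \<partial>lborel) * ?v = (\<integral>\<^sup>+y. (\<integral>\<^sup>+x. g (f x) \<partial>lborel) * B y \<partial>lborel)"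
    by (rule nn_integral_cmult[symmetric]) simp
  also have "\<dots> = (\<integral>\<^sup>+y. (\<integral>\<^sup>+x. g (f x + y) * B y \<partial>lborel) \<partial>lborel)"
  proof (rule nn_integral_cong)
    fix y
    have "(\<integral>\<^sup>+x. g (f x) \<partial>lborel) = (\<integral>\<^sup>+x. g (f (x + h y)) \<partial>lborel)"
      by (rule nn_integral_lborel_translate[symmetric]) measurable
    also have "\<dots> = (\<integral>\<^sup>+x. g (f x + y) \<partial>lborel)" by (simp add: linear_add[OF lin] h)
    finally show "(\<integral>\<^sup>+x. g (f x) \<partial>lborel) * B y = (\<integral>\<^sup>+x. g (f x + y) * B y \<partial>lborel)"
      by (simp add: nn_integral_multc)
  qed
  also have "\<dots> = (\<integral>\<^sup>+x. (\<integral>\<^sup>+y. g (f x + y) * B y \<partial>lborel) \<partial>lborel)"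
    by (rule lborel_pair.Fubini') measurable
  also have "\<dots> = (\<integral>\<^sup>+x. (\<integral>\<^sup>+y. g y * B (y - f x) \<partial>lborel) \<partial>lborel)"
  proof (rule nn_integral_cong)
    fix x
    have "(\<integral>\<^sup>+y. g (y + f x) * B ((y + f x) - f x) \<partial>lborel) = (\<integral>\<^sup>+y. g y * B (y - f x) \<partial>lborel)"
      by (rule nn_integral_lborel_translate) measurable
    then show "(\<integral>\<^sup>+y. g (f x + y) * B y \<partial>lborel) = (\<integral>\<^sup>+y. g y * B (y - f x) \<partial>lborel)"
      by (simp add: add.commute)
  qed
  also have "\<dots> = (\<integral>\<^sup>+y. (\<integral>\<^sup>+x. g y * B (y - f x) \<partial>lborel) \<partial>lborel)"
    by (rule lborel_pair.Fubini') measurable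
  also have "\<dots> = (\<integral>\<^sup>+y. g y * ?v \<partial>lborel)"
  proof (rule nn_integral_cong)
    fix y
    have "B (y - f x) = B (x + - h y)" for x
    proof -
      have "y - f x = f (h y - x)" by (simp add: linear_diff[OF lin] h)
      then have "norm (y - f x) = norm (x + - h y)"
        using orthogonal_transformation_norm[OF f] by (simp add: norm_minus_commute)
      then show ?thesis by (simp add: B_def indicator_def)
    qed
    then have "(\<integral>\<^sup>+x. B (y - f x) \<partial>lborel) = ?v"
      using nn_integral_lborel_translate[of B "- h y"] by simp
    then show "(\<integral>\<^sup>+x. g y * B (y - f x) \<partial>lborel) = g y * ?v"
      by (simp add: nn_integral_cmult)
  qed
  also have "\<dots> = (\<integral>\<^sup>+x. g x \<partial>lborel) * ?v" by (simp add: nn_integral_multc)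
  finally have "?v * (\<integral>\<^sup>+x. g (f x) \<partial>lborel) = ?v * (\<integral>\<^sup>+x. g x \<partial>lborel)" by (simp only: mult.commute)
  then show ?thesis
    using ennreal_mult_cancel_left[of ?v] v by simp
qed

text \<open>A rotation taking a multiple of a coordinate vector to \<open>w\<close> reduces this to
  the shift along an axis.\<close>

lemma measure_shifted_ball:
  fixes w :: "real^'n"
  assumes "norm w < 1"
  shows "measure lebesgue {y. norm y - w \<bullet> y < 1}
       = measure lebesgue (ball (0::real^'n) 1) / (1 - (norm w)\<^sup>2) powr ((real CARD('n) + 1) / 2)"
proof -
  fix k :: 'n
  define S where "S = {y :: real^'n. norm y - norm w * (y $ k) < 1}"
  obtain f :: "real^'n \<Rightarrow> real^'n" where f: "orthogonal_transformation f" "f (norm w *\<^sub>R axis k 1) = w"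
  proof -
    have "norm (norm w *\<^sub>R axis k 1 :: real^'n) = norm w" by simp
    then show ?thesis
    proof (rule orthogonal_transformation_exists)
      fix f :: "real^'n \<Rightarrow> real^'n" assume "orthogonal_transformation f" "f (norm w *\<^sub>R axis k 1) = w"
      then show ?thesis by (rule that[of f])
    qed
  qed
  have wy: "w \<bullet> f y = norm w * (y $ k)" for y
  proof -
    have "w \<bullet> f y = f (norm w *\<^sub>R axis k 1) \<bullet> f y" by (simp only: f(2))
    also have "\<dots> = norm w * (y $ k)"
      using f(1) by (simp add: orthogonal_transformation_def inner_axis')
    finally show ?thesis .
  qed
  have "f y \<in> {y. norm y - w \<bullet> y < 1} \<longleftrightarrow> y \<in> S" for y
    using orthogonal_transformation_norm[OF f(1)] by (simp add: S_def wy)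
  then have ind: "indicator {y. norm y - w \<bullet> y < 1} (f y) = (indicator S y :: ennreal)" for y
    by (simp add: indicator_def)
  have op: "open {y. norm y - w \<bullet> y < 1}" "open S"
    unfolding S_def by (intro open_Collect_less continuous_intros)+
  have "emeasure lborel {y. norm y - w \<bullet> y < 1} = (\<integral>\<^sup>+y. indicator {y. norm y - w \<bullet> y < 1} (f y) \<partial>lborel)"
    by (subst nn_integral_lborel_orthogonal[OF f(1)]) (use op(1) in auto)
  also have "\<dots> = emeasure lborel S" unfolding ind using op(2) by simp
  finally have "measure lebesgue {y. norm y - w \<bullet> y < 1} = measure lebesgue S"
    using op by (simp add: measure_def)
  then show ?thesis
    using measure_shifted_ball_axis(2)[OF norm_ge_zero assms, of k] by (simp add: S_def)
qed

definition bh :: "real \<Rightarrow> real \<Rightarrow> nat \<Rightarrow> real \<Rightarrow> real" where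
  "bh \<theta> \<epsilon> n r = (1 - (drift \<theta> \<epsilon> r)\<^sup>2) powr ((real n + 1) / 2)"

lemma BH_density_F_eps:
  fixes x :: "real^'n"
  assumes th: "0 \<le> \<theta>" "\<theta> < 1" and e: "\<epsilon> > 0"
  shows "BH_density (F_eps \<theta> \<epsilon>) x = bh \<theta> \<epsilon> CARD('n) (norm x)"
proof -
  define w where "w = (((norm x + 2 * \<epsilon>) * \<theta> / (norm x + \<epsilon>)\<^sup>2) *\<^sub>R x)"
  have F: "F_eps \<theta> \<epsilon> x y = norm y - w \<bullet> y" for y by (simp add: F_eps_def w_def)
  have nw: "norm w = drift \<theta> \<epsilon> (norm x)"
    using th e by (simp add: w_def drift_def abs_mult)
  have lt: "norm w < 1" unfolding nw using drift_bounds[OF th(1) e norm_ge_zero, of x] th(2) by linarith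
  have "measure lebesgue (ball (0::real^'n) 1) > 0" 
    by (simp add: content_ball_pos)
  moreover have "1 - (norm w)\<^sup>2 > 0" using lt by (simp add: power_less_one_iff)
  ultimately show ?thesis
    unfolding BH_density_def F measure_shifted_ball[OF lt] bh_def nw by (simp add: nw)
qed

lemma powr_divide_powr_minus:
  fixes x y a :: real
  assumes "x > 0" "y > 0"
  shows "(x / y) powr a = x powr a * y powr (- a)"
  using assms by (simp add: powr_divide powr_minus_divide)

section \<open>Monotonicity of the density relative to the distance\<close>

locale randers =
  fixes \<theta> \<epsilon> :: real
  assumes th0: "0 \<le> \<theta>" and th1: "\<theta> < 1" and e0: "\<epsilon> > 0"
begin

abbreviation "h \<equiv> drift \<theta> \<epsilon>"
abbreviation "\<rho> \<equiv> rad \<theta> \<epsilon>"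

lemma rad_bounds:
  assumes "r \<ge> 0"
  shows "(1 - \<theta>) * r \<le> \<rho> r" "\<rho> r \<le> r"
proof -
  have "\<theta> * r\<^sup>2 / (r + \<epsilon>) \<le> \<theta> * r"
    using assms e0 th0 by (simp add: power2_eq_square divide_simps mult_left_mono algebra_simps)
  then show "(1 - \<theta>) * r \<le> \<rho> r" by (simp add: rad_def algebra_simps)
  show "\<rho> r \<le> r" using assms e0 th0 by (simp add: rad_def)
qed

lemma rad_pos: "r > 0 \<Longrightarrow> \<rho> r > 0"
  using rad_bounds(1)[of r] th1 by (smt (verit) mult_pos_pos)

lemma rad_nonneg: "r \<ge> 0 \<Longrightarrow> \<rho> r \<ge> 0"
  using rad_bounds(1)[of r] th1 by (smt (verit) mult_nonneg_nonneg)

lemma drift_nonneg: "r \<ge> 0 \<Longrightarrow> h r \<ge> 0" and drift_le: "r \<ge> 0 \<Longrightarrow> h r \<le> \<theta>"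
  and drift_less_1: "r \<ge> 0 \<Longrightarrow> h r < 1"
  using drift_bounds[OF th0 e0, of r] th1 by auto

lemma drift_mono:
  assumes "0 \<le> r" "r \<le> s"
  shows "h r \<le> h s"
proof -
  have eq: "h r = \<theta> * (1 - (\<epsilon> / (r + \<epsilon>))\<^sup>2)" if "r \<ge> 0" for r
    using that e0 by (simp add: drift_def divide_simps) (simp add: power2_eq_square algebra_simps)
  have "\<epsilon> / (s + \<epsilon>) \<le> \<epsilon> / (r + \<epsilon>)" using assms e0 by (intro divide_left_mono) auto
  then have "(\<epsilon> / (s + \<epsilon>))\<^sup>2 \<le> (\<epsilon> / (r + \<epsilon>))\<^sup>2" using assms e0 by (intro power_mono) auto
  then show ?thesis using assms th0 by (simp add: eq mult_left_mono)
qed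

text \<open>This is bh r^(n-1) / (\<rho>^(n-1) (1 - h)), the ratio of the radial density to
  \<rho>^(n-1) d\<rho>. The written form makes monotonicity visible: both \<open>h\<close> and
  \<open>r / (r + \<epsilon> - \<theta> * r)\<close> increase with r, and both exponents are
  nonnegative for n at least 1.\<close>

definition cone_density :: "nat \<Rightarrow> real \<Rightarrow> real" where
  "cone_density n r = (1 + h r) powr ((real n + 1) / 2) *
     (1 + \<theta> * (1 - \<theta>) * (r / (r + \<epsilon> - \<theta> * r))\<^sup>2) powr ((real n - 1) / 2)"

lemma cone_density_pos: "r \<ge> 0 \<Longrightarrow> cone_density n r > 0"
proof -
  assume "r \<ge> 0"
  then have "1 + h r > 0" using drift_nonneg[of r] by simp
  moreover have "1 + \<theta> * (1 - \<theta>) * (r / (r + \<epsilon> - \<theta> * r))\<^sup>2 > 0" using th0 th1 by (intro add_pos_nonneg) auto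
  ultimately show ?thesis unfolding cone_density_def by simp
qed

lemma cone_density_mono:
  assumes r: "0 \<le> r" "r \<le> s" and n: "n \<ge> 1"
  shows "cone_density n r \<le> cone_density n s"
proof -
  have pos: "r + \<epsilon> - \<theta> * r > 0" if "r \<ge> 0" for r
    using mult_right_mono[OF less_imp_le[OF th1] that] e0 by linarith
  have "r * (s + \<epsilon> - \<theta> * s) \<le> s * (r + \<epsilon> - \<theta> * r)"
    using mult_right_mono[OF r(2), of \<epsilon>] e0 by (simp add: algebra_simps)
  then have "r / (r + \<epsilon> - \<theta> * r) \<le> s / (s + \<epsilon> - \<theta> * s)"
    using pos[of r] pos[of s] r
    by (simp only: pos_divide_le_eq times_divide_eq_left pos_le_divide_eq order_trans[OF r])
  then have "(r / (r + \<epsilon> - \<theta> * r))\<^sup>2 \<le> (s / (s + \<epsilon> - \<theta> * s))\<^sup>2"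
    using pos r by (intro power_mono) (auto simp: less_imp_le)
  then have "\<theta> * (1 - \<theta>) * (r / (r + \<epsilon> - \<theta> * r))\<^sup>2 \<le> \<theta> * (1 - \<theta>) * (s / (s + \<epsilon> - \<theta> * s))\<^sup>2"
    using th0 th1 by (intro mult_left_mono) auto
  moreover have "0 \<le> \<theta> * (1 - \<theta>) * (r / (r + \<epsilon> - \<theta> * r))\<^sup>2" using th0 th1 by simp
  ultimately show ?thesis
    unfolding cone_density_def using drift_mono[OF r] drift_nonneg[OF r(1)] n
    by (intro mult_mono powr_mono2) auto
qed

text \<open>The density of the Busemann--Hausdorff measure in polar coordinates adapted to the distance
  \<open>\<rho>\<close> is \<open>cone_density\<close> times \<open>\<rho>^(n-1)\<close>.\<close>

lemma bh_cone_density: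
  assumes r: "r > 0" and n: "n \<ge> 1"
  shows "bh \<theta> \<epsilon> n r = cone_density n r * (1 - h r) * (\<rho> r / r) powr (real n - 1)"
proof -
  define s where "s = r / (r + \<epsilon>)"
  define Q where "Q = 1 + \<theta> * (1 - \<theta>) * (r / (r + \<epsilon> - \<theta> * r))\<^sup>2"
  have Q: "Q > 0" unfolding Q_def using th0 th1 by (intro add_pos_nonneg) auto
  have pos: "r + \<epsilon> - \<theta> * r > 0"
    using mult_right_mono[OF less_imp_le[OF th1], of r] r e0 by linarith
  have q: "\<rho> r / r = (r + \<epsilon> - \<theta> * r) / (r + \<epsilon>)"
  proof -
    have "r + \<epsilon> \<noteq> 0" using r e0 by simp
    then have "\<rho> r = (r + \<epsilon> - \<theta> * r) / (r + \<epsilon>) * r"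
      by (simp add: rad_def divide_simps) (simp add: power2_eq_square algebra_simps)
    then show ?thesis using r by simp
  qed
  have q0: "\<rho> r / r > 0" using r rad_pos by simp
  \<comment> \<open>The key identity. After 1 - h^2 is split into (1 + h)(1 - h), one factor 1 - h
    is kept as \<rho>', and the remaining power (n - 1) / 2 of 1 - h is traded for (\<rho> /
    r)^(n-1) times a power of \<open>Q\<close>.\<close>
  have hh: "1 - h r = (\<rho> r / r)\<^sup>2 * Q"
  proof -
    have "(\<rho> r / r)\<^sup>2 * Q = ((r + \<epsilon> - \<theta> * r)\<^sup>2 + \<theta> * (1 - \<theta>) * r\<^sup>2) / (r + \<epsilon>)\<^sup>2"
    proof -
      have "(A / B)\<^sup>2 * (1 + k * (r / A)\<^sup>2) = (A\<^sup>2 + k * r\<^sup>2) / B\<^sup>2" if "A > 0" for A B k :: real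
        using that by (simp add: power_divide add_divide_distrib distrib_left)
      from this[OF pos] show ?thesis unfolding q Q_def .
    qed
    also have "\<dots> = 1 - h r"
      using r e0 by (simp add: drift_def divide_simps) (simp add: power2_eq_square algebra_simps)
    finally show ?thesis by simp
  qed
  have h1: "1 - h r > 0" "1 + h r > 0" using drift_less_1[of r] drift_nonneg[of r] r by auto
  have "bh \<theta> \<epsilon> n r = ((1 + h r) * (1 - h r)) powr ((real n + 1) / 2)"
    by (simp add: bh_def power2_eq_square algebra_simps)
  also have "\<dots> = (1 + h r) powr ((real n + 1) / 2) * (1 - h r) powr ((real n + 1) / 2)"
    using h1 by (simp add: powr_mult)
  also have "(real n + 1) / 2 = 1 + (real n - 1) / 2" by (simp add: field_simps)
  finally have "bh \<theta> \<epsilon> n r = (1 + h r) powr ((real n + 1) / 2) * (1 - h r) powr (1 + (real n - 1) / 2)"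
    by (simp add: field_simps)
  also have "(1 - h r) powr (1 + (real n - 1) / 2) = (1 - h r) * (1 - h r) powr ((real n - 1) / 2)"
    using h1 by (simp add: powr_add)
  also have "(1 - h r) powr ((real n - 1) / 2) = ((\<rho> r / r) powr 2) powr ((real n - 1) / 2) * Q powr ((real n - 1) / 2)"
    unfolding hh using Q q0 by (simp add: powr_mult)
  also have "((\<rho> r / r) powr 2) powr ((real n - 1) / 2) = (\<rho> r / r) powr (real n - 1)"
    unfolding powr_powr by (rule arg_cong[of _ _ "(powr) (\<rho> r / r)"]) simp
  finally show ?thesis unfolding cone_density_def Q_def by (simp add: mult_ac)
qed

lemma bh_pos: "r \<ge> 0 \<Longrightarrow> bh \<theta> \<epsilon> n r > 0"
  and bh_le_1: "r \<ge> 0 \<Longrightarrow> bh \<theta> \<epsilon> n r \<le> 1"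
  and bh_ge: "r \<ge> 0 \<Longrightarrow> bh \<theta> \<epsilon> n r \<ge> (1 - \<theta>\<^sup>2) powr ((real n + 1) / 2)"
proof -
  assume r: "r \<ge> 0"
  have "(h r)\<^sup>2 \<le> \<theta>\<^sup>2" "0 \<le> (h r)\<^sup>2" using drift_nonneg[OF r] drift_le[OF r] by (auto intro: power_mono)
  moreover have "\<theta>\<^sup>2 < 1" using th0 th1 by (simp add: power_less_one_iff)
  ultimately show "bh \<theta> \<epsilon> n r > 0" "bh \<theta> \<epsilon> n r \<le> 1" "bh \<theta> \<epsilon> n r \<ge> (1 - \<theta>\<^sup>2) powr ((real n + 1) / 2)"
    unfolding bh_def by (auto intro!: powr_le1 powr_mono2)
qed

text \<open>After dilations are undone, a point at radius r collects the weights at all radii r / t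
  with t at least 1. Replacing \<open>cone_density\<close> at r / t by its larger value at r turns
  the integrand into the exact derivative of a multiple of \<rho>(r / t)^\<beta>, with \<beta> = n +
  \<alpha> - p, so the integral telescopes. The exponent -n - 1 of t consists of n from the Jacobian
  of the dilation and 1 from rescaling the radial derivative.\<close>

lemma dilation_weight_le:
  assumes r: "r > 0" and n: "n \<ge> 1" and b: "real n + \<alpha> - p > 0"
  shows "(\<integral>\<^sup>+t. ennreal ((real n + \<alpha> - p) * \<rho> (r / t) powr (\<alpha> - p) * bh \<theta> \<epsilon> n (r / t) * t powr (- real n - 1))
            * indicator {1..} t \<partial>lborel)
         \<le> ennreal (bh \<theta> \<epsilon> n r * \<rho> r powr (\<alpha> - p + 1) / (r * (1 - h r)))"
proof -
  define \<beta> where "\<beta> = real n + \<alpha> - p"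
  have be: "\<beta> > 0" using b by (simp add: \<beta>_def)
  define C where "C = cone_density n r * r powr (- real n)"
  define F where "F t = - (C * \<rho> (r / t) powr \<beta>)" for t
  define f where "f t = C * (\<beta> * \<rho> (r / t) powr (\<beta> - 1) * (1 - h (r / t)) * (r / t\<^sup>2))" for t
  have C: "C > 0" unfolding C_def using cone_density_pos[of r n] r by simp
  have le: "(real n + \<alpha> - p) * \<rho> (r / t) powr (\<alpha> - p) * bh \<theta> \<epsilon> n (r / t) * t powr (- real n - 1) \<le> f t"
    if t: "t \<ge> 1" for t
  proof -
    define s where "s = r / t"
    have s: "s > 0" "s \<le> r" using r t by (auto simp: s_def divide_simps)
    \<comment> \<open>The factor r / t^2 produced here is, up to sign, the derivative of r / t, as
      the chain rule in \<open>der\<close> requires.\<close>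
    have e1: "s powr (1 - real n) * t powr (- real n - 1) = r powr (- real n) * (r / t\<^sup>2)"
    proof -
      have "s powr (1 - real n) * t powr (- real n - 1) = r powr (1 - real n) * (t powr (real n - 1) * t powr (- real n - 1))"
        using powr_divide_powr_minus[of r t "1 - real n"] r t unfolding s_def by simp
      also have "t powr (real n - 1) * t powr (- real n - 1) = t powr (- 2)"
        unfolding powr_add[symmetric] by simp
      also have "\<dots> = 1 / t\<^sup>2" using t by (simp add: powr_minus_divide)
      also have "r powr (1 - real n) = r * r powr (- real n)" using r powr_add[of r 1 "- real n"] by simp
      finally show ?thesis by simp
    qed
    have "\<beta> * \<rho> s powr (\<alpha> - p) * bh \<theta> \<epsilon> n s * t powr (- real n - 1)
        = \<beta> * (\<rho> s powr (\<alpha> - p) * \<rho> s powr (real n - 1)) * cone_density n s * (1 - h s)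
           * (s powr (1 - real n) * t powr (- real n - 1))"
      using bh_cone_density[OF s(1) n] s rad_pos[OF s(1)] powr_divide_powr_minus[of "\<rho> s" s "real n - 1"] by simp
    also have "\<rho> s powr (\<alpha> - p) * \<rho> s powr (real n - 1) = \<rho> s powr (\<beta> - 1)"
      unfolding powr_add[symmetric] \<beta>_def by (simp add: algebra_simps)
    also have "\<beta> * \<rho> s powr (\<beta> - 1) * cone_density n s * (1 - h s) * (s powr (1 - real n) * t powr (- real n - 1))
       \<le> \<beta> * \<rho> s powr (\<beta> - 1) * cone_density n r * (1 - h s) * (s powr (1 - real n) * t powr (- real n - 1))"
      using be drift_less_1[of s] s n cone_density_mono[of s r n]
      by (intro mult_right_mono mult_left_mono) auto
    also have "\<dots> = f t" unfolding e1 unfolding f_def C_def s_def by simp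
    finally show ?thesis unfolding s_def \<beta>_def .
  qed
  have der: "(F has_real_derivative f t) (at t)" if t: "t \<ge> 1" for t
  proof -
    have p: "\<rho> (r / t) > 0" using r t by (intro rad_pos) simp
    have d1: "((\<lambda>t. r / t) has_real_derivative (- (r / t\<^sup>2))) (at t)"
      using t by (auto intro!: derivative_eq_intros simp: power2_eq_square)
    have "((\<lambda>t. \<rho> (r / t)) has_real_derivative ((1 - h (r / t)) * (- (r / t\<^sup>2)))) (at t)"
      using r t e0 by (intro DERIV_chain2[OF rad_has_derivative d1]) (auto intro: add_pos_pos)
    from DERIV_fun_powr[OF this, of \<beta>] p
    have "((\<lambda>t. \<rho> (r / t) powr \<beta>) has_real_derivative
        (\<beta> * \<rho> (r / t) powr (\<beta> - 1) * ((1 - h (r / t)) * (- (r / t\<^sup>2))))) (at t)"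
      by simp
    from DERIV_minus[OF DERIV_cmult[OF this, of C]] show ?thesis
      unfolding F_def[abs_def] f_def by (simp add: algebra_simps)
  qed
  have f0: "f t \<ge> 0" if "t \<ge> 1" for t
    unfolding f_def using C be r that drift_less_1[of "r / t"] by (intro mult_nonneg_nonneg) auto
  \<comment> \<open>The boundary term at infinity vanishes because \<rho>(r / t) tends to 0 and
    \<beta> is positive.\<close>
  have lim: "(F \<longlongrightarrow> 0) at_top"
  proof -
    have l0: "((\<lambda>t. r / t) \<longlongrightarrow> 0) at_top" by (rule tendsto_divide_0[OF tendsto_const filterlim_at_top_imp_at_infinity[OF filterlim_ident]])
    have nn: "\<forall>\<^sub>F t in at_top. 0 \<le> \<rho> (r / t)"
      by (rule eventually_at_top_linorderI[of 1]) (intro rad_nonneg, use r in simp)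
    have le': "\<forall>\<^sub>F t in at_top. \<rho> (r / t) \<le> r / t"
      by (rule eventually_at_top_linorderI[of 1]) (intro rad_bounds(2), use r in simp)
    have "((\<lambda>t. \<rho> (r / t)) \<longlongrightarrow> 0) at_top"
      by (rule tendsto_sandwich[OF nn le' tendsto_const l0])
    from tendsto_powr'[OF this tendsto_const, of \<beta>] nn be
    have "((\<lambda>t. \<rho> (r / t) powr \<beta>) \<longlongrightarrow> 0) at_top" by simp
    then have "((\<lambda>t. - (C * \<rho> (r / t) powr \<beta>)) \<longlongrightarrow> - (C * 0)) at_top"
      by (intro tendsto_intros) simp
    then show ?thesis unfolding F_def[abs_def] by simp
  qed
  have meas: "f \<in> borel_measurable borel"
    unfolding f_def drift_def rad_def by measurable
  have "(\<integral>\<^sup>+t. ennreal ((real n + \<alpha> - p) * \<rho> (r / t) powr (\<alpha> - p) * bh \<theta> \<epsilon> n (r / t) * t powr (- real n - 1))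
            * indicator {1..} t \<partial>lborel) \<le> (\<integral>\<^sup>+t. ennreal (f t) * indicator {1..} t \<partial>lborel)"
    using le by (intro nn_integral_mono) (auto simp: indicator_def intro: ennreal_leI)
  also have "\<dots> = ennreal (0 - F 1)"
    by (rule nn_integral_FTC_atLeast[OF meas der f0 lim])
  also have "0 - F 1 = bh \<theta> \<epsilon> n r * \<rho> r powr (\<alpha> - p + 1) / (r * (1 - h r))"
  proof -
    have p: "\<rho> r > 0" using r by (rule rad_pos)
    have "\<rho> r powr \<beta> = \<rho> r powr (real n - 1) * \<rho> r powr (\<alpha> - p + 1)"
      unfolding powr_add[symmetric] \<beta>_def by (simp add: algebra_simps)
    moreover have "r powr (- real n) = 1 / (r powr (real n - 1) * r)"
      using r by (simp add: powr_diff powr_minus_divide)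
    ultimately show ?thesis
      unfolding F_def C_def using bh_cone_density[OF r n] drift_less_1[of r] r p
      by (simp add: powr_divide)
  qed
  finally show ?thesis .
qed

end

section \<open>The Hardy inequality\<close>

context randers
begin

lemma F_eps_bounds:
  fixes x y :: "real^'n"
  assumes y: "y \<noteq> 0"
  shows "(1 - \<theta>) * norm y \<le> F_eps \<theta> \<epsilon> x y" "F_eps \<theta> \<epsilon> x y > 0"
proof -
  have "(x \<bullet> y) * (norm x + 2 * \<epsilon>) * \<theta> / (norm x + \<epsilon>)\<^sup>2
      \<le> (norm x * norm y) * (norm x + 2 * \<epsilon>) * \<theta> / (norm x + \<epsilon>)\<^sup>2"
    using e0 th0 by (intro divide_right_mono mult_right_mono norm_cauchy_schwarz) auto
  also have "\<dots> = h (norm x) * norm y" by (simp add: drift_def)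
  also have "\<dots> \<le> \<theta> * norm y" using drift_le[of "norm x"] by (intro mult_right_mono) auto
  finally show *: "(1 - \<theta>) * norm y \<le> F_eps \<theta> \<epsilon> x y" by (simp add: F_eps_def algebra_simps)
  show "F_eps \<theta> \<epsilon> x y > 0" using * y th1 by (smt (verit) mult_pos_pos zero_less_norm_iff)
qed

lemma F_eps_radial:
  fixes x :: "real^'n"
  shows "F_eps \<theta> \<epsilon> x (- x) = norm x * (1 + h (norm x))" "F_eps \<theta> \<epsilon> x x = norm x * (1 - h (norm x))"
proof -
  define q where "q = (norm x + 2 * \<epsilon>) * \<theta> / (norm x + \<epsilon>)\<^sup>2"
  have x: "x \<bullet> x = norm x * norm x" by (simp add: power2_norm_eq_inner[symmetric] power2_eq_square)
  have h: "h (norm x) = norm x * q" by (simp add: drift_def q_def)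
  have F: "F_eps \<theta> \<epsilon> x y = norm y - (x \<bullet> y) * q" for y by (simp add: F_eps_def q_def)
  show "F_eps \<theta> \<epsilon> x (- x) = norm x * (1 + h (norm x))" "F_eps \<theta> \<epsilon> x x = norm x * (1 - h (norm x))"
    unfolding F h by (simp_all add: x algebra_simps)
qed

text \<open>The supremum of reals dominates its members only if the set is bounded above. The
  operator bound K of \<xi> and the lower bound (1 - \<theta>) norm y for the metric give K / (1 -
  \<theta>).\<close>

lemma dual_metric_upper:
  fixes x y :: "real^'n"
  assumes xi: "bounded_linear \<xi>" and y: "y \<noteq> 0"
  shows "\<xi> y / F_eps \<theta> \<epsilon> x y \<le> dual_metric (F_eps \<theta> \<epsilon>) x \<xi>"
proof -
  obtain K where K: "K \<ge> 0" "\<And>y. norm (\<xi> y) \<le> norm y * K"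
    using bounded_linear.nonneg_bounded[OF xi] by blast
  have "\<xi> z / F_eps \<theta> \<epsilon> x z \<le> K / (1 - \<theta>)" if "z \<noteq> 0" for z
  proof -
    have "\<xi> z * (1 - \<theta>) \<le> K * ((1 - \<theta>) * norm z)"
      using K(2)[of z] th1 by (simp add: abs_le_iff mult.commute mult.left_commute)
    also have "\<dots> \<le> K * F_eps \<theta> \<epsilon> x z"
      using F_eps_bounds(1)[OF that] K(1) by (intro mult_left_mono)
    finally show ?thesis using F_eps_bounds(2)[OF that, of x] th1 by (simp add: divide_simps mult.commute)
  qed
  then show ?thesis
    unfolding dual_metric_def using y by (intro cSUP_upper) (auto intro!: bdd_aboveI2)
qed

text \<open>Test with x or -x, whichever makes \<xi> nonnegative. The outward direction has the
  smaller length, with factor 1 - h, so the inward factor 1 + h gives a valid bound for both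
  signs.\<close>

lemma dual_metric_ge_radial:
  fixes x :: "real^'n"
  assumes xi: "bounded_linear \<xi>" and x: "x \<noteq> 0"
  shows "\<bar>\<xi> x\<bar> / (norm x * (1 + h (norm x))) \<le> dual_metric (F_eps \<theta> \<epsilon>) x \<xi>"
proof (cases "\<xi> x \<ge> 0")
  case True
  have "\<bar>\<xi> x\<bar> / (norm x * (1 + h (norm x))) \<le> \<xi> x / (norm x * (1 - h (norm x)))"
    using True x drift_nonneg[of "norm x"] drift_less_1[of "norm x"]
    by (intro frac_le mult_pos_pos mult_left_mono) auto
  then show ?thesis using dual_metric_upper[OF xi x, of x] by (simp add: F_eps_radial)
next
  case False
  then show ?thesis using dual_metric_upper[OF xi, of "- x" x] x
    by (simp add: F_eps_radial linear_neg[OF bounded_linear.linear[OF xi]])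
qed

lemma dual_metric_nonneg:
  fixes x :: "real^'n"
  assumes xi: "bounded_linear \<xi>"
  shows "0 \<le> dual_metric (F_eps \<theta> \<epsilon>) x \<xi>"
proof -
  obtain y :: "real^'n" where y: "y \<noteq> 0" using vector_choose_size[of 1] by (metis norm_zero zero_le_one zero_neq_one)
  show ?thesis
  proof (cases "\<xi> y \<ge> 0")
    case True
    then show ?thesis using dual_metric_upper[OF xi y, of x] F_eps_bounds(2)[OF y, of x]
      by (meson divide_nonneg_pos order_trans)
  next
    case False
    then have "\<xi> (- y) \<ge> 0" by (simp add: linear_neg[OF bounded_linear.linear[OF xi]])
    then show ?thesis using dual_metric_upper[OF xi, of "- y" x] F_eps_bounds(2)[of "- y" x] y
      by (meson divide_nonneg_pos order_trans neg_equal_0_iff_equal)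
  qed
qed

text \<open>For covectors that decrease outwards the radial lower bound is exact, by Cauchy-Schwarz,
  with y = -x extremal for x nonzero. This is what makes radially decreasing functions the right
  test functions for sharpness.\<close>

lemma dual_metric_le_radial:
  fixes x :: "real^'n"
  assumes k: "k \<le> 0"
  shows "dual_metric (F_eps \<theta> \<epsilon>) x (\<lambda>y. k * (x \<bullet> y)) \<le> \<bar>k\<bar> * norm x / (1 + h (norm x))"
  unfolding dual_metric_def
proof (rule cSUP_least)
  show "- {0} \<noteq> ({} :: (real^'n) set)" using vector_choose_size[of 1] by (metis Compl_iff empty_iff norm_zero singletonD zero_le_one zero_neq_one)
  fix y :: "real^'n" assume "y \<in> - {0}"
  then have y: "y \<noteq> 0" by simp
  define q where "q = (norm x + 2 * \<epsilon>) * \<theta> / (norm x + \<epsilon>)\<^sup>2"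
  have h: "h (norm x) = norm x * q" by (simp add: drift_def q_def)
  have F: "F_eps \<theta> \<epsilon> x y = norm y - (x \<bullet> y) * q" by (simp add: F_eps_def q_def)
  have "- (x \<bullet> y) \<le> norm x * norm y" using norm_cauchy_schwarz[of "- x" y] by simp
  then have "- (x \<bullet> y) * (1 + norm x * q) \<le> norm x * (norm y - (x \<bullet> y) * q)" by (simp add: algebra_simps)
  then have "\<bar>k\<bar> * (- (x \<bullet> y) * (1 + norm x * q)) \<le> \<bar>k\<bar> * (norm x * (norm y - (x \<bullet> y) * q))"
    by (intro mult_left_mono) auto
  then have "k * (x \<bullet> y) * (1 + h (norm x)) \<le> \<bar>k\<bar> * norm x * F_eps \<theta> \<epsilon> x y"
    unfolding h F using k by (simp add: algebra_simps)
  then show "k * (x \<bullet> y) / F_eps \<theta> \<epsilon> x y \<le> \<bar>k\<bar> * norm x / (1 + h (norm x))"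
    using F_eps_bounds(2)[OF y, of x] drift_nonneg[of "norm x"]
    by (simp add: divide_simps add_nonneg_eq_0_iff)
qed

end

section \<open>Smooth functions along rays\<close>

lemma smooth_fun_differentiable: "smooth_fun u \<Longrightarrow> u differentiable (at x)"
  by (auto elim: smooth_fun.cases)

lemma smooth_fun_continuous_on: "smooth_fun u \<Longrightarrow> continuous_on A u"
  by (meson smooth_fun_differentiable differentiable_imp_continuous_on differentiable_on_def differentiable_at_withinI)

text \<open>\<open>smooth_fun\<close> controls only the partial derivatives along the axes, so a
  variable direction is expanded in the standard basis.\<close>

lemma smooth_fun_derivative_continuous_on:
  fixes u :: "real^'n \<Rightarrow> real"
  assumes u: "smooth_fun u" and v: "continuous_on A v" and g: "continuous_on A g"
  shows "continuous_on A (\<lambda>x. frechet_derivative u (at (g x)) (v x))"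
proof -
  have lin: "linear (frechet_derivative u (at x))" for x
    using linear_frechet_derivative[OF smooth_fun_differentiable[OF u]] .
  have "frechet_derivative u (at (g x)) (v x) = (\<Sum>i\<in>UNIV. v x $ i * frechet_derivative u (at (g x)) (axis i 1))" for x
  proof -
    have "v x = (\<Sum>i\<in>UNIV. v x $ i *\<^sub>R axis i 1)" using basis_expansion[of "v x"] by (simp add: scalar_mult_eq_scaleR)
    then have "frechet_derivative u (at (g x)) (v x) = frechet_derivative u (at (g x)) (\<Sum>i\<in>UNIV. v x $ i *\<^sub>R axis i 1)" by simp
    then show ?thesis by (simp add: linear_sum[OF lin] linear_scale[OF lin])
  qed
  moreover have "continuous_on A (\<lambda>x. frechet_derivative u (at (g x)) (axis i 1))" for i
  proof -
    have "smooth_fun (\<lambda>x. frechet_derivative u (at x) (axis i 1))" using u by (auto elim: smooth_fun.cases)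
    from continuous_on_compose2[OF smooth_fun_continuous_on[OF this, of UNIV] g] show ?thesis by simp
  qed
  ultimately show ?thesis using v by (auto intro!: continuous_intros)
qed

lemma abs_powr_has_real_derivative:
  fixes v p :: real
  assumes p: "p > 1"
  shows "((\<lambda>v. \<bar>v\<bar> powr p) has_real_derivative (p * \<bar>v\<bar> powr (p - 1) * sgn v)) (at v)"
proof -
  consider "v > 0" | "v < 0" | "v = 0" by linarith
  then show ?thesis
  proof cases
    case 1
    have "((\<lambda>v. v powr p) has_real_derivative (p * \<bar>v\<bar> powr (p - 1) * sgn v)) (at v)"
      using 1 by (auto intro!: derivative_eq_intros)
    then show ?thesis
      by (rule has_field_derivative_transform_within_open[where S="{0<..}"]) (use 1 in auto)
  next
    case 2
    have "((\<lambda>v. (- v) powr p) has_real_derivative (p * \<bar>v\<bar> powr (p - 1) * sgn v)) (at v)"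
      using 2 by (auto intro!: derivative_eq_intros)
    then show ?thesis
      by (rule has_field_derivative_transform_within_open[where S="{..<0}"]) (use 2 in auto)
  next
    case 3
    \<comment> \<open>At the zero of v the difference quotient is bounded by the power p - 1 of the
      absolute value, which tends to 0 because p > 1.\<close>
    have "((\<lambda>t::real. \<bar>t\<bar> powr (p - 1)) \<longlongrightarrow> 0 powr (p - 1)) (at 0)"
      using p by (intro tendsto_powr' tendsto_const) (auto intro!: tendsto_eq_intros)
    then have "((\<lambda>t::real. \<bar>t\<bar> powr (p - 1)) \<longlongrightarrow> 0) (at 0)" using p by simp
    then have "((\<lambda>t::real. (\<bar>0 + t\<bar> powr p - \<bar>0\<bar> powr p) / t) \<longlongrightarrow> 0) (at 0)"
    proof (rule Lim_null_comparison[rotated])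
      show "\<forall>\<^sub>F t in at 0. norm ((\<bar>0 + t\<bar> powr p - \<bar>0\<bar> powr p) / t) \<le> \<bar>t\<bar> powr (p - 1)"
        unfolding eventually_at_filter using p by (auto simp: powr_diff intro!: always_eventually)
    qed
    then show ?thesis using 3 by (simp add: DERIV_def)
  qed
qed

text \<open>On the outward ray from x the function vanishes eventually, so the p-th power at x is
  minus the integral of its derivative along the ray. Taking absolute values can only enlarge the
  integral.\<close>

lemma C0_infty_ray_bound:
  fixes u :: "real^'n \<Rightarrow> real"
  assumes u: "u \<in> C0_infty" and x: "x \<noteq> 0" and p: "p > 1"
  shows "ennreal (\<bar>u x\<bar> powr p) \<le> (\<integral>\<^sup>+t. ennreal (p * \<bar>u (t *\<^sub>R x)\<bar> powr (p - 1)
             * \<bar>frechet_derivative u (at (t *\<^sub>R x)) x\<bar>) * indicator {1..} t \<partial>lborel)"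
proof -
  have sm: "smooth_fun u" using u by (simp add: C0_infty_def)
  have "bounded {x. u x \<noteq> 0}"
    using u unfolding C0_infty_def by (auto intro: bounded_subset[OF compact_imp_bounded closure_subset])
  then obtain R where R: "\<And>y. u y \<noteq> 0 \<Longrightarrow> norm y \<le> R" by (auto simp: bounded_iff)
  \<comment> \<open>At this parameter the point has norm \<open>norm x + \<bar>R\<bar>\<close>,
    which lies beyond the support.\<close>
  define T where "T = 1 + \<bar>R\<bar> / norm x"
  have T: "T \<ge> 1" "u (T *\<^sub>R x) = 0"
  proof -
    show "T \<ge> 1" by (simp add: T_def)
    have "norm (T *\<^sub>R x) = norm x + \<bar>R\<bar>" using x by (simp add: T_def field_simps)
    then have "norm (T *\<^sub>R x) > R" using x by (smt (verit) zero_less_norm_iff)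
    then show "u (T *\<^sub>R x) = 0" using R[of "T *\<^sub>R x"] by force
  qed
  define d where "d t = frechet_derivative u (at (t *\<^sub>R x)) x" for t
  define \<psi> where "\<psi> t = p * \<bar>u (t *\<^sub>R x)\<bar> powr (p - 1) * sgn (u (t *\<^sub>R x)) * d t" for t
  define g where "g t = p * \<bar>u (t *\<^sub>R x)\<bar> powr (p - 1) * \<bar>d t\<bar>" for t
  have du: "((\<lambda>t. u (t *\<^sub>R x)) has_real_derivative d t) (at t)" for t
  proof -
    have "((\<lambda>t. t *\<^sub>R x) has_derivative (\<lambda>s. s *\<^sub>R x)) (at t)" by (auto intro!: derivative_eq_intros)
    moreover have "(u has_derivative frechet_derivative u (at (t *\<^sub>R x))) (at (t *\<^sub>R x))"
      using smooth_fun_differentiable[OF sm] frechet_derivative_works by blast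
    ultimately have "((\<lambda>t. u (t *\<^sub>R x)) has_derivative (\<lambda>s. frechet_derivative u (at (t *\<^sub>R x)) (s *\<^sub>R x))) (at t)"
      by (rule has_derivative_compose)
    then show ?thesis
      unfolding has_field_derivative_def d_def
      by (simp add: linear_scale[OF linear_frechet_derivative[OF smooth_fun_differentiable[OF sm]]] mult_commute_abs)
  qed
  have "((\<lambda>t. \<bar>u (t *\<^sub>R x)\<bar> powr p) has_real_derivative \<psi> t) (at t)" for t
    using DERIV_chain2[OF abs_powr_has_real_derivative[OF p] du] unfolding \<psi>_def .
  then have I: "(\<psi> has_integral (\<bar>u (T *\<^sub>R x)\<bar> powr p - \<bar>u (1 *\<^sub>R x)\<bar> powr p)) {1..T}"
    by (intro fundamental_theorem_of_calculus T(1))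
      (auto simp: has_real_derivative_iff_has_vector_derivative[symmetric] intro: has_field_derivative_at_within)
  have uc: "continuous_on A (\<lambda>t. u (t *\<^sub>R x))" for A
    by (rule continuous_on_compose2[OF smooth_fun_continuous_on[OF sm, of UNIV]]) (auto intro!: continuous_intros)
  have dc: "continuous_on A d" for A
    unfolding d_def by (rule smooth_fun_derivative_continuous_on[OF sm]) (auto intro!: continuous_intros)
  have gc: "continuous_on A g" for A
    unfolding g_def using p by (intro continuous_intros continuous_on_powr' uc dc) auto
  have gi: "g integrable_on {1..T}" by (rule integrable_continuous_real[OF gc])
  have le: "norm (\<psi> t) \<le> g t" for t
    using p by (auto simp: \<psi>_def g_def abs_mult abs_sgn_eq)
  have g0: "g t \<ge> 0" for t using p by (simp add: g_def)
  have "\<bar>u x\<bar> powr p = norm (integral {1..T} \<psi>)"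
    using I T p by (simp add: integral_unique)
  also have "\<dots> \<le> integral {1..T} g"
    by (rule integral_norm_bound_integral[OF _ gi le]) (use I in \<open>auto simp: integrable_on_def\<close>)
  finally have "ennreal (\<bar>u x\<bar> powr p) \<le> ennreal (integral {1..T} g)" by (rule ennreal_leI)
  also have "\<dots> = (\<integral>\<^sup>+t. ennreal (g t) * indicator {1..T} t \<partial>lborel)"
    by (rule nn_integral_has_integral_lebesgue'[symmetric, OF g0 integrable_integral[OF gi]])
  also have "\<dots> \<le> (\<integral>\<^sup>+t. ennreal (g t) * indicator {1..} t \<partial>lborel)"
    by (intro nn_integral_mono) (auto simp: indicator_def)
  finally show ?thesis unfolding g_def d_def .
qed

lemma nn_integral_lborel_scaleR:
  fixes g :: "'a::euclidean_space \<Rightarrow> ennreal"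
  assumes [measurable]: "g \<in> borel_measurable borel" and c: "c > 0"
  shows "(\<integral>\<^sup>+x. g x \<partial>lborel) = (\<integral>\<^sup>+x. ennreal (c ^ DIM('a)) * g (c *\<^sub>R x) \<partial>lborel)"
proof -
  have "(\<integral>\<^sup>+x. g x \<partial>lborel) = (\<integral>\<^sup>+x. g x \<partial>density (distr lborel borel (\<lambda>x. 0 + c *\<^sub>R x)) (\<lambda>_. ennreal (\<bar>c\<bar> ^ DIM('a))))"
    using lborel_affine[of c "0::'a"] c by simp
  also have "\<dots> = (\<integral>\<^sup>+x. ennreal (c ^ DIM('a)) * g (c *\<^sub>R x) \<partial>lborel)"
    using c by (subst nn_integral_density) (auto simp: nn_integral_distr)
  finally show ?thesis .
qed

section \<open>The radial Hardy inequality outside a small ball\<close>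

context randers
begin

lemma borel_measurable_randers [measurable]:
  "h \<in> borel_measurable borel" "\<rho> \<in> borel_measurable borel" "bh \<theta> \<epsilon> n \<in> borel_measurable borel"
proof -
  show [measurable]: "h \<in> borel_measurable borel" "\<rho> \<in> borel_measurable borel"
    unfolding drift_def[abs_def] rad_def[abs_def] by measurable
  show "bh \<theta> \<epsilon> n \<in> borel_measurable borel" unfolding bh_def[abs_def] by measurable
qed

text \<open>This replaces integration by parts in polar coordinates. The ray bound is inserted, the
  integrals are exchanged, and the substitution z = t x moves the derivative of u to a fixed point
  and the dilation onto the explicit weight, whose t-integral is bounded by
  \<open>dilation_weight_le\<close>.\<close>

lemma hardy_dilation:
  fixes u :: "real^'n \<Rightarrow> real"
  assumes u: "u \<in> C0_infty" and p: "p > 1" and b: "real CARD('n) + \<alpha> - p > 0" and d: "\<delta> > 0"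
  shows "ennreal (real CARD('n) + \<alpha> - p) *
      (\<integral>\<^sup>+x. ennreal (\<rho> (norm x) powr (\<alpha> - p) * \<bar>u x\<bar> powr p * bh \<theta> \<epsilon> CARD('n) (norm x))
         * indicator {x. norm x > \<delta>} x \<partial>lborel)
    \<le> (\<integral>\<^sup>+x. ennreal (p * \<bar>u x\<bar> powr (p - 1) * \<bar>frechet_derivative u (at x) x\<bar>
         * (bh \<theta> \<epsilon> CARD('n) (norm x) * \<rho> (norm x) powr (\<alpha> - p + 1) / (norm x * (1 - h (norm x)))))
         * indicator {x. norm x > \<delta>} x \<partial>lborel)"
proof -
  let ?n = "CARD('n)"
  define \<beta> where "\<beta> = real ?n + \<alpha> - p"
  have be: "\<beta> > 0" using b by (simp add: \<beta>_def)
  have sm: "smooth_fun u" using u by (simp add: C0_infty_def)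
  define I :: "real^'n \<Rightarrow> ennreal" where "I = indicator {x. norm x > \<delta>}"
  define J :: "real \<Rightarrow> ennreal" where "J = indicator {1..}"
  define D where "D x = ennreal (\<beta> * \<rho> (norm x) powr (\<alpha> - p) * bh \<theta> \<epsilon> ?n (norm x)) * I x" for x :: "real^'n"
  define N where "N x = p * \<bar>u x\<bar> powr (p - 1) * \<bar>frechet_derivative u (at x) x\<bar>" for x
  have [measurable]: "I \<in> borel_measurable borel" "J \<in> borel_measurable borel"
    unfolding I_def J_def by measurable
  have [measurable]: "u \<in> borel_measurable borel"
    by (intro borel_measurable_continuous_onI smooth_fun_continuous_on sm)
  have [measurable]: "(\<lambda>x. frechet_derivative u (at x) x) \<in> borel_measurable borel"
    by (intro borel_measurable_continuous_onI smooth_fun_derivative_continuous_on sm continuous_intros)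
  have [measurable]: "D \<in> borel_measurable borel" "N \<in> borel_measurable borel"
    unfolding D_def N_def by measurable
  have N0: "N x \<ge> 0" for x using p by (simp add: N_def)
  have lin: "linear (frechet_derivative u (at x))" for x
    by (rule linear_frechet_derivative[OF smooth_fun_differentiable[OF sm]])
  \<comment> \<open>\<open>N\<close> differentiates at t x in the direction t x rather than x; the
    division by t compensates.\<close>
  have ray: "ennreal (\<bar>u x\<bar> powr p) \<le> (\<integral>\<^sup>+t. ennreal (N (t *\<^sub>R x) / t) * J t \<partial>lborel)" if "x \<noteq> 0" for x
  proof -
    have "N (t *\<^sub>R x) / t = p * \<bar>u (t *\<^sub>R x)\<bar> powr (p - 1) * \<bar>frechet_derivative u (at (t *\<^sub>R x)) x\<bar>" if "t \<ge> 1" for t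
      using that by (simp add: N_def linear_scale[OF lin] abs_mult)
    then have "(\<integral>\<^sup>+t. ennreal (N (t *\<^sub>R x) / t) * J t \<partial>lborel) =
        (\<integral>\<^sup>+t. ennreal (p * \<bar>u (t *\<^sub>R x)\<bar> powr (p - 1) * \<bar>frechet_derivative u (at (t *\<^sub>R x)) x\<bar>) * indicator {1..} t \<partial>lborel)"
      by (intro nn_integral_cong) (auto simp: J_def indicator_def)
    then show ?thesis using C0_infty_ray_bound[OF u that p] by simp
  qed
  have "ennreal \<beta> * (\<integral>\<^sup>+x. ennreal (\<rho> (norm x) powr (\<alpha> - p) * \<bar>u x\<bar> powr p * bh \<theta> \<epsilon> ?n (norm x)) * I x \<partial>lborel)
      = (\<integral>\<^sup>+x. ennreal \<beta> * (ennreal (\<rho> (norm x) powr (\<alpha> - p) * \<bar>u x\<bar> powr p * bh \<theta> \<epsilon> ?n (norm x)) * I x) \<partial>lborel)"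
    by (rule nn_integral_cmult[symmetric]) measurable
  also have "\<dots> = (\<integral>\<^sup>+x. D x * ennreal (\<bar>u x\<bar> powr p) \<partial>lborel)"
  proof (rule nn_integral_cong)
    fix x :: "real^'n"
    have "bh \<theta> \<epsilon> ?n (norm x) \<ge> 0" using bh_pos[of "norm x" ?n] by simp
    then show "ennreal \<beta> * (ennreal (\<rho> (norm x) powr (\<alpha> - p) * \<bar>u x\<bar> powr p * bh \<theta> \<epsilon> ?n (norm x)) * I x)
        = D x * ennreal (\<bar>u x\<bar> powr p)"
      unfolding D_def using be by (simp add: ennreal_mult mult_ac)
  qed
  also have "\<dots> \<le> (\<integral>\<^sup>+x. D x * (\<integral>\<^sup>+t. ennreal (N (t *\<^sub>R x) / t) * J t \<partial>lborel) \<partial>lborel)"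
  proof (rule nn_integral_mono)
    fix x :: "real^'n"
    show "D x * ennreal (\<bar>u x\<bar> powr p) \<le> D x * (\<integral>\<^sup>+t. ennreal (N (t *\<^sub>R x) / t) * J t \<partial>lborel)"
    proof (cases "x = 0")
      case True
      then have "D x = 0" using d by (simp add: D_def I_def)
      then show ?thesis by simp
    qed (use ray in \<open>auto intro: mult_left_mono\<close>)
  qed
  also have "\<dots> = (\<integral>\<^sup>+x. (\<integral>\<^sup>+t. D x * (ennreal (N (t *\<^sub>R x) / t) * J t) \<partial>lborel) \<partial>lborel)"
    by (intro nn_integral_cong nn_integral_cmult[symmetric]) measurable
  also have "\<dots> = (\<integral>\<^sup>+t. (\<integral>\<^sup>+x. D x * (ennreal (N (t *\<^sub>R x) / t) * J t) \<partial>lborel) \<partial>lborel)"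
    by (rule lborel_pair.Fubini') measurable
  \<comment> \<open>For fixed t the variable x is replaced by z / t, with Jacobian (1 /
    t)^n.\<close>
  also have "\<dots> = (\<integral>\<^sup>+t. (\<integral>\<^sup>+z. ennreal ((1 / t) ^ ?n) * (D ((1 / t) *\<^sub>R z) * (ennreal (N z / t) * J t)) \<partial>lborel) \<partial>lborel)"
  proof (rule nn_integral_cong)
    fix t :: real
    show "(\<integral>\<^sup>+x. D x * (ennreal (N (t *\<^sub>R x) / t) * J t) \<partial>lborel) =
       (\<integral>\<^sup>+z. ennreal ((1 / t) ^ ?n) * (D ((1 / t) *\<^sub>R z) * (ennreal (N z / t) * J t)) \<partial>lborel)"
    proof (cases "t \<ge> 1")
      case True
      then show ?thesis
        by (subst nn_integral_lborel_scaleR[of _ "1 / t"]) auto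
    qed (simp add: J_def)
  qed
  also have "\<dots> = (\<integral>\<^sup>+z. (\<integral>\<^sup>+t. ennreal ((1 / t) ^ ?n) * (D ((1 / t) *\<^sub>R z) * (ennreal (N z / t) * J t)) \<partial>lborel) \<partial>lborel)"
    by (rule lborel_pair.Fubini') measurable
  also have "\<dots> \<le> (\<integral>\<^sup>+z. ennreal (N z * (bh \<theta> \<epsilon> ?n (norm z) * \<rho> (norm z) powr (\<alpha> - p + 1) / (norm z * (1 - h (norm z))))) * I z \<partial>lborel)"
  proof (rule nn_integral_mono)
    fix z :: "real^'n"
    let ?q = "\<lambda>t. \<beta> * \<rho> (norm z / t) powr (\<alpha> - p) * bh \<theta> \<epsilon> ?n (norm z / t) * t powr (- real ?n - 1)"
    let ?K = "bh \<theta> \<epsilon> ?n (norm z) * \<rho> (norm z) powr (\<alpha> - p + 1) / (norm z * (1 - h (norm z)))"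
    have le: "ennreal ((1 / t) ^ ?n) * (D ((1 / t) *\<^sub>R z) * (ennreal (N z / t) * J t)) \<le> ennreal (N z) * I z * (ennreal (?q t) * J t)" for t
    \<comment> \<open>A dilation by t at least 1 moves points outwards, so z lies outside the
      \<delta>-ball whenever z / t does. This is how the cutoff passes from the left side to the
      right side.\<close>
    proof (cases "t \<ge> 1 \<and> norm z / t > \<delta>")
      case True
      then have t: "t \<ge> 1" "\<delta> < norm z / t" by auto
      have "norm z / t \<le> norm z" using t(1) mult_left_mono[of 1 t "norm z"] by (simp add: divide_simps)
      then have Iz: "I z = 1" "I ((1 / t) *\<^sub>R z) = 1" using t by (auto simp: I_def)
      have nn: "bh \<theta> \<epsilon> ?n (norm z / t) \<ge> 0" using bh_pos[of "norm z / t" ?n] t by simp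
      have "t powr (- real ?n - 1) = (1 / t) ^ ?n / t"
        using t(1) by (simp add: powr_diff powr_minus_divide powr_realpow power_one_over)
      then have "ennreal (N z) * ennreal (?q t) = ennreal ((1 / t) ^ ?n) * (ennreal (\<beta> * \<rho> (norm z / t) powr (\<alpha> - p) * bh \<theta> \<epsilon> ?n (norm z / t)) * ennreal (N z / t))"
        using t(1) N0[of z] nn be by (simp add: ennreal_mult[symmetric] mult_ac)
      then show ?thesis using t Iz by (simp add: D_def J_def)
    next
      case False
      then have "D ((1 / t) *\<^sub>R z) * J t = 0" by (auto simp: D_def I_def J_def indicator_def)
      moreover have "ennreal ((1 / t) ^ ?n) * (D ((1 / t) *\<^sub>R z) * (ennreal (N z / t) * J t))
          = ennreal ((1 / t) ^ ?n) * ennreal (N z / t) * (D ((1 / t) *\<^sub>R z) * J t)" by (simp only: mult_ac)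
      ultimately show ?thesis by (simp only: mult_zero_right zero_le)
    qed
    have "(\<integral>\<^sup>+t. ennreal ((1 / t) ^ ?n) * (D ((1 / t) *\<^sub>R z) * (ennreal (N z / t) * J t)) \<partial>lborel)
       \<le> (\<integral>\<^sup>+t. ennreal (N z) * I z * (ennreal (?q t) * J t) \<partial>lborel)"
      by (intro nn_integral_mono le)
    also have "\<dots> = ennreal (N z) * I z * (\<integral>\<^sup>+t. ennreal (?q t) * J t \<partial>lborel)"
      by (rule nn_integral_cmult) measurable
    also have "\<dots> \<le> ennreal (N z) * I z * ennreal ?K"
    proof (cases "norm z > \<delta>")
      case True
      then have "norm z > 0" using d by linarith
      then have "(\<integral>\<^sup>+t. ennreal (?q t) * J t \<partial>lborel) \<le> ennreal ?K"
        using dilation_weight_le[of "norm z" ?n \<alpha> p] d b unfolding \<beta>_def J_def by (simp add: Suc_leI)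
      then show ?thesis by (rule mult_left_mono) simp
    qed (simp add: I_def)
    also have "\<dots> = ennreal (N z * ?K) * I z"
      using bh_pos[of "norm z" ?n] drift_less_1[of "norm z"] N0[of z]
      by (subst ennreal_mult) (auto simp: mult_ac intro!: divide_nonneg_nonneg mult_nonneg_nonneg)
    finally show "(\<integral>\<^sup>+t. ennreal ((1 / t) ^ ?n) * (D ((1 / t) *\<^sub>R z) * (ennreal (N z / t) * J t)) \<partial>lborel) \<le> ennreal (N z * ?K) * I z" .
  qed
  finally show ?thesis unfolding I_def N_def \<beta>_def .
qed

text \<open>Young's inequality with exponents p and p / (p - 1) for b and (g a)^(p-1). The weight g
  makes the coefficient of a^p equal to (p - 1) / p times g^p, strictly below the g^p that
  \<open>hardy_cut\<close> has on its left side.\<close>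

lemma hardy_young:
  fixes a b g p :: real
  assumes p: "p > 1" and g: "g > 0" and ab: "a \<ge> 0" "b \<ge> 0"
  shows "g powr (p - 1) * (b * a powr (p - 1)) \<le> (p - 1) / p * (g powr p * a powr p) + b powr p / p"
proof -
  define q where "q = p / (p - 1)"
  have q: "q > 1" "1 / p + 1 / q = 1" using p by (auto simp: q_def field_simps)
  have "b * (g * a) powr (p - 1) \<le> b powr p / p + ((g * a) powr (p - 1)) powr q / q"
    using g ab by (intro Youngs_inequality p q) auto
  moreover have "((g * a) powr (p - 1)) powr q = g powr p * a powr p"
    using p g ab by (simp add: powr_powr q_def powr_mult)
  moreover have "(g * a) powr (p - 1) = g powr (p - 1) * a powr (p - 1)"
    using g ab by (simp add: powr_mult)
  ultimately show ?thesis by (simp add: q_def mult_ac)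
qed

text \<open>Finiteness is what allows this integral to be subtracted from both sides. On the compact
  annulus that carries the integrand, \<rho> is bounded away from 0 and the weight is
  continuous.\<close>

lemma hardy_cut_finite:
  fixes u :: "real^'n \<Rightarrow> real"
  assumes u: "u \<in> C0_infty" and p: "p > 1" and d: "\<delta> > 0"
  shows "(\<integral>\<^sup>+x. ennreal (\<rho> (norm x) powr (\<alpha> - p) * \<bar>u x\<bar> powr p * bh \<theta> \<epsilon> CARD('n) (norm x))
         * indicator {x. norm x > \<delta>} x \<partial>lborel) < \<infinity>"
proof -
  have sm: "smooth_fun u" using u by (simp add: C0_infty_def)
  have "bounded {x. u x \<noteq> 0}"
    using u unfolding C0_infty_def by (auto intro: bounded_subset[OF compact_imp_bounded closure_subset])
  then obtain R where R: "\<And>y. u y \<noteq> 0 \<Longrightarrow> norm y \<le> R" by (auto simp: bounded_iff)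
  define f where "f x = \<rho> (norm x) powr (\<alpha> - p) * \<bar>u x\<bar> powr p" for x :: "real^'n"
  define K where "K = cball (0 :: real^'n) R - ball 0 \<delta>"
  have K: "compact K" unfolding K_def by (intro compact_diff) auto
  have "continuous_on K (\<lambda>x. \<rho> (norm x))"
    unfolding rad_def K_def using e0 by (intro continuous_intros) (auto simp: add_nonneg_eq_0_iff)
  moreover have "\<rho> (norm x) \<noteq> 0" if "x \<in> K" for x
  proof -
    have "norm x \<ge> \<delta>" using that by (auto simp: K_def)
    then show ?thesis using d rad_pos[of "norm x"] by linarith
  qed
  ultimately have "continuous_on K (\<lambda>x. \<rho> (norm x) powr (\<alpha> - p))"
    by (intro continuous_on_powr continuous_on_const) auto
  moreover have "continuous_on K (\<lambda>x. \<bar>u x\<bar> powr p)"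
    by (rule continuous_on_powr'[OF continuous_on_rabs[OF smooth_fun_continuous_on[OF sm]] continuous_on_const])
      (use p in auto)
  ultimately have "continuous_on K f" unfolding f_def by (rule continuous_on_mult)
  then have "bounded (f ` K)" using K by (intro compact_imp_bounded compact_continuous_image)
  then obtain M where M: "\<And>x. x \<in> K \<Longrightarrow> \<bar>f x\<bar> \<le> M" by (auto simp: bounded_iff)
  have "(\<integral>\<^sup>+x. ennreal (\<rho> (norm x) powr (\<alpha> - p) * \<bar>u x\<bar> powr p * bh \<theta> \<epsilon> CARD('n) (norm x))
         * indicator {x. norm x > \<delta>} x \<partial>lborel) \<le> (\<integral>\<^sup>+x. ennreal M * indicator (cball (0::real^'n) R) x \<partial>lborel)"
  proof (rule nn_integral_mono)
    fix x :: "real^'n"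
    show "ennreal (\<rho> (norm x) powr (\<alpha> - p) * \<bar>u x\<bar> powr p * bh \<theta> \<epsilon> CARD('n) (norm x)) * indicator {x. norm x > \<delta>} x
      \<le> ennreal M * indicator (cball (0::real^'n) R) x"
    proof (cases "norm x > \<delta> \<and> u x \<noteq> 0")
      case True
      then have x: "x \<in> K" "norm x \<le> R" using R[of x] by (auto simp: K_def)
      have "f x * bh \<theta> \<epsilon> CARD('n) (norm x) \<le> f x * 1"
        using bh_le_1[of "norm x" "CARD('n)"] by (intro mult_left_mono) (auto simp: f_def)
      also have "\<dots> \<le> M" using M[OF x(1)] by simp
      finally show ?thesis using True x by (simp add: f_def ennreal_leI)
    qed (use p in \<open>auto simp: indicator_def\<close>)
  qed
  also have "\<dots> = ennreal M * emeasure lborel (cball (0::real^'n) R)"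
    by (rule nn_integral_cmult_indicator) simp
  also have "\<dots> < \<infinity>" using emeasure_lborel_cball_finite[of "0::real^'n" R] by (simp add: ennreal_mult_less_top)
  finally show ?thesis .
qed

text \<open>With A the Hardy integral, C the energy and g = (n + \<alpha> - p) / p, dilation and
  Young give g^p A at most (p - 1) / p g^p A + C / p. Absorbing the first term leaves g^p A at most
  C.\<close>

lemma hardy_cut:
  fixes u :: "real^'n \<Rightarrow> real"
  assumes u: "u \<in> C0_infty" and p: "p > 1" and b: "real CARD('n) + \<alpha> - p > 0" and d: "\<delta> > 0"
  shows "ennreal (((real CARD('n) + \<alpha> - p) / p) powr p) *
      (\<integral>\<^sup>+x. ennreal (\<rho> (norm x) powr (\<alpha> - p) * \<bar>u x\<bar> powr p * bh \<theta> \<epsilon> CARD('n) (norm x))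
         * indicator {x. norm x > \<delta>} x \<partial>lborel)
    \<le> (\<integral>\<^sup>+x. ennreal (\<rho> (norm x) powr \<alpha> * (\<bar>frechet_derivative u (at x) x\<bar> / (norm x * (1 - h (norm x)))) powr p
           * bh \<theta> \<epsilon> CARD('n) (norm x)) \<partial>lborel)"
proof -
  let ?n = "CARD('n)"
  define g where "g = (real ?n + \<alpha> - p) / p"
  have g: "g > 0" using b p by (simp add: g_def)
  have sm: "smooth_fun u" using u by (simp add: C0_infty_def)
  have [measurable]: "u \<in> borel_measurable borel"
    by (intro borel_measurable_continuous_onI smooth_fun_continuous_on sm)
  have [measurable]: "(\<lambda>x. frechet_derivative u (at x) x) \<in> borel_measurable borel"
    by (intro borel_measurable_continuous_onI smooth_fun_derivative_continuous_on sm continuous_intros)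
  define I :: "real^'n \<Rightarrow> ennreal" where "I = indicator {x. norm x > \<delta>}"
  have [measurable]: "I \<in> borel_measurable borel" unfolding I_def by measurable
  define X where "X x = \<bar>frechet_derivative u (at x) x\<bar> / (norm x * (1 - h (norm x)))" for x
  have [measurable]: "X \<in> borel_measurable borel" unfolding X_def by measurable
  define a where "a x = \<rho> (norm x) powr (\<alpha> - p) * \<bar>u x\<bar> powr p * bh \<theta> \<epsilon> ?n (norm x)" for x
  define c where "c x = \<rho> (norm x) powr \<alpha> * X x powr p * bh \<theta> \<epsilon> ?n (norm x)" for x
  define k where "k x = p * \<bar>u x\<bar> powr (p - 1) * \<bar>frechet_derivative u (at x) x\<bar>
         * (bh \<theta> \<epsilon> ?n (norm x) * \<rho> (norm x) powr (\<alpha> - p + 1) / (norm x * (1 - h (norm x))))" for x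
  have [measurable]: "a \<in> borel_measurable borel" "c \<in> borel_measurable borel" "k \<in> borel_measurable borel"
    unfolding a_def c_def k_def by measurable
  have nn: "a x \<ge> 0" "c x \<ge> 0" for x :: "real^'n"
    using bh_pos[of "norm x" ?n] by (auto simp: a_def c_def)
  have X0: "X x \<ge> 0" for x using drift_less_1[of "norm x"] by (simp add: X_def)
  define A where "A = (\<integral>\<^sup>+x. ennreal (a x) * I x \<partial>lborel)"
  define C where "C = (\<integral>\<^sup>+x. ennreal (c x) \<partial>lborel)"
  have young: "g powr (p - 1) / p * k x \<le> (p - 1) / p * g powr p * a x + c x / p" if "norm x > \<delta>" for x
  proof -
    let ?r = "\<rho> (norm x)"
    have r: "?r > 0" using that d by (intro rad_pos) linarith
    define w where "w = bh \<theta> \<epsilon> ?n (norm x) * ?r powr \<alpha>"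
    have w: "w \<ge> 0" using bh_pos[of "norm x" ?n] by (simp add: w_def)
    have "?r powr (\<alpha> - p + 1) = ?r powr \<alpha> / ?r powr (p - 1)"
      unfolding powr_diff[symmetric] by (simp add: algebra_simps)
    then have e1: "k x = p * (w * (X x * (\<bar>u x\<bar> / ?r) powr (p - 1)))"
      using r by (simp add: k_def w_def X_def powr_divide mult_ac)
    have e2: "a x = w * (\<bar>u x\<bar> / ?r) powr p"
      using r by (simp add: a_def w_def powr_divide powr_diff)
    have e3: "c x = w * X x powr p" by (simp add: c_def w_def)
    have "w * (g powr (p - 1) * (X x * (\<bar>u x\<bar> / ?r) powr (p - 1)))
        \<le> w * ((p - 1) / p * (g powr p * (\<bar>u x\<bar> / ?r) powr p) + X x powr p / p)"
      using r by (intro mult_left_mono w hardy_young p g X0) auto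
    then show ?thesis unfolding e1 e2 e3 using p by (simp add: algebra_simps add_divide_distrib)
  qed
  \<comment> \<open>Since n + \<alpha> - p equals g p, this multiplier turns the coefficient of A
    into exactly g^p.\<close>
  have "ennreal (g powr (p - 1) / p) * (ennreal (real ?n + \<alpha> - p) * A)
      \<le> ennreal (g powr (p - 1) / p) * (\<integral>\<^sup>+x. ennreal (k x) * I x \<partial>lborel)"
    using hardy_dilation[OF u p b d] unfolding A_def a_def k_def I_def by (intro mult_left_mono) auto
  also have "\<dots> = (\<integral>\<^sup>+x. ennreal (g powr (p - 1) / p) * (ennreal (k x) * I x) \<partial>lborel)"
    by (rule nn_integral_cmult[symmetric]) measurable
  also have "\<dots> \<le> (\<integral>\<^sup>+x. ennreal ((p - 1) / p * g powr p) * (ennreal (a x) * I x) + ennreal (1 / p) * ennreal (c x) \<partial>lborel)"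
  proof (rule nn_integral_mono)
    fix x :: "real^'n"
    show "ennreal (g powr (p - 1) / p) * (ennreal (k x) * I x)
        \<le> ennreal ((p - 1) / p * g powr p) * (ennreal (a x) * I x) + ennreal (1 / p) * ennreal (c x)"
    proof (cases "norm x > \<delta>")
      case True
      have "ennreal (g powr (p - 1) / p) * ennreal (k x) = ennreal (g powr (p - 1) / p * k x)"
        using p by (intro ennreal_mult'[symmetric]) simp
      also have "\<dots> \<le> ennreal ((p - 1) / p * g powr p * a x + c x / p)" by (intro ennreal_leI young True)
      also have "\<dots> = ennreal ((p - 1) / p * g powr p) * ennreal (a x) + ennreal (1 / p) * ennreal (c x)"
        using p nn[of x] by (subst ennreal_plus) (auto simp: ennreal_mult[symmetric])
      finally show ?thesis using True by (simp add: I_def)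
    qed (simp add: I_def)
  qed
  also have "\<dots> = ennreal ((p - 1) / p * g powr p) * A + ennreal (1 / p) * C"
    unfolding A_def C_def by (subst nn_integral_add) (auto simp: nn_integral_cmult)
  finally have main: "ennreal (g powr (p - 1) / p) * (ennreal (real ?n + \<alpha> - p) * A)
      \<le> ennreal ((p - 1) / p * g powr p) * A + ennreal (1 / p) * C" .
  \<comment> \<open>From here on A is a real number, and an infinite C is trivial, so absorption
    becomes real arithmetic.\<close>
  have "A < \<infinity>" unfolding A_def a_def I_def by (rule hardy_cut_finite[OF u p d])
  then obtain A' where A': "A = ennreal A'" "A' \<ge> 0" by (cases A) auto
  have "ennreal (g powr p) * A \<le> C"
  proof (cases C)
    case (real C')
    have gp: "g powr (p - 1) / p * (real ?n + \<alpha> - p) = g powr p"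
    proof -
      have "real ?n + \<alpha> - p = g * p" using p by (simp add: g_def)
      then show ?thesis using g p by (simp add: powr_diff)
    qed
    have "ennreal (g powr (p - 1) / p) * (ennreal (real ?n + \<alpha> - p) * A) = ennreal (g powr (p - 1) / p * (real ?n + \<alpha> - p) * A')"
      using A' b p by (simp add: ennreal_mult[symmetric] mult.assoc)
    then have L: "ennreal (g powr (p - 1) / p) * (ennreal (real ?n + \<alpha> - p) * A) = ennreal (g powr p * A')"
      unfolding gp .
    have Rr: "ennreal ((p - 1) / p * g powr p) * A + ennreal (1 / p) * C = ennreal ((p - 1) / p * g powr p * A' + 1 / p * C')"
      using A' real p by (simp add: ennreal_mult[symmetric] ennreal_plus[symmetric] del: ennreal_plus)
    have "g powr p * A' \<le> (p - 1) / p * g powr p * A' + 1 / p * C'"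
      using main unfolding L Rr using A' real p by (subst (asm) ennreal_le_iff) auto
    then have "g powr p * A' \<le> C'" using p by (simp add: field_simps)
    then show ?thesis using A' real by (simp add: ennreal_mult[symmetric] ennreal_leI)
  qed simp
  then show ?thesis unfolding A_def C_def a_def c_def X_def I_def g_def .
qed

end

section \<open>From the radial inequality to the dual metric\<close>

context randers
begin

lemma nn_integral_BH_measure:
  fixes g :: "real^'n \<Rightarrow> ennreal"
  assumes [measurable]: "g \<in> borel_measurable borel"
  shows "(\<integral>\<^sup>+x. g x \<partial>BH_measure (F_eps \<theta> \<epsilon>)) = (\<integral>\<^sup>+x. ennreal (bh \<theta> \<epsilon> CARD('n) (norm x)) * g x \<partial>lborel)"
  unfolding BH_measure_def BH_density_F_eps[OF th0 th1 e0]
  by (rule nn_integral_density) measurable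

lemma sets_BH_measure: "sets (BH_measure (F_eps \<theta> \<epsilon> :: real^'n \<Rightarrow> real^'n \<Rightarrow> real)) = sets borel"
  by (simp add: BH_measure_def)

text \<open>The constant does not depend on the cutoff, so \<delta> = 1 / (k + 1) decreases to 0 by
  monotone convergence.\<close>

lemma hardy_radial:
  fixes u :: "real^'n \<Rightarrow> real"
  assumes u: "u \<in> C0_infty" and p: "p > 1" and b: "real CARD('n) + \<alpha> - p > 0"
  shows "ennreal (((real CARD('n) + \<alpha> - p) / p) powr p) *
      (\<integral>\<^sup>+x. ennreal (\<rho> (norm x) powr (\<alpha> - p) * \<bar>u x\<bar> powr p * bh \<theta> \<epsilon> CARD('n) (norm x)) \<partial>lborel)
    \<le> (\<integral>\<^sup>+x. ennreal (\<rho> (norm x) powr \<alpha> * (\<bar>frechet_derivative u (at x) x\<bar> / (norm x * (1 - h (norm x)))) powr p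
           * bh \<theta> \<epsilon> CARD('n) (norm x)) \<partial>lborel)" (is "?c * _ \<le> ?B")
proof -
  have sm: "smooth_fun u" using u by (simp add: C0_infty_def)
  have [measurable]: "u \<in> borel_measurable borel"
    by (intro borel_measurable_continuous_onI smooth_fun_continuous_on sm)
  define a where "a x = \<rho> (norm x) powr (\<alpha> - p) * \<bar>u x\<bar> powr p * bh \<theta> \<epsilon> CARD('n) (norm x)" for x
  have [measurable]: "a \<in> borel_measurable borel" unfolding a_def by measurable
  let ?f = "\<lambda>k x. ennreal (a x) * indicator {x :: real^'n. norm x > 1 / real (Suc k)} x"
  have inc: "incseq ?f"
  proof (intro incseq_SucI le_funI mult_left_mono)
    fix k and x :: "real^'n"
    have "1 / real (Suc (Suc k)) \<le> 1 / real (Suc k)" by (intro divide_left_mono) auto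
    then show "indicator {x. norm x > 1 / real (Suc k)} x \<le> (indicator {x. norm x > 1 / real (Suc (Suc k))} x :: ennreal)"
      by (auto simp: indicator_def)
  qed simp
  have "ennreal (a x) \<le> (SUP k. ?f k x)" for x
  proof (cases "x = 0")
    case False
    then obtain k where "1 / real (Suc k) < norm x"
      using nat_approx_posE[of "norm x"] by (auto simp: of_nat_Suc)
    then have "ennreal (a x) = ?f k x" by simp
    also have "\<dots> \<le> (SUP k. ?f k x)" by (rule SUP_upper) simp
    finally show ?thesis .
  \<comment> \<open>At the origin \<rho> is 0, and \<open>0 powr _ = 0\<close> makes
    \<open>a\<close> vanish there whatever the sign of the exponent.\<close>
  qed (simp add: a_def rad_def)
  then have "(\<integral>\<^sup>+x. ennreal (a x) \<partial>lborel) \<le> (\<integral>\<^sup>+x. (SUP k. ?f k x) \<partial>lborel)" by (intro nn_integral_mono)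
  also have "\<dots> = (SUP k. \<integral>\<^sup>+x. ?f k x \<partial>lborel)"
    by (rule nn_integral_monotone_convergence_SUP[OF inc]) measurable
  finally have "?c * (\<integral>\<^sup>+x. ennreal (a x) \<partial>lborel) \<le> ?c * (SUP k. \<integral>\<^sup>+x. ?f k x \<partial>lborel)"
    by (rule mult_left_mono) simp
  also have "\<dots> = (SUP k. ?c * (\<integral>\<^sup>+x. ?f k x \<partial>lborel))" by (rule SUP_mult_left_ennreal)
  also have "\<dots> \<le> ?B"
    unfolding a_def by (intro SUP_least hardy_cut[OF u p b]) simp
  finally show ?thesis unfolding a_def .
qed

text \<open>The derivative with respect to \<rho> carries the factor 1 / (1 - h), while the dual
  metric is bounded below with 1 / (1 + h). Because h is at most \<theta>, the factor
  \<open>lam\<close> covers the quotient (1 + h) / (1 - h).\<close>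

theorem hardy_inequality:
  fixes u :: "real^'n \<Rightarrow> real"
  assumes u: "u \<in> C0_infty" and p: "p > 1" and b: "p < real CARD('n) + \<alpha>" and lam: "lam = (1 + \<theta>) / (1 - \<theta>)"
  shows "ennreal (((real CARD('n) + \<alpha> - p) / p) powr p) *
              (\<integral>\<^sup>+ x. ennreal (finsler_dist (F_eps \<theta> \<epsilon>) 0 x powr \<alpha> *
                   (\<bar>u x\<bar> powr p / finsler_dist (F_eps \<theta> \<epsilon>) 0 x powr p))
                 \<partial>BH_measure (F_eps \<theta> \<epsilon>))
    \<le> ennreal (lam powr p) *
              (\<integral>\<^sup>+ x. ennreal (finsler_dist (F_eps \<theta> \<epsilon>) 0 x powr \<alpha> *
                   dual_metric (F_eps \<theta> \<epsilon>) x (frechet_derivative u (at x)) powr p)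
                 \<partial>BH_measure (F_eps \<theta> \<epsilon>))"
proof -
  let ?n = "CARD('n)"
  have sm: "smooth_fun u" using u by (simp add: C0_infty_def)
  have l0: "lam > 0" using lam th0 th1 by simp
  have [measurable]: "u \<in> borel_measurable borel"
    by (intro borel_measurable_continuous_onI smooth_fun_continuous_on sm)
  have [measurable]: "(\<lambda>x. frechet_derivative u (at x) x) \<in> borel_measurable borel"
    by (intro borel_measurable_continuous_onI smooth_fun_derivative_continuous_on sm continuous_intros)
  define X where "X x = \<bar>frechet_derivative u (at x) x\<bar> / (norm x * (1 - h (norm x)))" for x
  have X0: "X x \<ge> 0" for x using drift_less_1[of "norm x"] by (simp add: X_def)
  have [measurable]: "X \<in> borel_measurable borel" unfolding X_def by measurable
  have "(\<integral>\<^sup>+ x. ennreal (\<rho> (norm x) powr \<alpha> * (\<bar>u x\<bar> powr p / \<rho> (norm x) powr p)) \<partial>BH_measure (F_eps \<theta> \<epsilon>))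
     = (\<integral>\<^sup>+x. ennreal (\<rho> (norm x) powr (\<alpha> - p) * \<bar>u x\<bar> powr p * bh \<theta> \<epsilon> ?n (norm x)) \<partial>lborel)"
  proof (subst nn_integral_BH_measure)
    show "(\<integral>\<^sup>+x. ennreal (bh \<theta> \<epsilon> ?n (norm x)) * ennreal (\<rho> (norm x) powr \<alpha> * (\<bar>u x\<bar> powr p / \<rho> (norm x) powr p)) \<partial>lborel) =
     (\<integral>\<^sup>+x. ennreal (\<rho> (norm x) powr (\<alpha> - p) * \<bar>u x\<bar> powr p * bh \<theta> \<epsilon> ?n (norm x)) \<partial>lborel)"
    proof (rule nn_integral_cong)
      fix x :: "real^'n"
      have "bh \<theta> \<epsilon> ?n (norm x) \<ge> 0" using bh_pos[of "norm x" ?n] by simp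
      then show "ennreal (bh \<theta> \<epsilon> ?n (norm x)) * ennreal (\<rho> (norm x) powr \<alpha> * (\<bar>u x\<bar> powr p / \<rho> (norm x) powr p))
        = ennreal (\<rho> (norm x) powr (\<alpha> - p) * \<bar>u x\<bar> powr p * bh \<theta> \<epsilon> ?n (norm x))"
        by (simp add: ennreal_mult[symmetric] powr_diff mult_ac)
    qed
  qed measurable
  note lhs = this
  have "(\<integral>\<^sup>+x. ennreal (\<rho> (norm x) powr \<alpha> * X x powr p * bh \<theta> \<epsilon> ?n (norm x)) \<partial>lborel)
      = (\<integral>\<^sup>+x. ennreal (lam powr p) * ennreal (\<rho> (norm x) powr \<alpha> * (X x / lam) powr p) \<partial>BH_measure (F_eps \<theta> \<epsilon>))"
  proof (subst nn_integral_BH_measure)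
    show "(\<integral>\<^sup>+x. ennreal (\<rho> (norm x) powr \<alpha> * X x powr p * bh \<theta> \<epsilon> ?n (norm x)) \<partial>lborel)
      = (\<integral>\<^sup>+x. ennreal (bh \<theta> \<epsilon> ?n (norm x)) * (ennreal (lam powr p) * ennreal (\<rho> (norm x) powr \<alpha> * (X x / lam) powr p)) \<partial>lborel)"
    proof (rule nn_integral_cong)
      fix x :: "real^'n"
      have "bh \<theta> \<epsilon> ?n (norm x) \<ge> 0" using bh_pos[of "norm x" ?n] by simp
      moreover have "lam powr p * (X x / lam) powr p = X x powr p" using X0[of x] l0 by (simp add: powr_divide)
      then have "\<rho> (norm x) powr \<alpha> * X x powr p = lam powr p * (\<rho> (norm x) powr \<alpha> * (X x / lam) powr p)" by (simp add: mult_ac)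
      ultimately show "ennreal (\<rho> (norm x) powr \<alpha> * X x powr p * bh \<theta> \<epsilon> ?n (norm x))
        = ennreal (bh \<theta> \<epsilon> ?n (norm x)) * (ennreal (lam powr p) * ennreal (\<rho> (norm x) powr \<alpha> * (X x / lam) powr p))"
        by (simp add: ennreal_mult[symmetric] mult_ac)
    qed
  qed measurable
  also have "\<dots> = ennreal (lam powr p) * (\<integral>\<^sup>+x. ennreal (\<rho> (norm x) powr \<alpha> * (X x / lam) powr p) \<partial>BH_measure (F_eps \<theta> \<epsilon>))"
    by (rule nn_integral_cmult) (subst measurable_cong_sets[OF sets_BH_measure refl], measurable)
  also have "\<dots> \<le> ennreal (lam powr p) * (\<integral>\<^sup>+x. ennreal (\<rho> (norm x) powr \<alpha> *
       dual_metric (F_eps \<theta> \<epsilon>) x (frechet_derivative u (at x)) powr p) \<partial>BH_measure (F_eps \<theta> \<epsilon>))"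
  proof (intro mult_left_mono nn_integral_mono ennreal_leI powr_mono2)
    fix x :: "real^'n"
    have xi: "bounded_linear (frechet_derivative u (at x))"
      using smooth_fun_differentiable[OF sm] frechet_derivative_works has_derivative_bounded_linear by blast
    show "X x / lam \<le> dual_metric (F_eps \<theta> \<epsilon>) x (frechet_derivative u (at x))"
    proof (cases "x = 0")
      case True
      then show ?thesis using dual_metric_nonneg[OF xi] by (simp add: X_def)
    next
      case False
      have h01: "0 \<le> h (norm x)" "h (norm x) \<le> \<theta>" using drift_nonneg drift_le by auto
      have "(1 + h (norm x)) * (1 - \<theta>) \<le> (1 - h (norm x)) * (1 + \<theta>)" using h01 by (simp add: algebra_simps)
      then have "1 + h (norm x) \<le> (1 - h (norm x)) * lam" using th1 unfolding lam by (simp add: pos_le_divide_eq)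
      then have "\<bar>frechet_derivative u (at x) x\<bar> / (norm x * ((1 - h (norm x)) * lam))
         \<le> \<bar>frechet_derivative u (at x) x\<bar> / (norm x * (1 + h (norm x)))"
        using False h01 th1 l0 by (intro divide_left_mono mult_left_mono mult_pos_pos) auto
      then show ?thesis using dual_metric_ge_radial[OF xi False] by (simp add: X_def mult.assoc)
    qed
  qed (use X0 l0 p in auto)
  finally have rhs: "(\<integral>\<^sup>+x. ennreal (\<rho> (norm x) powr \<alpha> * X x powr p * bh \<theta> \<epsilon> ?n (norm x)) \<partial>lborel)
    \<le> ennreal (lam powr p) * (\<integral>\<^sup>+x. ennreal (\<rho> (norm x) powr \<alpha> *
       dual_metric (F_eps \<theta> \<epsilon>) x (frechet_derivative u (at x)) powr p) \<partial>BH_measure (F_eps \<theta> \<epsilon>))" .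
  show ?thesis
    unfolding finsler_dist_F_eps[OF th0 e0] lhs
    by (rule order_trans[OF hardy_radial[OF u p] rhs[unfolded X_def]]) (use b in simp)
qed

end

section \<open>Sharpness\<close>

text \<open>The cutoff itself is k = 0. The index is there because differentiation leads to
  combinations of members with higher index, so the whole family is closed under
  derivatives.\<close>

definition bump :: "nat \<Rightarrow> real \<Rightarrow> real" where
  "bump k t = (if t \<le> 0 then 0 else inverse t ^ k * exp (- inverse t))"

lemma bump_nonneg: "bump k t \<ge> 0"
  by (simp add: bump_def)

lemma bump_has_derivative:
  "(bump k has_real_derivative (bump (k + 2) t - real k * bump (k + 1) t)) (at t)"
proof -
  consider "t > 0" | "t < 0" | "t = 0" by linarith
  then show ?thesis
  proof cases
    case 1
    have "((\<lambda>t. inverse t ^ k * exp (- inverse t)) has_real_derivative (bump (k + 2) t - real k * bump (k + 1) t)) (at t)"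
    proof -
      have d1: "(inverse has_real_derivative - (inverse t * inverse t)) (at t)"
        using DERIV_inverse[of t] 1 by (simp add: power2_eq_square)
      from DERIV_mult[OF DERIV_power[OF d1, of k] DERIV_fun_exp[OF DERIV_minus[OF d1]]] show ?thesis
        using 1 by (cases k) (simp_all add: bump_def algebra_simps)
    qed
    then show ?thesis
      by (rule has_field_derivative_transform_within_open[where S="{0<..}"]) (use 1 in \<open>auto simp: bump_def\<close>)
  next
    case 2
    have "((\<lambda>t. 0) has_real_derivative (bump (k + 2) t - real k * bump (k + 1) t)) (at t)"
      using 2 by (simp add: bump_def)
    then show ?thesis
      by (rule has_field_derivative_transform_within_open[where S="{..<0}"]) (use 2 in \<open>auto simp: bump_def\<close>)
  next
    case 3
    \<comment> \<open>With s = 1 / t the right-hand difference quotient at 0 is s^(k+1) exp(-s),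
      which tends to 0.\<close>
    have "((\<lambda>t::real. inverse t ^ (k + 1) / exp (inverse t)) \<longlongrightarrow> 0) (at_right 0)"
      by (rule filterlim_compose[OF tendsto_power_div_exp_0 filterlim_inverse_at_top_right])
    then have "((\<lambda>t. bump k t / t) \<longlongrightarrow> 0) (at_right 0)"
      by (rule Lim_transform_eventually)
        (auto simp: eventually_at_filter bump_def exp_minus field_simps)
    moreover have "((\<lambda>t. bump k t / t) \<longlongrightarrow> 0) (at_left 0)"
      by (rule Lim_transform_eventually[OF tendsto_const]) (auto simp: eventually_at_filter bump_def)
    ultimately have "((\<lambda>t. bump k t / t) \<longlongrightarrow> 0) (at 0)"
      by (rule filterlim_split_at[rotated])
    then show ?thesis using 3 by (simp add: DERIV_def bump_def)
  qed
qed

text \<open>A class of expressions closed under all partial derivatives. \<open>smooth_fun\<close>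
  is coinductive, so such a class is exactly an invariant for coinduction. Powers are restricted to
  globally positive bases, where they are differentiable everywhere.\<close>

inductive elementary :: "(real^'n \<Rightarrow> real) \<Rightarrow> bool" where
  const: "elementary (\<lambda>x. c)"
| coord: "elementary (\<lambda>x. x $ i)"
| add: "elementary f \<Longrightarrow> elementary g \<Longrightarrow> elementary (\<lambda>x. f x + g x)"
| mult: "elementary f \<Longrightarrow> elementary g \<Longrightarrow> elementary (\<lambda>x. f x * g x)"
| powr: "elementary f \<Longrightarrow> (\<And>x. f x > 0) \<Longrightarrow> elementary (\<lambda>x. f x powr b)"
| bump: "elementary f \<Longrightarrow> elementary (\<lambda>x. bump k (f x))"

lemma frechet_derivative_chain_real:
  fixes f :: "'a::real_normed_vector \<Rightarrow> real"
  assumes "f differentiable (at x)" "(\<phi> has_real_derivative d) (at (f x))"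
  shows "((\<lambda>x. \<phi> (f x)) has_derivative (\<lambda>y. d * frechet_derivative f (at x) y)) (at x)"
  using has_derivative_compose[OF frechet_derivative_works[THEN iffD1, OF assms(1)] assms(2)[unfolded has_field_derivative_def]]
  by simp

lemma elementary_derivative:
  fixes f :: "real^'n \<Rightarrow> real"
  assumes "elementary f"
  shows "(\<forall>x. f differentiable (at x)) \<and> (\<forall>i. elementary (\<lambda>x. frechet_derivative f (at x) (axis i 1)))"
  using assms
proof induction
  case (const c)
  have "((\<lambda>x. c) has_derivative (\<lambda>y. 0)) (at x)" for x :: "real^'n" by simp
  from frechet_derivative_at[OF this] show ?case by (auto intro: elementary.const simp: fun_eq_iff)
next
  case (coord j)
  have d: "((\<lambda>x. x $ j) has_derivative (\<lambda>y. y $ j)) (at x)" for x :: "real^'n"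
    by (rule bounded_linear.has_derivative[OF bounded_linear_vec_nth has_derivative_ident])
  have "frechet_derivative (\<lambda>x. x $ j) (at x) (axis i 1) = axis i 1 $ j" for x :: "real^'n" and i
    by (simp only: frechet_derivative_at[OF d, symmetric])
  then show ?case using d by (auto intro: elementary.const simp: differentiable_def)
next
  case (add f g)
  have d: "((\<lambda>x. f x + g x) has_derivative (\<lambda>y. frechet_derivative f (at x) y + frechet_derivative g (at x) y)) (at x)" for x
    using add.IH by (intro has_derivative_add) (auto simp: frechet_derivative_works[symmetric])
  have "frechet_derivative (\<lambda>x. f x + g x) (at x) (axis i 1)
      = frechet_derivative f (at x) (axis i 1) + frechet_derivative g (at x) (axis i 1)" for x i
    by (simp only: frechet_derivative_at[OF d, symmetric])
  then show ?case using d add.IH by (auto intro: elementary.add simp: differentiable_def)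
next
  case (mult f g)
  have d: "((\<lambda>x. f x * g x) has_derivative (\<lambda>y. f x * frechet_derivative g (at x) y + frechet_derivative f (at x) y * g x)) (at x)" for x
    using mult.IH by (intro has_derivative_mult) (auto simp: frechet_derivative_works[symmetric])
  have "frechet_derivative (\<lambda>x. f x * g x) (at x) (axis i 1)
      = f x * frechet_derivative g (at x) (axis i 1) + frechet_derivative f (at x) (axis i 1) * g x" for x i
    by (simp only: frechet_derivative_at[OF d, symmetric])
  then show ?case using d mult by (auto intro!: elementary.add elementary.mult simp: differentiable_def)
next
  case (powr f b)
  have d: "((\<lambda>x. f x powr b) has_derivative (\<lambda>y. (b * f x powr (b - 1)) * frechet_derivative f (at x) y)) (at x)" for x
    using powr by (intro frechet_derivative_chain_real has_real_derivative_powr) auto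
  have "frechet_derivative (\<lambda>x. f x powr b) (at x) (axis i 1)
      = (b * f x powr (b - 1)) * frechet_derivative f (at x) (axis i 1)" for x i
    by (simp only: frechet_derivative_at[OF d, symmetric])
  then show ?case using d powr
    by (auto intro!: elementary.mult elementary.const elementary.powr simp: differentiable_def)
next
  case (bump f k)
  have d: "((\<lambda>x. bump k (f x)) has_derivative
      (\<lambda>y. (bump (k + 2) (f x) + (- real k) * bump (k + 1) (f x)) * frechet_derivative f (at x) y)) (at x)" for x
    using bump bump_has_derivative[of k "f x"] by (intro frechet_derivative_chain_real) auto
  have e1: "frechet_derivative (\<lambda>x. bump k (f x)) (at x) (axis i 1)
      = (bump (k + 2) (f x) + (- real k) * bump (k + 1) (f x)) * frechet_derivative f (at x) (axis i 1)" for x i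
    by (simp only: frechet_derivative_at[OF d, symmetric])
  have e2: "elementary (\<lambda>x. (bump (k + 2) (f x) + (- real k) * bump (k + 1) (f x)) * frechet_derivative f (at x) (axis i 1))" for i
    using bump by (intro elementary.mult elementary.add elementary.const elementary.bump) auto
  show ?case
  proof (intro conjI allI)
    show "(\<lambda>x. bump k (f x)) differentiable (at x)" for x
      using d[of x] unfolding differentiable_def by blast
    show "elementary (\<lambda>x. frechet_derivative (\<lambda>x. bump k (f x)) (at x) (axis i 1))" for i
      unfolding e1 by (rule e2)
  qed
qed

lemma elementary_smooth_fun:
  fixes f :: "real^'n \<Rightarrow> real"
  shows "elementary f \<Longrightarrow> smooth_fun f"
  by (coinduction arbitrary: f) (use elementary_derivative in blast)

lemma elementary_sum: "finite A \<Longrightarrow> (\<And>i. i \<in> A \<Longrightarrow> elementary (f i)) \<Longrightarrow> elementary (\<lambda>x. \<Sum>i\<in>A. f i x)"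
  by (induction A rule: finite_induct) (auto intro: elementary.const elementary.add)

lemma elementary_power: "elementary f \<Longrightarrow> elementary (\<lambda>x. f x ^ m)"
  by (induction m) (auto intro: elementary.const elementary.mult)

lemma elementary_inner_power: "elementary (\<lambda>x::real^'n. (x \<bullet> x) ^ m)"
  unfolding inner_vec_def inner_real_def
  by (intro elementary_power elementary_sum elementary.mult elementary.coord) simp

text \<open>Truncated powers: up to a smooth cutoff at \<open>y = 1 / d\<close>, the function \<open>radial_test m b d\<close>
  behaves like \<open>norm x powr (- 2 m b)\<close> at infinity.\<close>

definition profile :: "real \<Rightarrow> real \<Rightarrow> real \<Rightarrow> real" where
  "profile b d y = (1 + y) powr (- b) * bump 0 (1 - d * y)"

text \<open>Minus the derivative of \<open>profile\<close>, so that it is nonnegative. The first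
  summand comes from the power and the second from the cutoff, and the estimates treat them
  separately.\<close>

definition profile_slope :: "real \<Rightarrow> real \<Rightarrow> real \<Rightarrow> real" where
  "profile_slope b d y = b * (1 + y) powr (- b - 1) * bump 0 (1 - d * y) + d * (1 + y) powr (- b) * bump 2 (1 - d * y)"

definition radial_test :: "nat \<Rightarrow> real \<Rightarrow> real \<Rightarrow> real^'n \<Rightarrow> real" where
  "radial_test m b d x = profile b d ((x \<bullet> x) ^ m)"

lemma profile_has_derivative:
  assumes "y \<ge> 0"
  shows "(profile b d has_real_derivative (- profile_slope b d y)) (at y)"
proof -
  have 1: "((\<lambda>y. (1 + y) powr (- b)) has_real_derivative (- b * (1 + y) powr (- b - 1))) (at y)"
    using assms by (auto intro!: derivative_eq_intros)
  have "((\<lambda>y. 1 - d * y) has_real_derivative (- d)) (at y)" by (auto intro!: derivative_eq_intros)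
  from DERIV_chain2[OF bump_has_derivative[of 0] this]
  have 2: "((\<lambda>y. bump 0 (1 - d * y)) has_real_derivative (bump 2 (1 - d * y) * (- d))) (at y)" by (simp add: numeral_2_eq_2)
  from DERIV_mult[OF 1 2] show ?thesis
    unfolding profile_def[abs_def] profile_slope_def by (simp add: algebra_simps)
qed

lemma radial_test_C0_infty:
  assumes d: "d > 0" and m: "m \<ge> 1"
  shows "radial_test m b d \<in> (C0_infty :: (real^'n \<Rightarrow> real) set)"
proof -
  have "elementary (radial_test m b d :: real^'n \<Rightarrow> real)"
  proof -
    have "elementary (\<lambda>x::real^'n. (1 + (x \<bullet> x) ^ m) powr (- b) * bump 0 (1 + (- d) * (x \<bullet> x) ^ m))"
      by (intro elementary.mult elementary.bump elementary.powr elementary.add elementary.const elementary_inner_power)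
        (simp add: add_pos_nonneg)
    then show ?thesis by (simp add: radial_test_def[abs_def] profile_def)
  qed
  then have "smooth_fun (radial_test m b d :: real^'n \<Rightarrow> real)" by (rule elementary_smooth_fun)
  moreover have "bounded {x :: real^'n. radial_test m b d x \<noteq> 0}"
  proof (rule boundedI)
    fix x :: "real^'n" assume "x \<in> {x. radial_test m b d x \<noteq> 0}"
    then have "d * (x \<bullet> x) ^ m < 1" by (auto simp: radial_test_def profile_def bump_def split: if_splits)
    then have q: "(x \<bullet> x) ^ m < 1 / d" using d by (simp add: field_simps)
    show "norm x \<le> max 1 (1 / d)"
    proof (cases "norm x \<le> 1")
      case False
      then have n: "norm x \<ge> 1" by simp
      have "x \<bullet> x = norm x ^ 2" by (simp add: power2_norm_eq_inner)
      then have "(x \<bullet> x) ^ m = norm x ^ (2 * m)" by (simp add: power_mult)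
      also have "\<dots> \<ge> norm x ^ 1" using n m by (intro power_increasing) auto
      finally show ?thesis using q by simp
    qed simp
  qed
  ultimately show ?thesis by (simp add: C0_infty_def compact_closure)
qed

lemma frechet_derivative_radial_test:
  fixes x :: "real^'n"
  shows "frechet_derivative (radial_test m b d) (at x)
     = (\<lambda>y. - (profile_slope b d ((x \<bullet> x) ^ m) * (2 * real m * (x \<bullet> x) ^ (m - 1))) * (x \<bullet> y))"
proof -
  have "((\<lambda>x::real^'n. (x \<bullet> x) ^ m) has_derivative (\<lambda>y. 2 * real m * (x \<bullet> x) ^ (m - 1) * (x \<bullet> y))) (at x)"
    by (auto intro!: derivative_eq_intros simp: inner_commute)
  from has_derivative_compose[OF this profile_has_derivative[of "(x \<bullet> x) ^ m" b d, unfolded has_field_derivative_def]]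
  have "(radial_test m b d has_derivative
     (\<lambda>y. - (profile_slope b d ((x \<bullet> x) ^ m) * (2 * real m * (x \<bullet> x) ^ (m - 1))) * (x \<bullet> y))) (at x)"
    unfolding radial_test_def[abs_def] by (simp add: mult.assoc)
  from frechet_derivative_at[OF this] show ?thesis by simp
qed

lemma bump_0_le_1: "bump 0 t \<le> 1"
  by (simp add: bump_def)

lemma bump_2_le_2: "bump 2 t \<le> 2"
proof (cases "t \<le> 0")
  case False
  have "inverse t ^ 2 \<le> 2 * exp (inverse t)"
  proof -
    have x: "0 \<le> inverse t" using False by simp
    show ?thesis using exp_lower_Taylor_quadratic[OF x] x by linarith
  qed
  then show ?thesis using False by (simp add: bump_def exp_minus divide_inverse[symmetric] pos_divide_le_eq)
qed (simp add: bump_def)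

lemma profile_slope_nonneg: "b \<ge> 0 \<Longrightarrow> d \<ge> 0 \<Longrightarrow> y \<ge> 0 \<Longrightarrow> profile_slope b d y \<ge> 0"
  unfolding profile_slope_def by (intro add_nonneg_nonneg mult_nonneg_nonneg bump_nonneg) auto

lemma profile_nonneg: "profile b d y \<ge> 0"
  unfolding profile_def by (intro mult_nonneg_nonneg bump_nonneg) auto

lemma profile_slope_le:
  assumes "b \<ge> 0" "0 \<le> d" "d \<le> 1" "y \<ge> 0"
  shows "profile_slope b d y \<le> b + 2"
proof -
  have p: "(1 + y) powr (- b - 1) \<le> 1" "(1 + y) powr (- b) \<le> 1"
    using assms powr_mono[of "- b - 1" 0 "1 + y"] powr_mono[of "- b" 0 "1 + y"] by auto
  have "b * (1 + y) powr (- b - 1) * bump 0 (1 - d * y) \<le> b * 1 * 1"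
    using assms p by (intro mult_mono bump_0_le_1 mult_nonneg_nonneg bump_nonneg) auto
  moreover have "d * (1 + y) powr (- b) * bump 2 (1 - d * y) \<le> 1 * 1 * 2"
    using assms p by (intro mult_mono bump_2_le_2 mult_nonneg_nonneg bump_nonneg) auto
  ultimately show ?thesis by (simp add: profile_slope_def)
qed

lemma mult_powr_minus_1_le:
  fixes y b :: real
  assumes "y \<ge> 0"
  shows "y * (1 + y) powr (- b - 1) \<le> (1 + y) powr (- b)"
proof -
  have "(1 + y) powr (- b) = (1 + y) * (1 + y) powr (- b - 1)"
    using assms powr_add[of "1 + y" 1 "- b - 1"] by simp
  then show ?thesis by (simp add: algebra_simps)
qed

text \<open>A crude bound for the whole support, used in the cutoff zone: b comes from the power,
  and 2 from \<open>bump_2_le_2\<close> with d y at most 1. Losing a constant factor is affordable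
  because that zone contributes only a bounded amount.\<close>

lemma profile_slope_le_powr:
  assumes "b \<ge> 0" "0 \<le> d" "d * y \<le> 1" "y > 0"
  shows "y * profile_slope b d y \<le> (b + 2) * y powr (- b)"
proof -
  have "y * (b * (1 + y) powr (- b - 1) * bump 0 (1 - d * y)) = b * (y * (1 + y) powr (- b - 1)) * bump 0 (1 - d * y)"
    by simp
  also have "\<dots> \<le> b * (1 + y) powr (- b) * 1"
    using assms by (intro mult_mono mult_powr_minus_1_le bump_0_le_1 mult_nonneg_nonneg bump_nonneg) auto
  finally have 1: "y * (b * (1 + y) powr (- b - 1) * bump 0 (1 - d * y)) \<le> b * (1 + y) powr (- b)" by simp
  have "y * (d * (1 + y) powr (- b) * bump 2 (1 - d * y)) = (d * y) * (1 + y) powr (- b) * bump 2 (1 - d * y)"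
    by simp
  also have "\<dots> \<le> 1 * (1 + y) powr (- b) * 2"
    using assms by (intro mult_mono bump_2_le_2 mult_nonneg_nonneg bump_nonneg) auto
  finally have "y * profile_slope b d y \<le> (b + 2) * (1 + y) powr (- b)"
    using 1 by (simp add: profile_slope_def algebra_simps)
  also have "\<dots> \<le> (b + 2) * y powr (- b)"
    using assms by (intro mult_left_mono powr_mono2') auto
  finally show ?thesis .
qed

text \<open>Well before the cutoff the logarithmic slope is b up to a small error. The quotient of
  \<open>bump 2\<close> by \<open>bump 0\<close> is (1 - d y)^(-2), at most 4 for d y up to 1/2, and
  the remaining factor d y is at most \<tau>.\<close>

lemma profile_slope_le_profile:
  assumes "b \<ge> 0" "0 \<le> d" "d * y \<le> \<tau>" "\<tau> \<le> 1 / 2" "y \<ge> 0"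
  shows "y * profile_slope b d y \<le> (b + 4 * \<tau>) * profile b d y"
proof -
  let ?t = "1 - d * y"
  have t: "?t \<ge> 1 / 2" "d * y \<ge> 0" using assms by auto
  then have tau: "\<tau> \<ge> 0" using assms by linarith
  have "bump 2 ?t = (inverse ?t)\<^sup>2 * bump 0 ?t" using t by (simp add: bump_def)
  also have "\<dots> \<le> 4 * bump 0 ?t"
  proof (intro mult_right_mono bump_nonneg)
    have "inverse ?t \<le> inverse (1 / 2)" using t by (intro le_imp_inverse_le) auto
    then have "(inverse ?t)\<^sup>2 \<le> 2\<^sup>2" using t by (intro power_mono) auto
    then show "(inverse ?t)\<^sup>2 \<le> 4" by simp
  qed
  finally have b2: "bump 2 ?t \<le> 4 * bump 0 ?t" .
  have "y * (b * (1 + y) powr (- b - 1) * bump 0 ?t) = b * (y * (1 + y) powr (- b - 1)) * bump 0 ?t"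
    by simp
  also have "\<dots> \<le> b * (1 + y) powr (- b) * bump 0 ?t"
    using assms by (intro mult_right_mono mult_left_mono mult_powr_minus_1_le bump_nonneg) auto
  finally have 1: "y * (b * (1 + y) powr (- b - 1) * bump 0 ?t) \<le> b * profile b d y" by (simp add: profile_def)
  have "y * (d * (1 + y) powr (- b) * bump 2 ?t) = (d * y) * ((1 + y) powr (- b) * bump 2 ?t)"
    by simp
  also have "\<dots> \<le> \<tau> * ((1 + y) powr (- b) * (4 * bump 0 ?t))"
    using assms t tau b2 by (intro mult_mono mult_nonneg_nonneg bump_nonneg) auto
  finally show ?thesis
    using 1 by (simp add: profile_slope_def profile_def algebra_simps)
qed

lemma profile_slope_eq_0: "d * y \<ge> 1 \<Longrightarrow> profile_slope b d y = 0"
  by (simp add: profile_slope_def bump_def)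

text \<open>The two constants come from 1 + y \<le> 2 y and from 1 - d y being at least 1/2.\<close>

lemma profile_ge:
  assumes "b \<ge> 0" "y \<ge> 1" "d * y \<le> 1 / 2"
  shows "profile b d y \<ge> 2 powr (- b) * exp (- 2) * y powr (- b)"
proof -
  have "(2 * y) powr (- b) \<le> (1 + y) powr (- b)" using assms by (intro powr_mono2') auto
  moreover have "(2 * y) powr (- b) = 2 powr (- b) * y powr (- b)" using assms by (simp add: powr_mult)
  moreover have "exp (- 2) \<le> bump 0 (1 - d * y)"
  proof -
    have "inverse (1 - d * y) \<le> inverse (1 / 2)" using assms by (intro le_imp_inverse_le) auto
    then show ?thesis using assms by (simp add: bump_def)
  qed
  ultimately have "2 powr (- b) * y powr (- b) * exp (- 2) \<le> (1 + y) powr (- b) * bump 0 (1 - d * y)"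
    by (intro mult_mono) auto
  then show ?thesis by (simp add: profile_def mult_ac)
qed

text \<open>The logarithmic divergence of the borderline power, counted dyadically. On the shell
  between s and 2 s the integrand is at least (2 s)^(-n) and the volume is V s^n (2^n - 1), so every
  shell contributes at least V (1 - 2^(-n)), hence V / 2.\<close>

lemma nn_integral_shells:
  fixes R :: real
  assumes R: "R > 0"
  shows "ennreal (real N * unit_ball_vol (real CARD('n)) / 2)
    \<le> (\<integral>\<^sup>+x. ennreal (norm x powr (- real CARD('n))) * indicator {x :: real^'n. R \<le> norm x \<and> norm x \<le> 2 ^ N * R} x \<partial>lborel)"
proof (induction N)
  case (Suc N)
  let ?n = "CARD('n)"
  let ?f = "\<lambda>x::real^'n. ennreal (norm x powr (- real ?n))"
  define s where "s = 2 ^ N * R"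
  have s: "s \<ge> R" "s > 0" using R one_le_power[of "2::real" N] by (auto simp: s_def mult_le_cancel_right1)
  define V where "V = unit_ball_vol (real ?n)"
  have V: "V > 0" by (simp add: V_def unit_ball_vol_pos)
  let ?A = "cball (0::real^'n) (2 * s) - cball 0 s"
  have "emeasure lborel ?A = ennreal (V * (2 * s) ^ ?n) - ennreal (V * s ^ ?n)"
    using s by (subst emeasure_Diff) (auto simp: emeasure_cball V_def)
  also have "\<dots> = ennreal (V * (2 * s) ^ ?n - V * s ^ ?n)"
    using s V by (intro ennreal_minus) auto
  finally have eA: "emeasure lborel ?A = ennreal (V * (2 * s) ^ ?n - V * s ^ ?n)" .
  have p2: "(2 * s) powr (- real ?n) = 1 / (2 * s) ^ ?n"
    using s by (simp add: powr_minus_divide powr_realpow)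
  have half: "V / 2 \<le> (2 * s) powr (- real ?n) * (V * (2 * s) ^ ?n - V * s ^ ?n)"
  proof -
    have "(2::real) ^ 1 \<le> 2 ^ ?n" by (intro power_increasing) (auto simp: Suc_leI)
    then have "V / 2 \<le> V * (1 - 1 / 2 ^ ?n)" using V by (simp add: field_simps)
    also have "\<dots> = (2 * s) powr (- real ?n) * (V * (2 * s) ^ ?n - V * s ^ ?n)"
      unfolding p2 using s by (simp add: power_mult_distrib field_simps)
    finally show ?thesis .
  qed
  have "ennreal (real (Suc N) * V / 2) = ennreal (real N * V / 2) + ennreal (V / 2)"
    using V by (simp add: ennreal_plus[symmetric] field_simps del: ennreal_plus)
  also have "\<dots> \<le> (\<integral>\<^sup>+x. ?f x * indicator {x. R \<le> norm x \<and> norm x \<le> s} x \<partial>lborel)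
       + (\<integral>\<^sup>+x. ennreal ((2 * s) powr (- real ?n)) * indicator ?A x \<partial>lborel)"
  proof (intro add_mono)
    show "ennreal (real N * V / 2) \<le> (\<integral>\<^sup>+x. ?f x * indicator {x. R \<le> norm x \<and> norm x \<le> s} x \<partial>lborel)"
      using Suc.IH by (simp add: s_def V_def)
    have "ennreal (V / 2) \<le> ennreal ((2 * s) powr (- real ?n)) * emeasure lborel ?A"
      unfolding eA using half by (subst ennreal_mult'[symmetric]) (auto intro: ennreal_leI)
    also have "\<dots> = (\<integral>\<^sup>+x. ennreal ((2 * s) powr (- real ?n)) * indicator ?A x \<partial>lborel)"
      by (rule nn_integral_cmult_indicator[symmetric]) simp
    finally show "ennreal (V / 2) \<le> (\<integral>\<^sup>+x. ennreal ((2 * s) powr (- real ?n)) * indicator ?A x \<partial>lborel)" .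
  qed
  also have "\<dots> = (\<integral>\<^sup>+x. ?f x * indicator {x. R \<le> norm x \<and> norm x \<le> s} x + ennreal ((2 * s) powr (- real ?n)) * indicator ?A x \<partial>lborel)"
  proof (rule nn_integral_add[symmetric])
    have [measurable]: "?A \<in> sets borel" by simp
    show "(\<lambda>x. ?f x * indicator {x. R \<le> norm x \<and> norm x \<le> s} x) \<in> borel_measurable lborel" by measurable
    show "(\<lambda>x. ennreal ((2 * s) powr (- real ?n)) * indicator ?A x) \<in> borel_measurable lborel"
      by (intro borel_measurable_times_ennreal borel_measurable_const borel_measurable_indicator) simp
  qed
  also have "\<dots> \<le> (\<integral>\<^sup>+x. ?f x * indicator {x. R \<le> norm x \<and> norm x \<le> 2 * s} x \<partial>lborel)"
  proof (rule nn_integral_mono)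
    fix x :: "real^'n"
    have "(2 * s) powr (- real ?n) \<le> norm x powr (- real ?n)" if "x \<in> ?A"
      using that s by (intro powr_mono2') auto
    then show "?f x * indicator {x. R \<le> norm x \<and> norm x \<le> s} x + ennreal ((2 * s) powr (- real ?n)) * indicator ?A x
       \<le> ?f x * indicator {x. R \<le> norm x \<and> norm x \<le> 2 * s} x"
    proof (cases "x \<in> ?A")
      case True
      then show ?thesis using \<open>x \<in> ?A \<Longrightarrow> _\<close> s by (simp add: ennreal_leI)
    next
      case False
      then show ?thesis using s by (auto simp: indicator_def)
    qed
  qed
  finally show ?case unfolding V_def s_def by (simp only: power_Suc mult.assoc)
qed (simp only: of_nat_0 mult_zero_left div_0 ennreal_0 zero_le)

section \<open>Comparison of the distance with the Euclidean norm\<close>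

context randers
begin

text \<open>The quotient \<rho> / r lies between 1 - \<theta> and 1; \<open>max\<close> and
  \<open>min\<close> cover both signs of the exponent.\<close>

lemma rad_powr_bounds:
  assumes r: "r > 0"
  shows "\<rho> r powr a \<le> max 1 ((1 - \<theta>) powr a) * r powr a"
    and "min 1 ((1 - \<theta>) powr a) * r powr a \<le> \<rho> r powr a"
proof -
  define q where "q = \<rho> r / r"
  have q: "1 - \<theta> \<le> q" "q \<le> 1" using rad_bounds[of r] r by (auto simp: q_def field_simps)
  have q0: "0 < 1 - \<theta>" using th1 by simp
  have e: "\<rho> r powr a = q powr a * r powr a" using r rad_pos[OF r] by (simp add: q_def powr_divide)
  have "q powr a \<le> max 1 ((1 - \<theta>) powr a) \<and> min 1 ((1 - \<theta>) powr a) \<le> q powr a"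
  proof (cases "a \<ge> 0")
    case True
    have "q powr a \<le> 1" using q q0 True by (intro powr_le1) auto
    moreover have "(1 - \<theta>) powr a \<le> q powr a" using q q0 True by (intro powr_mono2) auto
    ultimately show ?thesis by auto
  next
    case False
    then have "1 \<le> q powr a" "q powr a \<le> (1 - \<theta>) powr a"
      using powr_mono2'[of a q 1] powr_mono2'[of a "1 - \<theta>" q] q q0 by auto
    then show ?thesis by auto
  qed
  then show "\<rho> r powr a \<le> max 1 ((1 - \<theta>) powr a) * r powr a"
    "min 1 ((1 - \<theta>) powr a) * r powr a \<le> \<rho> r powr a"
    unfolding e by (auto intro!: mult_right_mono)
qed

text \<open>At infinity \<rho> / r tends to 1 - \<theta> and h tends to \<theta>, so the quotient of
  the two sides without 1 + \<eta> tends to lam (1 - \<theta>) / (1 + \<theta>) = 1.\<close>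

lemma rad_drift_limit:
  assumes "\<eta> > 0" and lam: "lam = (1 + \<theta>) / (1 - \<theta>)"
  shows "\<exists>R\<ge>1. \<forall>r\<ge>R. lam * \<rho> r \<le> (1 + \<eta>) * (r * (1 + h r))"
proof -
  have s: "((\<lambda>r. \<epsilon> / (r + \<epsilon>)) \<longlongrightarrow> 0) at_top"
    by (intro tendsto_divide_0[OF tendsto_const] filterlim_at_top_imp_at_infinity
        filterlim_at_top_mono[OF filterlim_ident]) (use e0 in auto)
  have "((\<lambda>r. lam * (1 - \<theta> * (1 - \<epsilon> / (r + \<epsilon>))) - (1 + \<eta>) * (1 + \<theta> * (1 - (\<epsilon> / (r + \<epsilon>))\<^sup>2)))
      \<longlongrightarrow> lam * (1 - \<theta> * (1 - 0)) - (1 + \<eta>) * (1 + \<theta> * (1 - 0\<^sup>2))) at_top"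
    by (intro tendsto_intros s)
  moreover have "lam * (1 - \<theta> * (1 - 0)) - (1 + \<eta>) * (1 + \<theta> * (1 - 0\<^sup>2)) < 0"
  proof -
    have "lam * (1 - \<theta>) = 1 + \<theta>" using th1 by (simp add: lam)
    moreover have "\<eta> * (1 + \<theta>) > 0" using th0 assms(1) by (intro mult_pos_pos) auto
    ultimately show ?thesis by (simp add: algebra_simps)
  qed
  ultimately have "\<forall>\<^sub>F r in at_top. lam * (1 - \<theta> * (1 - \<epsilon> / (r + \<epsilon>))) - (1 + \<eta>) * (1 + \<theta> * (1 - (\<epsilon> / (r + \<epsilon>))\<^sup>2)) < 0"
    by (rule order_tendstoD(2))
  then obtain R0 where R0: "\<And>r. r \<ge> R0 \<Longrightarrow> lam * (1 - \<theta> * (1 - \<epsilon> / (r + \<epsilon>))) - (1 + \<eta>) * (1 + \<theta> * (1 - (\<epsilon> / (r + \<epsilon>))\<^sup>2)) < 0"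
    unfolding eventually_at_top_linorder by blast
  have "lam * \<rho> r \<le> (1 + \<eta>) * (r * (1 + h r))" if r: "r \<ge> max 1 R0" for r
  proof -
    have ne: "r + \<epsilon> \<noteq> 0" "r > 0" using r e0 by auto
    have "\<rho> r = r * (1 - \<theta> * (1 - \<epsilon> / (r + \<epsilon>)))"
      using ne by (simp add: rad_def divide_simps) (simp add: power2_eq_square algebra_simps)
    moreover have "h r = \<theta> * (1 - (\<epsilon> / (r + \<epsilon>))\<^sup>2)"
      using ne by (simp add: drift_def divide_simps) (simp add: power2_eq_square algebra_simps)
    moreover have "r * (lam * (1 - \<theta> * (1 - \<epsilon> / (r + \<epsilon>))))
        \<le> r * ((1 + \<eta>) * (1 + \<theta> * (1 - (\<epsilon> / (r + \<epsilon>))\<^sup>2)))"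
      using R0[of r] r ne by (intro mult_left_mono) auto
    ultimately show ?thesis by (simp only: mult_ac)
  qed
  then show ?thesis by (intro exI[of _ "max 1 R0"]) auto
qed

end

section \<open>Pointwise bounds for the energy of the test functions\<close>

context randers
begin

text \<open>The radial derivative of \<open>radial_test\<close>, sign reversed, divided by 1 + h.
  With y = r^(2m) one has dy/dr = 2 m y / r, which explains the grouping of y with the
  slope.\<close>

definition radial_dual :: "nat \<Rightarrow> real \<Rightarrow> real \<Rightarrow> real \<Rightarrow> real" where
  "radial_dual m b d r = 2 * real m * (r ^ (2 * m) * profile_slope b d (r ^ (2 * m))) / (r * (1 + h r))"

lemma radial_dual_nonneg: "b \<ge> 0 \<Longrightarrow> d \<ge> 0 \<Longrightarrow> r \<ge> 0 \<Longrightarrow> radial_dual m b d r \<ge> 0"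
  unfolding radial_dual_def using drift_nonneg[of r]
  by (intro divide_nonneg_nonneg mult_nonneg_nonneg profile_slope_nonneg) auto

lemma radial_dual_measurable [measurable]: "radial_dual m b d \<in> borel_measurable borel"
proof -
  have [measurable]: "bump k \<in> borel_measurable borel" for k
    by (intro borel_measurable_continuous_onI continuous_at_imp_continuous_on ballI DERIV_isCont[OF bump_has_derivative])
  show ?thesis unfolding radial_dual_def[abs_def] profile_slope_def by measurable
qed

lemma dual_metric_radial_test:
  fixes x :: "real^'n"
  assumes b: "b \<ge> 0" and d: "d \<ge> 0" and m: "m \<ge> 1"
  shows "dual_metric (F_eps \<theta> \<epsilon>) x (frechet_derivative (radial_test m b d) (at x)) \<le> radial_dual m b d (norm x)"
proof -
  let ?r = "norm x"
  have xx: "x \<bullet> x = ?r ^ 2" by (simp add: power2_norm_eq_inner)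
  define k where "k = - (profile_slope b d ((x \<bullet> x) ^ m) * (2 * real m * (x \<bullet> x) ^ (m - 1)))"
  have s: "profile_slope b d ((x \<bullet> x) ^ m) \<ge> 0" using b d by (intro profile_slope_nonneg) auto
  have k: "k \<le> 0" unfolding k_def using s by simp
  have "\<bar>k\<bar> * ?r / (1 + h ?r) = radial_dual m b d ?r"
  proof (cases "?r = 0")
    case False
    have "\<bar>k\<bar> * ?r = 2 * real m * (?r ^ (2 * m) * profile_slope b d (?r ^ (2 * m))) / ?r"
    proof -
      have "\<bar>k\<bar> = profile_slope b d (?r ^ (2 * m)) * (2 * real m * ?r ^ (2 * (m - 1)))"
        using k s unfolding k_def xx by (simp add: power_mult[symmetric])
      moreover have "?r ^ (2 * m) = ?r ^ (2 * (m - 1)) * ?r * ?r"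
        using m by (cases m) (auto simp: power2_eq_square)
      ultimately show ?thesis using False by simp
    qed
    then show ?thesis by (simp add: radial_dual_def)
  qed (simp add: radial_dual_def)
  then show ?thesis
    unfolding frechet_derivative_radial_test using dual_metric_le_radial[OF k, of x] by (simp add: k_def)
qed

lemma radial_dual_le:
  assumes "r > 0" "b \<ge> 0" "d \<ge> 0" "r ^ (2 * m) * profile_slope b d (r ^ (2 * m)) \<le> C"
  shows "radial_dual m b d r \<le> 2 * real m * C / r"
proof -
  have "radial_dual m b d r \<le> 2 * real m * (r ^ (2 * m) * profile_slope b d (r ^ (2 * m))) / (r * 1)"
    unfolding radial_dual_def using assms drift_nonneg[of r]
    by (intro divide_left_mono mult_left_mono mult_nonneg_nonneg profile_slope_nonneg mult_pos_pos) auto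
  also have "\<dots> \<le> 2 * real m * C / (r * 1)"
    using assms by (intro divide_right_mono mult_left_mono) auto
  finally show ?thesis by simp
qed

text \<open>Near the origin the gradient is of order r^(2m-1). For m large enough this compensates a
  negative \<alpha> and keeps the weighted energy bounded, uniformly in d.\<close>

lemma radial_dual_near:
  assumes r: "0 < r" "r \<le> R" and p: "p > 1" and b: "b \<ge> 0" and d: "0 \<le> d" "d \<le> 1" and e: "0 \<le> \<alpha> + (2 * real m - 1) * p"
  shows "\<rho> r powr \<alpha> * radial_dual m b d r powr p
    \<le> max 1 ((1 - \<theta>) powr \<alpha>) * (2 * real m * (b + 2)) powr p * R powr (\<alpha> + (2 * real m - 1) * p)"
proof -
  have "radial_dual m b d r \<le> 2 * real m * (r ^ (2 * m) * (b + 2)) / r"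
    using r b d by (intro radial_dual_le mult_left_mono profile_slope_le) auto
  also have "\<dots> = 2 * real m * (b + 2) * r powr (2 * real m - 1)"
    using r powr_realpow[of r "2 * m"] by (simp add: powr_diff)
  finally have "radial_dual m b d r powr p \<le> (2 * real m * (b + 2) * r powr (2 * real m - 1)) powr p"
    using radial_dual_nonneg[OF b d(1), of r] r p by (intro powr_mono2) auto
  also have "\<dots> = (2 * real m * (b + 2)) powr p * r powr ((2 * real m - 1) * p)"
    using b by (simp add: powr_mult powr_powr)
  finally have "\<rho> r powr \<alpha> * radial_dual m b d r powr p
     \<le> (max 1 ((1 - \<theta>) powr \<alpha>) * r powr \<alpha>) * ((2 * real m * (b + 2)) powr p * r powr ((2 * real m - 1) * p))"
    using r by (intro mult_mono rad_powr_bounds(1)) auto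
  also have "\<dots> = max 1 ((1 - \<theta>) powr \<alpha>) * (2 * real m * (b + 2)) powr p * r powr (\<alpha> + (2 * real m - 1) * p)"
    by (simp add: powr_add mult_ac)
  also have "\<dots> \<le> max 1 ((1 - \<theta>) powr \<alpha>) * (2 * real m * (b + 2)) powr p * R powr (\<alpha> + (2 * real m - 1) * p)"
    using r e by (intro mult_left_mono powr_mono2) auto
  finally show ?thesis .
qed

lemma power_powr_eq:
  assumes "r > 0" "2 * real m * b = g"
  shows "(r ^ (2 * m)) powr (- b) = r powr (- g)"
proof -
  have "(r ^ (2 * m)) powr (- b) = (r powr (2 * real m)) powr (- b)"
    using assms(1) powr_realpow[of r "2 * m"] by simp
  then show ?thesis using assms(2) by (simp add: powr_powr)
qed

text \<open>The choice 2 m b = g with g = (n + \<alpha> - p) / p makes the total exponent \<alpha> -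
  p - g p equal to -n, the borderline of integrability at infinity.\<close>

lemma radial_dual_far:
  assumes r: "0 < r" and p: "p > 1" and b: "b \<ge> 0" "2 * real m * b = g" and d: "0 \<le> d" "d * r ^ (2 * m) \<le> 1"
    and n: "\<alpha> - p - g * p = - n"
  shows "\<rho> r powr \<alpha> * radial_dual m b d r powr p
    \<le> max 1 ((1 - \<theta>) powr \<alpha>) * (2 * real m * (b + 2)) powr p * r powr (- n)"
proof -
  have "radial_dual m b d r \<le> 2 * real m * ((b + 2) * (r ^ (2 * m)) powr (- b)) / r"
    using r b d by (intro radial_dual_le profile_slope_le_powr) auto
  also have "\<dots> = 2 * real m * (b + 2) * r powr (- g - 1)"
    using r unfolding power_powr_eq[OF r b(2)] by (simp add: powr_diff)
  finally have "radial_dual m b d r powr p \<le> (2 * real m * (b + 2) * r powr (- g - 1)) powr p"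
    using radial_dual_nonneg[OF b(1) d(1), of r] r p by (intro powr_mono2) auto
  also have "\<dots> = (2 * real m * (b + 2)) powr p * r powr ((- g - 1) * p)"
    using b by (simp add: powr_mult powr_powr)
  finally have "\<rho> r powr \<alpha> * radial_dual m b d r powr p
     \<le> (max 1 ((1 - \<theta>) powr \<alpha>) * r powr \<alpha>) * ((2 * real m * (b + 2)) powr p * r powr ((- g - 1) * p))"
    using r by (intro mult_mono rad_powr_bounds(1)) auto
  also have "\<dots> = max 1 ((1 - \<theta>) powr \<alpha>) * (2 * real m * (b + 2)) powr p * (r powr \<alpha> * r powr ((- g - 1) * p))"
    by (simp add: mult_ac)
  also have "r powr \<alpha> * r powr ((- g - 1) * p) = r powr (- n)"
    unfolding powr_add[symmetric] n[symmetric] by (simp add: algebra_simps)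
  finally show ?thesis .
qed

text \<open>The range that determines the constant. Comparing lam \<rho> with r (1 + h) costs the
  factor 1 + \<eta>; the cutoff changes 2 m b = g into 2 m (b + 4 \<tau>) = g + 8 m \<tau>, which is
  at most g + \<eta>.\<close>

lemma radial_dual_middle:
  assumes r: "0 < r" and p: "p > 1" and b: "b \<ge> 0" "2 * real m * b = g" and d: "0 \<le> d" "d * r ^ (2 * m) \<le> \<tau>"
    and tau: "\<tau> \<le> 1 / 2" "8 * real m * \<tau> \<le> \<eta>" and eta: "\<eta> > 0" and lam: "lam > 0"
    and R: "lam * \<rho> r \<le> (1 + \<eta>) * (r * (1 + h r))"
  shows "lam powr p * (\<rho> r powr \<alpha> * radial_dual m b d r powr p)
    \<le> ((1 + \<eta>) * (g + \<eta>)) powr p * (\<rho> r powr (\<alpha> - p) * profile b d (r ^ (2 * m)) powr p)"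
proof -
  let ?u = "profile b d (r ^ (2 * m))" and ?s = "r * (1 + h r)"
  have s: "?s > 0" using r drift_nonneg[of r] by (intro mult_pos_pos) auto
  have rho: "\<rho> r > 0" by (rule rad_pos[OF r])
  have g: "g \<ge> 0" using b by (metis mult_nonneg_nonneg of_nat_0_le_iff zero_le_numeral)
  have "2 * real m * (r ^ (2 * m) * profile_slope b d (r ^ (2 * m))) \<le> 2 * real m * ((b + 4 * \<tau>) * ?u)"
    using r b d tau by (intro mult_left_mono profile_slope_le_profile) auto
  also have "\<dots> = (g + 8 * real m * \<tau>) * ?u" using b(2) by (simp add: algebra_simps)
  also have "\<dots> \<le> (g + \<eta>) * ?u" using tau by (intro mult_right_mono profile_nonneg) auto
  finally have "radial_dual m b d r * ?s \<le> (g + \<eta>) * ?u"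
    using s by (simp only: radial_dual_def times_divide_eq_left nonzero_mult_div_cancel_right[OF less_imp_neq[OF s, symmetric]])
  then have "lam * \<rho> r * (radial_dual m b d r * ?s) \<le> ((1 + \<eta>) * ?s) * ((g + \<eta>) * ?u)"
    using s eta radial_dual_nonneg[OF b(1) d(1), of r] r
    by (intro mult_mono[OF R] mult_nonneg_nonneg[of _ ?s]) auto
  then have "(lam * radial_dual m b d r * \<rho> r) * ?s \<le> ((1 + \<eta>) * (g + \<eta>) * ?u) * ?s" by (simp only: mult_ac)
  then have "lam * radial_dual m b d r * \<rho> r \<le> (1 + \<eta>) * (g + \<eta>) * ?u"
    using s by (rule mult_right_le_imp_le)
  then have "lam * radial_dual m b d r \<le> (1 + \<eta>) * (g + \<eta>) * ?u / \<rho> r" using rho by (simp add: pos_le_divide_eq)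
  then have "(lam * radial_dual m b d r) powr p \<le> ((1 + \<eta>) * (g + \<eta>) * ?u / \<rho> r) powr p"
    using lam p radial_dual_nonneg[OF b(1) d(1), of r] r by (intro powr_mono2) auto
  then have "lam powr p * radial_dual m b d r powr p \<le> ((1 + \<eta>) * (g + \<eta>)) powr p * (?u powr p / \<rho> r powr p)"
    using lam radial_dual_nonneg[OF b(1) d(1), of r] r eta g rho profile_nonneg[of b d "r ^ (2 * m)"]
    by (simp add: powr_mult powr_divide)
  then have "\<rho> r powr \<alpha> * (lam powr p * radial_dual m b d r powr p)
      \<le> \<rho> r powr \<alpha> * (((1 + \<eta>) * (g + \<eta>)) powr p * (?u powr p / \<rho> r powr p))"
    by (rule mult_left_mono) simp
  then show ?thesis by (simp add: powr_diff mult_ac)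
qed

lemma radial_dual_outside: "d * r ^ (2 * m) \<ge> 1 \<Longrightarrow> radial_dual m b d r = 0"
  by (simp add: radial_dual_def profile_slope_eq_0)

text \<open>A lower bound by the same borderline power, so that the Hardy integral over the middle
  range really diverges as the range grows.\<close>

lemma profile_lower:
  assumes r: "r \<ge> 1" and p: "p > 1" and b: "b \<ge> 0" "2 * real m * b = g" and d: "d * r ^ (2 * m) \<le> 1 / 2"
    and n: "\<alpha> - p - g * p = - n"
  shows "min 1 ((1 - \<theta>) powr (\<alpha> - p)) * (2 powr (- b) * exp (- 2)) powr p * r powr (- n)
     \<le> \<rho> r powr (\<alpha> - p) * profile b d (r ^ (2 * m)) powr p"
proof -
  have r0: "r > 0" using r by simp
  have "2 powr (- b) * exp (- 2) * r powr (- g) \<le> profile b d (r ^ (2 * m))"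
    using profile_ge[OF b(1) one_le_power[OF r] d] unfolding power_powr_eq[OF r0 b(2)] .
  then have "(2 powr (- b) * exp (- 2) * r powr (- g)) powr p \<le> profile b d (r ^ (2 * m)) powr p"
    using p by (intro powr_mono2) auto
  moreover have "(2 powr (- b) * exp (- 2) * r powr (- g)) powr p = (2 powr (- b) * exp (- 2)) powr p * r powr (- g * p)"
    by (simp add: powr_mult powr_powr)
  ultimately have le: "(min 1 ((1 - \<theta>) powr (\<alpha> - p)) * r powr (\<alpha> - p)) * ((2 powr (- b) * exp (- 2)) powr p * r powr (- g * p))
     \<le> \<rho> r powr (\<alpha> - p) * profile b d (r ^ (2 * m)) powr p"
    using r0 by (intro mult_mono rad_powr_bounds(2)) auto
  have e: "r powr (\<alpha> - p) * r powr (- g * p) = r powr (- n)"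
    unfolding powr_add[symmetric] n[symmetric] by simp
  show ?thesis using le unfolding e[symmetric] by (simp only: mult_ac)
qed

end

section \<open>Logarithmic divergence determines the constant\<close>

context randers
begin

text \<open>Let S be the Hardy integral over the shell from R to P, and q the claimed bound. If c'
  exceeded q, the inequality would give (c' - q) S \<le> T with T independent of P, whereas S grows
  with the number of dyadic shells between R and P.\<close>

lemma sharpness_estimate:
  assumes p: "p > 1" and b: "p < real CARD('n) + \<alpha>" and lam: "lam = (1 + \<theta>) / (1 - \<theta>)"
    and eta: "\<eta> > 0" and c': "c' > 0"
    and ineq: "\<And>u :: real^'n \<Rightarrow> real. u \<in> C0_infty \<Longrightarrow> ennreal c' *
              (\<integral>\<^sup>+ x. ennreal (finsler_dist (F_eps \<theta> \<epsilon>) 0 x powr \<alpha> *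
                   (\<bar>u x\<bar> powr p / finsler_dist (F_eps \<theta> \<epsilon>) 0 x powr p))
                 \<partial>BH_measure (F_eps \<theta> \<epsilon>))
    \<le> ennreal (lam powr p) *
              (\<integral>\<^sup>+ x. ennreal (finsler_dist (F_eps \<theta> \<epsilon>) 0 x powr \<alpha> *
                   dual_metric (F_eps \<theta> \<epsilon>) x (frechet_derivative u (at x)) powr p)
                 \<partial>BH_measure (F_eps \<theta> \<epsilon>))"
  shows "c' \<le> ((1 + \<eta>) * ((real CARD('n) + \<alpha> - p) / p + \<eta>)) powr p"
proof (rule ccontr)
  let ?n = "CARD('n)"
  define g where "g = (real ?n + \<alpha> - p) / p"
  have g: "g > 0" using b p by (simp add: g_def)
  have gn: "\<alpha> - p - g * p = - real ?n" using p by (simp add: g_def)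
  define q where "q = ((1 + \<eta>) * (g + \<eta>)) powr p"
  assume "\<not> c' \<le> ((1 + \<eta>) * ((real CARD('n) + \<alpha> - p) / p + \<eta>)) powr p"
  then have cq: "c' > q" by (simp add: q_def g_def)
  have l0: "lam > 0" using lam th0 th1 by simp
  \<comment> \<open>The size of m makes \<alpha> + (2 m - 1) p nonnegative, the hypothesis of
    \<open>radial_dual_near\<close>.\<close>
  obtain m0 :: nat where m0: "real m0 \<ge> 1 + \<bar>\<alpha>\<bar>" using real_arch_simple by blast
  define m where "m = Suc m0"
  have m: "m \<ge> 1" by (simp add: m_def)
  have e: "0 \<le> \<alpha> + (2 * real m - 1) * p"
  proof -
    have "\<bar>\<alpha>\<bar> * 1 \<le> (2 * real m - 1) * p" using m0 p by (intro mult_mono) (auto simp: m_def)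
    then show ?thesis by linarith
  qed
  define \<beta> where "\<beta> = g / (2 * real m)"
  have be: "\<beta> \<ge> 0" "2 * real m * \<beta> = g" using g m by (auto simp: \<beta>_def)
  \<comment> \<open>The bound 1/2 keeps the cutoff factor away from 0 in the middle range; the other
    bound makes the cutoff error 8 m \<tau> at most \<eta>.\<close>
  define \<tau> where "\<tau> = min (1 / 2) (\<eta> / (8 * real m))"
  have tau: "0 < \<tau>" "\<tau> \<le> 1 / 2" "8 * real m * \<tau> \<le> \<eta>"
  proof -
    show "0 < \<tau>" "\<tau> \<le> 1 / 2" using eta m by (auto simp: \<tau>_def)
    have "\<tau> \<le> \<eta> / (8 * real m)" by (simp add: \<tau>_def)
    then show "8 * real m * \<tau> \<le> \<eta>" using m by (simp add: pos_le_divide_eq mult.commute)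
  qed
  obtain R where R: "R \<ge> 1" "\<And>r. r \<ge> R \<Longrightarrow> lam * \<rho> r \<le> (1 + \<eta>) * (r * (1 + h r))"
    using rad_drift_limit[OF eta lam] by blast
  define V where "V = unit_ball_vol (real ?n)"
  have V: "V > 0" by (simp add: V_def unit_ball_vol_pos)
  define K where "K = max 1 ((1 - \<theta>) powr \<alpha>) * (2 * real m * (\<beta> + 2)) powr p"
  have K: "K \<ge> 0" unfolding K_def by (intro mult_nonneg_nonneg) auto
  define C1 where "C1 = lam powr p * (K * R powr (\<alpha> + (2 * real m - 1) * p))"
  have C1: "C1 \<ge> 0" using K by (simp add: C1_def)
  \<comment> \<open>The constant of \<open>profile_lower\<close> times the lower bound of the
    Busemann--Hausdorff density.\<close>
  define k0 where "k0 = min 1 ((1 - \<theta>) powr (\<alpha> - p)) * (2 powr (- \<beta>) * exp (- 2)) powr p * (1 - \<theta>\<^sup>2) powr ((real ?n + 1) / 2)"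
  have "\<theta>\<^sup>2 < 1" using th0 th1 by (simp add: power_less_one_iff)
  then have k0: "k0 > 0" unfolding k0_def using th1 by (intro mult_pos_pos) auto
  define T where "T = C1 * (V * R ^ ?n) + lam powr p * K * V / \<tau> ^ ?n"
  have T0: "T \<ge> 0" using C1 K V R tau by (simp add: T_def)
  have main: "(c' - q) * (k0 * (real N * V / 2)) \<le> T" for N :: nat
  proof -
    define P where "P = 2 ^ N * R"
    have "1 * R \<le> 2 ^ N * R" using R by (intro mult_right_mono one_le_power) auto
    then have P: "P \<ge> R" "P \<ge> 1" "P > 0" using R unfolding P_def by linarith+
    \<comment> \<open>Scaled so that d r^(2m) reaches \<tau> exactly at r = P: the middle range ends
      at P, and the support ends no later than P / \<tau>.\<close>
    define d where "d = \<tau> / P ^ (2 * m)"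
    have dy: "d * r ^ (2 * m) = \<tau> * (r / P) ^ (2 * m)" for r by (simp add: d_def power_divide)
    have d0: "d > 0" using tau P by (simp add: d_def)
    have d1: "d \<le> 1"
    proof -
      have "\<tau> / P ^ (2 * m) \<le> \<tau> / 1" using tau P by (intro divide_left_mono one_le_power) auto
      then show ?thesis using tau by (simp add: d_def)
    qed
    have dP: "d * r ^ (2 * m) \<le> \<tau>" if "0 \<le> r" "r \<le> P" for r
      unfolding dy using that P tau power_le_one[of "r / P" "2 * m"] by (simp add: mult_left_le)
    \<comment> \<open>Here \<tau> < 1 is used: 1 / \<tau> is at most its own power 2 m, so passing P
      / \<tau> already makes d r^(2m) at least 1.\<close>
    have dout: "d * r ^ (2 * m) \<ge> 1" if "r \<ge> P / \<tau>" for r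
    proof -
      have "1 / \<tau> \<le> r / P" using that P tau by (simp add: field_simps)
      moreover have "(1 / \<tau>) ^ 1 \<le> (1 / \<tau>) ^ (2 * m)" using tau m by (intro power_increasing) auto
      ultimately have "1 / \<tau> \<le> (r / P) ^ (2 * m)"
        using power_mono[of "1 / \<tau>" "r / P" "2 * m"] tau by simp
      then have "\<tau> * (1 / \<tau>) \<le> \<tau> * (r / P) ^ (2 * m)" using tau by (intro mult_left_mono) auto
      then show ?thesis unfolding dy using tau by simp
    qed
    define u :: "real^'n \<Rightarrow> real" where "u = radial_test m \<beta> d"
    have u: "u \<in> C0_infty" unfolding u_def by (rule radial_test_C0_infty[OF d0 m])
    have sm: "smooth_fun u" using u by (simp add: C0_infty_def)
    have ur: "\<bar>u x\<bar> = profile \<beta> d (norm x ^ (2 * m))" for x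
    proof -
      have "(x \<bullet> x) ^ m = norm x ^ (2 * m)" by (simp add: power_mult power2_norm_eq_inner)
      then show ?thesis using profile_nonneg by (simp add: u_def radial_test_def)
    qed
    have [measurable]: "u \<in> borel_measurable borel"
      by (intro borel_measurable_continuous_onI smooth_fun_continuous_on sm)
    define D where "D x = radial_dual m \<beta> d (norm x)" for x :: "real^'n"
    have [measurable]: "D \<in> borel_measurable borel" unfolding D_def by measurable
    define a where "a x = \<rho> (norm x) powr (\<alpha> - p) * \<bar>u x\<bar> powr p * bh \<theta> \<epsilon> ?n (norm x)" for x
    have [measurable]: "a \<in> borel_measurable borel" unfolding a_def by measurable
    have bhn: "bh \<theta> \<epsilon> ?n (norm x) \<ge> 0" "bh \<theta> \<epsilon> ?n (norm x) \<le> 1" for x :: "real^'n"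
      using bh_pos[of "norm x" ?n] bh_le_1[of "norm x" ?n] by auto
    have a0: "a x \<ge> 0" for x using bhn[of x] by (simp add: a_def)
    define I :: "real^'n \<Rightarrow> ennreal" where "I = indicator {x. R \<le> norm x \<and> norm x \<le> P}"
    have [measurable]: "I \<in> borel_measurable borel" unfolding I_def by measurable
    define S where "S = (\<integral>\<^sup>+x. ennreal (a x) * I x \<partial>lborel)"
    let ?B1 = "cball (0::real^'n) R" and ?B2 = "cball (0::real^'n) (P / \<tau>)"
    \<comment> \<open>The cutoff zone lies between P and P / \<tau>. Its energy density is at most a
      multiple of P^(-n) and its volume at most V (P / \<tau>)^n, so P cancels and \<open>T\<close>
      does not depend on N.\<close>
    define C3 where "C3 = lam powr p * (K * P powr (- real ?n))"
    have C3: "C3 \<ge> 0" using K by (simp add: C3_def)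
    have q0: "q \<ge> 0" by (simp add: q_def)
    have lhs: "(\<integral>\<^sup>+ x. ennreal (\<rho> (norm x) powr \<alpha> * (\<bar>u x\<bar> powr p / \<rho> (norm x) powr p)) \<partial>BH_measure (F_eps \<theta> \<epsilon>))
       = (\<integral>\<^sup>+x. ennreal (a x) \<partial>lborel)"
    proof (subst nn_integral_BH_measure)
      show "(\<integral>\<^sup>+x. ennreal (bh \<theta> \<epsilon> ?n (norm x)) * ennreal (\<rho> (norm x) powr \<alpha> * (\<bar>u x\<bar> powr p / \<rho> (norm x) powr p)) \<partial>lborel)
         = (\<integral>\<^sup>+x. ennreal (a x) \<partial>lborel)"
        using bhn by (intro nn_integral_cong) (simp add: a_def ennreal_mult[symmetric] powr_diff mult_ac)
    qed measurable
    \<comment> \<open>Only the middle range is compared with the Hardy integrand; the origin and the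
      cutoff zone are charged to constants on balls.\<close>
    have pw: "lam powr p * (\<rho> (norm x) powr \<alpha> * D x powr p) * bh \<theta> \<epsilon> ?n (norm x)
        \<le> q * a x * indicator {x. R \<le> norm x \<and> norm x \<le> P} x + C1 * indicator ?B1 x + C3 * indicator ?B2 x" (is "?L \<le> ?R") for x
    proof -
      let ?r = "norm x"
      have ge: "q * a x * indicator {x. R \<le> norm x \<and> norm x \<le> P} x \<ge> 0" "C1 * indicator ?B1 x \<ge> 0" "C3 * indicator ?B2 x \<ge> 0"
        using q0 a0 C1 C3 by auto
      have shrink: "lam powr p * (\<rho> ?r powr \<alpha> * D x powr p) * bh \<theta> \<epsilon> ?n ?r \<le> lam powr p * (\<rho> ?r powr \<alpha> * D x powr p)"
        using bhn[of x] by (intro mult_left_le) auto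
      consider "?r = 0" | "0 < ?r" "?r < R" | "R \<le> ?r" "?r \<le> P" | "P < ?r" "d * ?r ^ (2 * m) < 1" | "d * ?r ^ (2 * m) \<ge> 1"
        using norm_ge_zero[of x] by linarith
      then show ?thesis
      proof cases
        case 1
        then have "?L = 0" by (simp add: rad_def)
        then show ?thesis using ge by linarith
      next
        case 2
        have "lam powr p * (\<rho> ?r powr \<alpha> * D x powr p) \<le> C1"
          unfolding C1_def K_def D_def using 2 p be d0 d1 e by (intro mult_left_mono radial_dual_near) auto
        moreover have "indicator ?B1 x = (1::real)" using 2 by simp
        ultimately show ?thesis using ge shrink by simp
      next
        case 3
        then have r0: "?r > 0" using R by linarith
        have "lam powr p * (\<rho> ?r powr \<alpha> * D x powr p) \<le> q * (\<rho> ?r powr (\<alpha> - p) * profile \<beta> d (?r ^ (2 * m)) powr p)"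
          unfolding q_def D_def
          by (rule radial_dual_middle[OF r0 p be less_imp_le[OF d0] dP tau(2,3) eta l0 R(2)]) (use 3 in auto)
        then have "?L \<le> q * (\<rho> ?r powr (\<alpha> - p) * profile \<beta> d (?r ^ (2 * m)) powr p) * bh \<theta> \<epsilon> ?n ?r"
          using bhn(1)[of x] by (rule mult_right_mono)
        also have "\<dots> = q * a x" by (simp add: a_def ur mult_ac)
        finally show ?thesis using 3 ge by simp
      next
        case 4
        then have r0: "?r > 0" using P by linarith
        have "lam powr p * (\<rho> ?r powr \<alpha> * D x powr p) \<le> lam powr p * (K * ?r powr (- real ?n))"
          unfolding K_def D_def using 4 d0
          by (intro mult_left_mono radial_dual_far[OF r0 p be _ _ gn]) auto
        also have "\<dots> \<le> C3"
          unfolding C3_def using 4 P K by (intro mult_left_mono powr_mono2') auto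
        finally have "lam powr p * (\<rho> ?r powr \<alpha> * D x powr p) \<le> C3" .
        moreover have "?r \<le> P / \<tau>" using dout[of ?r] 4 by linarith
        then have "indicator ?B2 x = (1::real)" by simp
        ultimately show ?thesis using ge shrink by simp
      next
        case 5
        then have "?L = 0" using p by (simp add: D_def radial_dual_outside)
        then show ?thesis using ge by linarith
      qed
    qed
    have "ennreal c' * (\<integral>\<^sup>+x. ennreal (a x) \<partial>lborel) \<le> ennreal (lam powr p) *
       (\<integral>\<^sup>+ x. ennreal (\<rho> (norm x) powr \<alpha> * dual_metric (F_eps \<theta> \<epsilon>) x (frechet_derivative u (at x)) powr p)
                 \<partial>BH_measure (F_eps \<theta> \<epsilon>))"
      using ineq[OF u] unfolding finsler_dist_F_eps[OF th0 e0] lhs .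
    also have "\<dots> \<le> ennreal (lam powr p) * (\<integral>\<^sup>+ x. ennreal (\<rho> (norm x) powr \<alpha> * D x powr p) \<partial>BH_measure (F_eps \<theta> \<epsilon>))"
    proof (intro mult_left_mono nn_integral_mono ennreal_leI powr_mono2)
      fix x :: "real^'n"
      have "bounded_linear (frechet_derivative u (at x))"
        using smooth_fun_differentiable[OF sm] frechet_derivative_works has_derivative_bounded_linear by blast
      then show "0 \<le> dual_metric (F_eps \<theta> \<epsilon>) x (frechet_derivative u (at x))" by (rule dual_metric_nonneg)
      show "dual_metric (F_eps \<theta> \<epsilon>) x (frechet_derivative u (at x)) \<le> D x"
        unfolding u_def D_def using be d0 m by (intro dual_metric_radial_test) auto
    qed (use p in auto)
    also have "\<dots> = (\<integral>\<^sup>+ x. ennreal (lam powr p) * (ennreal (bh \<theta> \<epsilon> ?n (norm x)) * ennreal (\<rho> (norm x) powr \<alpha> * D x powr p)) \<partial>lborel)"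
      by (subst nn_integral_BH_measure, measurable, subst nn_integral_cmult) auto
    also have "\<dots> = (\<integral>\<^sup>+ x. ennreal (lam powr p * (\<rho> (norm x) powr \<alpha> * D x powr p) * bh \<theta> \<epsilon> ?n (norm x)) \<partial>lborel)"
      using bhn by (intro nn_integral_cong) (simp add: ennreal_mult[symmetric] mult_ac)
    also have "\<dots> \<le> (\<integral>\<^sup>+ x. ennreal q * (ennreal (a x) * I x) + (ennreal C1 * indicator ?B1 x + ennreal C3 * indicator ?B2 x) \<partial>lborel)"
    proof (rule nn_integral_mono)
      fix x :: "real^'n"
      have "ennreal (q * a x * indicator {x. R \<le> norm x \<and> norm x \<le> P} x + C1 * indicator ?B1 x + C3 * indicator ?B2 x)
        = ennreal q * (ennreal (a x) * I x) + (ennreal C1 * indicator ?B1 x + ennreal C3 * indicator ?B2 x)"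
        using q0 a0[of x] C1 C3 by (simp add: ennreal_plus ennreal_mult I_def indicator_def add.assoc)
      then show "ennreal (lam powr p * (\<rho> (norm x) powr \<alpha> * D x powr p) * bh \<theta> \<epsilon> ?n (norm x))
        \<le> ennreal q * (ennreal (a x) * I x) + (ennreal C1 * indicator ?B1 x + ennreal C3 * indicator ?B2 x)"
        using ennreal_leI[OF pw[of x]] by simp
    qed
    also have "\<dots> = ennreal q * S + (ennreal C1 * emeasure lborel ?B1 + ennreal C3 * emeasure lborel ?B2)"
    proof -
      have m: "(\<lambda>x. ennreal (a x) * I x) \<in> borel_measurable lborel" by measurable
      have mi: "(\<lambda>x. ennreal C * indicator (cball (0::real^'n) s) x) \<in> borel_measurable lborel" for C s
        by (intro borel_measurable_times_ennreal borel_measurable_const borel_measurable_indicator) simp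
      have i: "(\<integral>\<^sup>+x. ennreal C * indicator (cball (0::real^'n) s) x \<partial>lborel) = ennreal C * emeasure lborel (cball (0::real^'n) s)" for C s
        by (rule nn_integral_cmult_indicator) simp
      have "(\<integral>\<^sup>+ x. ennreal q * (ennreal (a x) * I x) + (ennreal C1 * indicator ?B1 x + ennreal C3 * indicator ?B2 x) \<partial>lborel)
         = (\<integral>\<^sup>+ x. ennreal q * (ennreal (a x) * I x) \<partial>lborel)
           + (\<integral>\<^sup>+ x. ennreal C1 * indicator ?B1 x + ennreal C3 * indicator ?B2 x \<partial>lborel)"
        by (rule nn_integral_add[OF borel_measurable_times_ennreal[OF borel_measurable_const m] borel_measurable_add[OF mi mi]])
      also have "\<dots> = ennreal q * S + (ennreal C1 * emeasure lborel ?B1 + ennreal C3 * emeasure lborel ?B2)"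
        unfolding S_def nn_integral_cmult[OF m] nn_integral_add[OF mi mi] i ..
      finally show ?thesis .
    qed
    also have "ennreal C1 * emeasure lborel ?B1 = ennreal (C1 * (V * R ^ ?n))"
      using R C1 V by (simp add: emeasure_cball V_def ennreal_mult)
    also have "ennreal C3 * emeasure lborel ?B2 = ennreal (C3 * (V * (P / \<tau>) ^ ?n))"
      using P tau C3 V by (simp add: emeasure_cball V_def ennreal_mult)
    also have "C3 * (V * (P / \<tau>) ^ ?n) = lam powr p * K * V / \<tau> ^ ?n"
      using P by (simp add: C3_def powr_minus_divide powr_realpow power_divide)
    also have "ennreal (C1 * (V * R ^ ?n)) + ennreal (lam powr p * K * V / \<tau> ^ ?n) = ennreal T"
      unfolding T_def using C1 V R K tau by (intro ennreal_plus[symmetric]) auto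
    finally have 1: "ennreal c' * (\<integral>\<^sup>+x. ennreal (a x) \<partial>lborel) \<le> ennreal q * S + ennreal T" .
    have "S \<le> (\<integral>\<^sup>+x. ennreal (a x) \<partial>lborel)"
      unfolding S_def I_def by (intro nn_integral_mono) (auto simp: indicator_def)
    then have "ennreal c' * S \<le> ennreal c' * (\<integral>\<^sup>+x. ennreal (a x) \<partial>lborel)" by (rule mult_left_mono) simp
    with 1 have 2: "ennreal c' * S \<le> ennreal q * S + ennreal T" by (rule order_trans[rotated])
    \<comment> \<open>Finiteness of S, needed to subtract q S. As R is at least 1, the shell stays
      outside the ball of radius 1/2, so \<open>hardy_cut_finite\<close> applies.\<close>
    have "S \<le> (\<integral>\<^sup>+x. ennreal (a x) * indicator {x. norm x > 1 / 2} x \<partial>lborel)"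
      unfolding S_def I_def using R by (intro nn_integral_mono) (auto simp: indicator_def)
    also have "\<dots> < \<infinity>" unfolding a_def by (rule hardy_cut_finite[OF u p]) simp
    finally obtain s where s: "S = ennreal s" "s \<ge> 0" by (cases S) auto
    have "ennreal (c' * s) \<le> ennreal (q * s + T)"
      using 2 s c' q0 T0 by (simp add: ennreal_mult ennreal_plus)
    then have 3: "c' * s \<le> q * s + T" using q0 s T0 by (subst (asm) ennreal_le_iff) auto
    have "ennreal (k0 * (real N * V / 2)) = ennreal k0 * ennreal (real N * V / 2)"
      using k0 V by (intro ennreal_mult) auto
    also have "\<dots> \<le> ennreal k0 * (\<integral>\<^sup>+x. ennreal (norm x powr (- real ?n)) * I x \<partial>lborel)"
      unfolding V_def I_def P_def using R by (intro mult_left_mono nn_integral_shells) auto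
    also have "\<dots> = (\<integral>\<^sup>+x. ennreal k0 * (ennreal (norm x powr (- real ?n)) * I x) \<partial>lborel)"
      by (rule nn_integral_cmult[symmetric]) measurable
    also have "\<dots> \<le> S"
      unfolding S_def
    proof (rule nn_integral_mono)
      fix x :: "real^'n"
      show "ennreal k0 * (ennreal (norm x powr (- real ?n)) * I x) \<le> ennreal (a x) * I x"
      proof (cases "R \<le> norm x \<and> norm x \<le> P")
        case True
        have "min 1 ((1 - \<theta>) powr (\<alpha> - p)) * (2 powr (- \<beta>) * exp (- 2)) powr p * norm x powr (- real ?n)
           \<le> \<rho> (norm x) powr (\<alpha> - p) * profile \<beta> d (norm x ^ (2 * m)) powr p"
        proof (rule profile_lower[OF _ p be _ gn])
          show "1 \<le> norm x" using True R by linarith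
          show "d * norm x ^ (2 * m) \<le> 1 / 2" using dP[of "norm x"] True tau(2) by simp
        qed
        then have "min 1 ((1 - \<theta>) powr (\<alpha> - p)) * (2 powr (- \<beta>) * exp (- 2)) powr p * norm x powr (- real ?n)
             * (1 - \<theta>\<^sup>2) powr ((real ?n + 1) / 2) \<le> a x"
          unfolding a_def ur by (rule mult_mono[OF _ bh_ge]) auto
        then have "k0 * norm x powr (- real ?n) \<le> a x" by (simp add: k0_def mult_ac)
        then have "ennreal (k0 * norm x powr (- real ?n)) \<le> ennreal (a x)" by (rule ennreal_leI)
        then show ?thesis using True k0 by (simp add: I_def ennreal_mult)
      qed (simp add: I_def)
    qed
    finally have 4: "k0 * (real N * V / 2) \<le> s" using s by (simp add: ennreal_le_iff)
    have "(c' - q) * (k0 * (real N * V / 2)) \<le> (c' - q) * s" using 4 cq by (intro mult_left_mono) auto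
    also have "\<dots> \<le> T" using 3 by (simp add: algebra_simps)
    finally show ?thesis .
  qed
  define w where "w = (c' - q) * (k0 * (V / 2))"
  have w: "w > 0" using cq k0 V by (simp add: w_def)
  obtain N :: nat where "real N > T / w" using reals_Archimedean2 by blast
  then have "real N * w > T" using w by (simp add: pos_divide_less_eq)
  then show False using main[of N] by (simp add: w_def mult_ac)
qed

end

theorem theorem4p4:
  fixes lam \<alpha> p :: real
  assumes n3: "CARD('n::finite) \<ge> 3"
    and lam: "lam > 1"
    and p1: "1 < p" and p2: "p < real CARD('n) + \<alpha>"
  defines "\<theta> \<equiv> (lam - 1) / (lam + 1)"
    and "c \<equiv> ((real CARD('n) + \<alpha> - p) / p) powr p"
  shows "(\<forall>\<epsilon>>0. \<forall>u\<in>(C0_infty :: (real^'n \<Rightarrow> real) set).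
            ennreal (lam powr p) *
              (\<integral>\<^sup>+ x. ennreal (finsler_dist (F_eps \<theta> \<epsilon>) 0 x powr \<alpha> *
                   dual_metric (F_eps \<theta> \<epsilon>) x (frechet_derivative u (at x)) powr p)
                 \<partial>BH_measure (F_eps \<theta> \<epsilon>))
            \<ge> ennreal c *
              (\<integral>\<^sup>+ x. ennreal (finsler_dist (F_eps \<theta> \<epsilon>) 0 x powr \<alpha> *
                   (\<bar>u x\<bar> powr p / finsler_dist (F_eps \<theta> \<epsilon>) 0 x powr p))
                 \<partial>BH_measure (F_eps \<theta> \<epsilon>)))
     \<and> (\<forall>c'::real. (\<forall>\<epsilon>>0. \<forall>u\<in>(C0_infty :: (real^'n \<Rightarrow> real) set).
            ennreal (lam powr p) *
              (\<integral>\<^sup>+ x. ennreal (finsler_dist (F_eps \<theta> \<epsilon>) 0 x powr \<alpha> *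
                   dual_metric (F_eps \<theta> \<epsilon>) x (frechet_derivative u (at x)) powr p)
                 \<partial>BH_measure (F_eps \<theta> \<epsilon>))
            \<ge> ennreal c' *
              (\<integral>\<^sup>+ x. ennreal (finsler_dist (F_eps \<theta> \<epsilon>) 0 x powr \<alpha> *
                   (\<bar>u x\<bar> powr p / finsler_dist (F_eps \<theta> \<epsilon>) 0 x powr p))
                 \<partial>BH_measure (F_eps \<theta> \<epsilon>)))
          \<longrightarrow> c' \<le> c)"
proof (intro conjI allI impI ballI)
  have th: "0 \<le> \<theta>" "\<theta> < 1" using lam by (auto simp: \<theta>_def)
  have lam': "lam = (1 + \<theta>) / (1 - \<theta>)" using lam by (simp add: \<theta>_def field_simps)
  have rand: "randers \<theta> \<epsilon>" if "\<epsilon> > 0" for \<epsilon> using th that by unfold_locales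
  show "ennreal c *
              (\<integral>\<^sup>+ x. ennreal (finsler_dist (F_eps \<theta> \<epsilon>) 0 x powr \<alpha> *
                   (\<bar>u x\<bar> powr p / finsler_dist (F_eps \<theta> \<epsilon>) 0 x powr p))
                 \<partial>BH_measure (F_eps \<theta> \<epsilon>))
         \<le> ennreal (lam powr p) *
              (\<integral>\<^sup>+ x. ennreal (finsler_dist (F_eps \<theta> \<epsilon>) 0 x powr \<alpha> *
                   dual_metric (F_eps \<theta> \<epsilon>) x (frechet_derivative u (at x)) powr p)
                 \<partial>BH_measure (F_eps \<theta> \<epsilon>))"
    if "\<epsilon> > 0" "u \<in> C0_infty" for \<epsilon> and u :: "real^'n \<Rightarrow> real"
    unfolding c_def by (rule randers.hardy_inequality[OF rand[OF that(1)] that(2) p1 p2 lam'])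
  fix c' :: real
  assume H: "\<forall>\<epsilon>>0. \<forall>u\<in>(C0_infty :: (real^'n \<Rightarrow> real) set).
            ennreal (lam powr p) *
              (\<integral>\<^sup>+ x. ennreal (finsler_dist (F_eps \<theta> \<epsilon>) 0 x powr \<alpha> *
                   dual_metric (F_eps \<theta> \<epsilon>) x (frechet_derivative u (at x)) powr p)
                 \<partial>BH_measure (F_eps \<theta> \<epsilon>))
            \<ge> ennreal c' *
              (\<integral>\<^sup>+ x. ennreal (finsler_dist (F_eps \<theta> \<epsilon>) 0 x powr \<alpha> *
                   (\<bar>u x\<bar> powr p / finsler_dist (F_eps \<theta> \<epsilon>) 0 x powr p))
                 \<partial>BH_measure (F_eps \<theta> \<epsilon>))"
  let ?g = "(real CARD('n) + \<alpha> - p) / p"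
  show "c' \<le> c"
  \<comment> \<open>For nonpositive c' the hypothesis carries no information, since
    \<open>ennreal c'\<close> is 0; the claim then rests on c being nonnegative.\<close>
  proof (cases "c' > 0")
    case False
    then show ?thesis unfolding c_def using powr_ge_zero[of ?g p] by linarith
  next
    case True
    \<comment> \<open>The value \<epsilon> = 1 is an arbitrary member of the family: the estimate
      takes place at infinity, where the drift tends to \<theta> for every \<epsilon>.\<close>
    have est: "c' \<le> ((1 + \<eta>) * (?g + \<eta>)) powr p" if "\<eta> > 0" for \<eta>
      by (rule randers.sharpness_estimate[OF rand[of 1] p1 p2 lam' that True]) (use H in auto)
    have "?g > 0" using p1 p2 by simp
    then have "((\<lambda>\<eta>. ((1 + \<eta>) * (?g + \<eta>)) powr p) \<longlongrightarrow> ((1 + 0) * (?g + 0)) powr p) (at_right 0)"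
      by (intro tendsto_intros) auto
    moreover have "\<forall>\<^sub>F \<eta> in at_right 0. c' \<le> ((1 + \<eta>) * (?g + \<eta>)) powr p"
      using est by (auto simp: eventually_at_filter)
    ultimately show ?thesis
      unfolding c_def using tendsto_lowerbound[of _ _ "at_right (0::real)" c'] by simp
  qed
qed

end
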